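(* Let $n\ge1$ be an integer, and let $(y^1,y_r^1,y_l^1)$ and $(y^2,y_r^2,y_l^2)$ be two weak solutions on $[0,T]$ of the higher-order Camassa-Holm equation with the same initial and boundary conditions $(y_0,\mathbf{v_l},\mathbf{v_r},y_r^c,y_l^c)$. Then $$(y^1,y_r^1,y_l^1)=(y^2,y_r^2,y_l^2)$$ on the interval $[0,T]$.
   Context: Fix $T>0$, $\Omega_T:=[0,T]\times(0,1)$. For $n\ge1$, $\mathrm A_n:=\sum_{k=0}^n(-\partial_x^2)^k$ and $\mathbf A_n^{1/2}:=(\mathrm{Id},\partial_x,\dots,\partial_x^n)$, with $\cdot$ the standard scalar product on $\mathbb R^{n+1}$. The higher-order Camassa-Holm system is $\partial_ty+v\,\partial_xy=-2y\,\partial_xv$, $\mathrm A_nv=y$ on $(0,1)$. Data: $v_l,v_r\in C^0([0,T])$ are non-zero except on a finite set; $\Gamma_l:=\{t\in[0,T]:v_l(t)>0\}$, $\Gamma_r:=\{t\in[0,T]:v_r(t)<0\}$; $y_0\in L^\infty(0,1)$, $y_r^c\in L^\infty(\Gamma_r)$, $y_l^c\in L^\infty(\Gamma_l)$; $\mathbf{v_l},\mathbf{v_r}\in C^0([0,T])^n$, with components indexed by $i=0,\dots,n-1$, and $(\mathbf{v_l})_0=v_l$, $(\mathbf{v_r})_0=v_r$ (admissibility). Velocity associated with $y$: for each $t$, $v(t,\cdot)$ is the unique function in $H^n(0,1)$ with $\partial_x^iv(t,0)=(\mathbf{v_l})_i(t)$, $\partial_x^iv(t,1)=(\mathbf{v_r})_i(t)$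 for $i=0,\dots,n-1$, and $\int_0^1\mathbf A_n^{1/2}v(t,\cdot)\cdot\mathbf A_n^{1/2}g=\int_0^1y(t,\cdot)g$ for all $g\in H^n_0(0,1)$ (variational form of $\mathrm A_nv=y$). Weak solution: a triple $(y,y_r,y_l)\in (L^\infty(\Omega_T)\cap C^0([0,T],L^2(0,1)))\times L^\infty([0,T])^2$ is a weak solution with data $(y_0,\mathbf{v_l},\mathbf{v_r},y_r^c,y_l^c)$ if $y_{|t=0}=y_0$, $(y_r)_{|\Gamma_r}=y_r^c$, $(y_l)_{|\Gamma_l}=y_l^c$, and for all $0\le t_0\le t_1<T$ and all $\phi\in H^1([t_0,t_1]\times[0,1])$, $$\int_{t_0}^{t_1}\!\!\int_0^1\big(y\,\partial_t\phi+yv\,\partial_x\phi-y\,\partial_xv\,\phi\big)=\int_{t_0}^{t_1}\big(y_rv_r\phi(\cdot,1)-y_lv_l\phi(\cdot,0)\big)+\int_0^1\phi(t_1,\cdot)y(t_1,\cdot)-\int_0^1\phi(t_0,\cdot)y(t_0,\cdot),$$ where $v$ is the velocity associated with $y$. *)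

theory Defs
  imports "HOL-Analysis.Analysis"
begin

text \<open>
  Elements of \<open>L\<^sup>2\<close> and \<open>L\<^sup>\<infinity>\<close> spaces are given by Borel representatives (every class of
  Lebesgue measurable functions has one); equality of classes is equality almost everywhere.
  A function of time and space is curried, so that \<open>y t\<close> is the slice at time \<open>t\<close>.
\<close>

definition L2_on :: "'a::euclidean_space set \<Rightarrow> ('a \<Rightarrow> real) \<Rightarrow> bool" where
  "L2_on S f \<longleftrightarrow> set_borel_measurable lborel S f \<and> set_integrable lborel S (\<lambda>x. (f x)\<^sup>2)"

definition Linf_on :: "'a::euclidean_space set \<Rightarrow> ('a \<Rightarrow> real) \<Rightarrow> bool" where
  "Linf_on S f \<longleftrightarrow> set_borel_measurable lborel S f \<and>
     (\<exists>C. AE x in lborel. x \<in> S \<longrightarrow> \<bar>f x\<bar> \<le> C)"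

definition L2_dist_sq :: "'a::euclidean_space set \<Rightarrow> ('a \<Rightarrow> real) \<Rightarrow> ('a \<Rightarrow> real) \<Rightarrow> real" where
  "L2_dist_sq S f g = (LINT x:S|lborel. (f x - g x)\<^sup>2)"

definition ae_eq_on :: "'a::euclidean_space set \<Rightarrow> ('a \<Rightarrow> real) \<Rightarrow> ('a \<Rightarrow> real) \<Rightarrow> bool" where
  "ae_eq_on S f g \<longleftrightarrow> (AE x in lborel. x \<in> S \<longrightarrow> f x = g x)"

definition C0_L2 :: "real \<Rightarrow> (real \<Rightarrow> real \<Rightarrow> real) \<Rightarrow> bool" where
  "C0_L2 T y \<longleftrightarrow> (\<forall>t\<in>{0..T}. L2_on {0<..<1} (y t) \<and>
     ((\<lambda>s. L2_dist_sq {0<..<1} (y s) (y t)) \<longlongrightarrow> 0) (at t within {0..T}))"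


section \<open>Sobolev spaces on the unit interval\<close>

definition weak_deriv :: "(real \<Rightarrow> real) \<Rightarrow> (real \<Rightarrow> real) \<Rightarrow> bool" where
  "weak_deriv u u' \<longleftrightarrow>
     (\<forall>\<psi> \<psi>' K. (\<forall>x. (\<psi> has_real_derivative \<psi>' x) (at x)) \<and> continuous_on UNIV \<psi>' \<and>
        compact K \<and> K \<subseteq> {0<..<1} \<and> (\<forall>x. x \<notin> K \<longrightarrow> \<psi> x = 0) \<longrightarrow>
        (LINT x:{0<..<1}|lborel. u x * \<psi>' x) = - (LINT x:{0<..<1}|lborel. u' x * \<psi> x))"

text \<open>
  \<open>Hn_jet n d\<close> says that \<open>d 0 \<in> H\<^sup>n(0,1)\<close> and that \<open>d i\<close> is its \<open>i\<close>-th weak derivative for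
  \<open>i \<le> n\<close>. The derivatives of order below \<open>n\<close> are represented by their continuous
  representatives on \<open>[0,1]\<close>, so that their boundary values are \<open>d i 0\<close> and \<open>d i 1\<close>; the
  derivative of order \<open>n\<close> is only an \<open>L\<^sup>2\<close> class.
\<close>

definition Hn_jet :: "nat \<Rightarrow> (nat \<Rightarrow> real \<Rightarrow> real) \<Rightarrow> bool" where
  "Hn_jet n d \<longleftrightarrow>
     (\<forall>i\<le>n. L2_on {0<..<1} (d i)) \<and>
     (\<forall>i<n. weak_deriv (d i) (d (Suc i)) \<and> continuous_on {0..1} (d i))"

definition Hn0_jet :: "nat \<Rightarrow> (nat \<Rightarrow> real \<Rightarrow> real) \<Rightarrow> bool" where
  "Hn0_jet n d \<longleftrightarrow> Hn_jet n d \<and> (\<forall>i<n. d i 0 = 0 \<and> d i 1 = 0)"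


section \<open>The space \<open>H\<^sup>1\<close> on a space-time rectangle\<close>

definition C1_plane ::
    "(real \<Rightarrow> real \<Rightarrow> real) \<Rightarrow> (real \<Rightarrow> real \<Rightarrow> real) \<Rightarrow> (real \<Rightarrow> real \<Rightarrow> real) \<Rightarrow> bool" where
  "C1_plane \<psi> \<psi>t \<psi>x \<longleftrightarrow>
     (\<forall>t x. ((\<lambda>(s, z). \<psi> s z) has_derivative (\<lambda>(a, b). a * \<psi>t t x + b * \<psi>x t x)) (at (t, x))) \<and>
     continuous_on UNIV (\<lambda>(t, x). \<psi>t t x) \<and> continuous_on UNIV (\<lambda>(t, x). \<psi>x t x)"

definition H1_rect ::
    "real \<Rightarrow> real \<Rightarrow> (real \<Rightarrow> real \<Rightarrow> real) \<Rightarrow> (real \<Rightarrow> real \<Rightarrow> real) \<Rightarrow>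
     (real \<Rightarrow> real \<Rightarrow> real) \<Rightarrow> bool" where
  "H1_rect t0 t1 \<phi> \<phi>t \<phi>x \<longleftrightarrow>
     (let Q = {t0..t1} \<times> {0..1} in
      L2_on Q (\<lambda>(t, x). \<phi> t x) \<and> L2_on Q (\<lambda>(t, x). \<phi>t t x) \<and> L2_on Q (\<lambda>(t, x). \<phi>x t x) \<and>
      (\<forall>\<psi> \<psi>t \<psi>x K. C1_plane \<psi> \<psi>t \<psi>x \<and> compact K \<and> K \<subseteq> {t0<..<t1} \<times> {0<..<1} \<and>
         (\<forall>t x. (t, x) \<notin> K \<longrightarrow> \<psi> t x = 0) \<longrightarrow>
         (LINT (t, x):Q|lborel. \<phi> t x * \<psi>t t x) = - (LINT (t, x):Q|lborel. \<phi>t t x * \<psi> t x) \<and>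
         (LINT (t, x):Q|lborel. \<phi> t x * \<psi>x t x) = - (LINT (t, x):Q|lborel. \<phi>x t x * \<psi> t x)))"

text \<open>
  The boundary of the rectangle is a null set, so an element of \<open>H\<^sup>1\<close> has representatives with
  arbitrary values there. The following condition selects those whose values on the four edges
  are the traces: the trace is the \<open>L\<^sup>2\<close> limit of the restrictions to the edges of functions
  that are \<open>C\<^sup>1\<close> up to the boundary and converge in \<open>H\<^sup>1\<close>. As such functions are dense and the
  trace operator is bounded, every element of \<open>H\<^sup>1\<close> has such a representative. Using one
  sequence for all edges makes the condition meaningful also for \<open>t0 = t1\<close>.
\<close>

definition edge_values_are_traces ::
    "real \<Rightarrow> real \<Rightarrow> (real \<Rightarrow> real \<Rightarrow> real) \<Rightarrow> (real \<Rightarrow> real \<Rightarrow> real) \<Rightarrow>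
     (real \<Rightarrow> real \<Rightarrow> real) \<Rightarrow> bool" where
  "edge_values_are_traces t0 t1 \<phi> \<phi>t \<phi>x \<longleftrightarrow>
     (let Q = {t0..t1} \<times> {0..1} in
      (\<forall>x\<in>{0, 1}. L2_on {t0..t1} (\<lambda>t. \<phi> t x)) \<and> (\<forall>t\<in>{t0, t1}. L2_on {0..1} (\<phi> t)) \<and>
      (\<exists>\<Psi> \<Psi>t \<Psi>x :: nat \<Rightarrow> real \<Rightarrow> real \<Rightarrow> real.
         (\<forall>k. C1_plane (\<Psi> k) (\<Psi>t k) (\<Psi>x k)) \<and>
         (\<lambda>k. L2_dist_sq Q (\<lambda>(t, x). \<Psi> k t x) (\<lambda>(t, x). \<phi> t x)) \<longlonglongrightarrow> 0 \<and>
         (\<lambda>k. L2_dist_sq Q (\<lambda>(t, x). \<Psi>t k t x) (\<lambda>(t, x). \<phi>t t x)) \<longlonglongrightarrow> 0 \<and>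
         (\<lambda>k. L2_dist_sq Q (\<lambda>(t, x). \<Psi>x k t x) (\<lambda>(t, x). \<phi>x t x)) \<longlonglongrightarrow> 0 \<and>
         (\<forall>x\<in>{0, 1}. (\<lambda>k. L2_dist_sq {t0..t1} (\<lambda>t. \<Psi> k t x) (\<lambda>t. \<phi> t x)) \<longlonglongrightarrow> 0) \<and>
         (\<forall>t\<in>{t0, t1}. (\<lambda>k. L2_dist_sq {0..1} (\<Psi> k t) (\<phi> t)) \<longlonglongrightarrow> 0)))"


section \<open>The higher-order Camassa--Holm system\<close>

definition Gamma_l :: "real \<Rightarrow> (real \<Rightarrow> real) \<Rightarrow> real set" where
  "Gamma_l T vl = {t \<in> {0..T}. vl t > 0}"

definition Gamma_r :: "real \<Rightarrow> (real \<Rightarrow> real) \<Rightarrow> real set" where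
  "Gamma_r T vr = {t \<in> {0..T}. vr t < 0}"

text \<open>
  \<open>bvl\<close> and \<open>bvr\<close> are the vectors of boundary velocities; only the components with index
  below \<open>n\<close> are used.
\<close>

definition CH_data ::
    "real \<Rightarrow> nat \<Rightarrow> (real \<Rightarrow> real) \<Rightarrow> (real \<Rightarrow> real) \<Rightarrow> (real \<Rightarrow> real) \<Rightarrow>
     (nat \<Rightarrow> real \<Rightarrow> real) \<Rightarrow> (nat \<Rightarrow> real \<Rightarrow> real) \<Rightarrow> (real \<Rightarrow> real) \<Rightarrow> (real \<Rightarrow> real) \<Rightarrow> bool" where
  "CH_data T n vl vr y0 bvl bvr yrc ylc \<longleftrightarrow>
     continuous_on {0..T} vl \<and> continuous_on {0..T} vr \<and>
     finite {t \<in> {0..T}. vl t = 0} \<and> finite {t \<in> {0..T}. vr t = 0} \<and>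
     Linf_on {0<..<1} y0 \<and> Linf_on (Gamma_r T vr) yrc \<and> Linf_on (Gamma_l T vl) ylc \<and>
     (\<forall>i<n. continuous_on {0..T} (bvl i) \<and> continuous_on {0..T} (bvr i)) \<and>
     (\<forall>t\<in>{0..T}. bvl 0 t = vl t \<and> bvr 0 t = vr t)"

text \<open>
  \<open>V i t\<close> is the \<open>i\<close>-th space derivative of the velocity \<open>v(t,\<cdot>) = V 0 t\<close>. The measurability
  condition restricts only the choice of the representatives of the classes of the derivatives
  of order \<open>n\<close>, which would otherwise be independent for different times.
\<close>

definition is_velocity ::
    "real \<Rightarrow> nat \<Rightarrow> (nat \<Rightarrow> real \<Rightarrow> real) \<Rightarrow> (nat \<Rightarrow> real \<Rightarrow> real) \<Rightarrow> (real \<Rightarrow> real \<Rightarrow> real) \<Rightarrow>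
     (nat \<Rightarrow> real \<Rightarrow> real \<Rightarrow> real) \<Rightarrow> bool" where
  "is_velocity T n bvl bvr y V \<longleftrightarrow>
     (\<forall>i\<le>n. set_borel_measurable lborel ({0..T} \<times> {0<..<1}) (\<lambda>(t, x). V i t x)) \<and>
     (\<forall>t\<in>{0..T}.
        Hn_jet n (\<lambda>i. V i t) \<and>
        (\<forall>i<n. V i t 0 = bvl i t \<and> V i t 1 = bvr i t) \<and>
        (\<forall>g. Hn0_jet n g \<longrightarrow>
           (LINT x:{0<..<1}|lborel. (\<Sum>i\<le>n. V i t x * g i x)) =
           (LINT x:{0<..<1}|lborel. y t x * g 0 x)))"

definition weak_solution ::
    "real \<Rightarrow> nat \<Rightarrow> (real \<Rightarrow> real) \<Rightarrow> (real \<Rightarrow> real) \<Rightarrow> (real \<Rightarrow> real) \<Rightarrow>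
     (nat \<Rightarrow> real \<Rightarrow> real) \<Rightarrow> (nat \<Rightarrow> real \<Rightarrow> real) \<Rightarrow> (real \<Rightarrow> real) \<Rightarrow> (real \<Rightarrow> real) \<Rightarrow>
     (real \<Rightarrow> real \<Rightarrow> real) \<Rightarrow> (real \<Rightarrow> real) \<Rightarrow> (real \<Rightarrow> real) \<Rightarrow> bool" where
  "weak_solution T n vl vr y0 bvl bvr yrc ylc y yr yl \<longleftrightarrow>
     Linf_on ({0..T} \<times> {0<..<1}) (\<lambda>(t, x). y t x) \<and> C0_L2 T y \<and>
     Linf_on {0..T} yr \<and> Linf_on {0..T} yl \<and>
     ae_eq_on {0<..<1} (y 0) y0 \<and>
     ae_eq_on (Gamma_r T vr) yr yrc \<and> ae_eq_on (Gamma_l T vl) yl ylc \<and>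
     (\<exists>V. is_velocity T n bvl bvr y V \<and>
        (\<forall>t0 t1 \<phi> \<phi>t \<phi>x.
           0 \<le> t0 \<and> t0 \<le> t1 \<and> t1 < T \<and>
           H1_rect t0 t1 \<phi> \<phi>t \<phi>x \<and> edge_values_are_traces t0 t1 \<phi> \<phi>t \<phi>x \<longrightarrow>
           (LINT (t, x):{t0..t1} \<times> {0<..<1}|lborel.
              y t x * \<phi>t t x + y t x * V 0 t x * \<phi>x t x - y t x * V 1 t x * \<phi> t x) =
           (LINT t:{t0..t1}|lborel. yr t * vr t * \<phi> t 1 - yl t * vl t * \<phi> t 0)
           + (LINT x:{0<..<1}|lborel. \<phi> t1 x * y t1 x)
           - (LINT x:{0<..<1}|lborel. \<phi> t0 x * y t0 x)))"

end

theory Submission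
  imports Defs
begin

text \<open>
  Let \<open>Y\<close> be the difference of the two solutions and \<open>D \<in> H\<^sup>n\<^sub>0(0,1)\<close> that of their velocities.
  The idea is to estimate \<open>Y\<close> in a negative norm adapted to the boundary. Between two zeros
  of the boundary velocities each end is either an inflow or an outflow end; let \<open>W\<close> solve
  \<open>-W'' = Y\<close> with \<open>W = 0\<close> at outflow ends and the Robin condition \<open>\<partial>\<^sub>\<nu> W = -W\<close> at inflow
  ends, and let \<open>E = \<integral> Y W = \<integral> W'\<^sup>2 + W(0)\<^sup>2 + W(1)\<^sup>2\<close>. By symmetry
  \<open>E(t) - E(s) = \<integral> (Y(t) - Y(s)) (W(t) + W(s))\<close>, so the weak formulation is only needed for the
  time-independent test function \<open>W(t) + W(s)\<close>, whose boundary terms vanish: at outflow ends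
  because \<open>W = 0\<close>, at inflow ends because the boundary data coincide. Integrating by parts with
  \<open>Y = -W''\<close>, the term \<open>-v W'\<^sup>2 / 2\<close> at the boundary has the good sign at outflow ends and is
  controlled by \<open>E\<close> at inflow ends, while \<open>\<parallel>D'\<parallel>\<^sup>2 \<le> \<integral> Y D = \<integral> W' D'\<close> gives
  \<open>\<parallel>D'\<parallel>\<^sup>2 \<le> E\<close>. Hence the upper Dini derivative of \<open>E\<close> is at most \<open>C E\<close>, and Gronwall's lemma
  propagates \<open>Y = 0\<close> across the interval; the zeros are finitely many.
\<close>

section \<open>Square integrable functions on the unit interval\<close>

text \<open>The obstacle is a lost derivative. Subtracting the equations leaves \<open>D\<close>
  times the space derivative of the second solution, which is merely bounded; a mean-square estimate
  of \<open>Y\<close> would have to differentiate it. Hence the negative norm, which gives away one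
  derivative. The boundary dictates which negative norm. With a Dirichlet condition at an inflow
  end, \<open>v W'^2 / 2\<close> has the bad sign there and \<open>W'\<close> at that end is not
  controlled by the energy. With Neumann conditions at two inflow ends, \<open>-W'' = Y\<close> is
  solvable only for \<open>Y\<close> of mean zero. The Robin condition avoids both: the boundary
  slope equals the boundary value up to sign, and the square of that value is part of the energy.
  The nonlinearity is split as \<open>y1 v1 - y2 v2 = Y v1 + y2 D\<close>, so that two derivatives
  fall on the first velocity only. For \<open>n = 1\<close> the second one comes from the elliptic
  equation, and only in mean square. At outflow ends the traces are unknown during the estimate.
  Once \<open>Y = 0\<close>, the weak formulation reduces to its boundary integral, and the test
  functions \<open>x\<close> and \<open>x - 1\<close> recover the traces one end at a time.\<close>

definition U :: "real measure" where "U = restrict_space lborel {0<..<1}"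

lemma space_U [simp]: "space U = {0<..<1}"
  by (simp add: U_def space_restrict_space)

lemma borel_measurable_UI: "f \<in> borel_measurable borel \<Longrightarrow> f \<in> borel_measurable U"
  unfolding U_def by (rule measurable_restrict_space1) simp

lemma integral_U:
  fixes f :: "real \<Rightarrow> real"
  shows "integral\<^sup>L U f = (LINT x:{0<..<1}|lborel. f x)"
  unfolding U_def set_lebesgue_integral_def by (subst integral_restrict_space) auto

lemma integrable_U:
  fixes f :: "real \<Rightarrow> real"
  shows "integrable U f \<longleftrightarrow> set_integrable lborel {0<..<1} f"
  unfolding U_def set_integrable_def by (subst integrable_restrict_space) auto

lemma borel_measurable_U:
  fixes f :: "real \<Rightarrow> real"
  shows "f \<in> borel_measurable U \<longleftrightarrow> set_borel_measurable lborel {0<..<1} f"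
  unfolding U_def set_borel_measurable_def
  by (subst borel_measurable_restrict_space_iff) (auto simp: mult.commute)

lemma AE_U: "(AE x in U. P x) \<longleftrightarrow> (AE x in lborel. x \<in> {0<..<1} \<longrightarrow> P x)"
  unfolding U_def by (subst AE_restrict_space_iff) auto

lemma emeasure_U: "emeasure U (space U) = 1"
  unfolding space_U U_def by (subst emeasure_restrict_space) auto

interpretation U: finite_measure U
  by standard (use emeasure_U in auto)

lemma measure_U [simp]: "measure U {0<..<1} = 1"
  using emeasure_U by (simp add: measure_def)

lemma L2_on_U: "L2_on {0<..<1} f \<longleftrightarrow> f \<in> borel_measurable U \<and> integrable U (\<lambda>x. (f x)\<^sup>2)"
  unfolding L2_on_def borel_measurable_U integrable_U ..

abbreviation L2 :: "(real \<Rightarrow> real) \<Rightarrow> bool" where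
  "L2 \<equiv> L2_on {0<..<1}"

abbreviation sqnorm :: "(real \<Rightarrow> real) \<Rightarrow> real" where
  "sqnorm f \<equiv> \<integral>x. (f x)\<^sup>2 \<partial>U"

lemma L2_measurable: "L2 f \<Longrightarrow> f \<in> borel_measurable U"
  and L2_square: "L2 f \<Longrightarrow> integrable U (\<lambda>x. (f x)\<^sup>2)"
  by (simp_all add: L2_on_U)

lemma L2_mult_integrable:
  assumes "L2 f" "L2 g"
  shows "integrable U (\<lambda>x. f x * g x)"
proof (rule Bochner_Integration.integrable_bound)
  show "integrable U (\<lambda>x. (f x)\<^sup>2 + (g x)\<^sup>2)"
    using assms by (simp add: L2_square)
  show "(\<lambda>x. f x * g x) \<in> borel_measurable U"
    using borel_measurable_times[OF assms[THEN L2_measurable]] .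
  have "\<bar>a * b\<bar> \<le> a\<^sup>2 + b\<^sup>2" for a b :: real
    using sum_squares_bound[of "\<bar>a\<bar>" "\<bar>b\<bar>"] by (simp add: abs_mult mult.assoc) (smt (verit) mult_nonneg_nonneg abs_ge_zero)
  then show "AE x in U. norm (f x * g x) \<le> norm ((f x)\<^sup>2 + (g x)\<^sup>2)"
    by simp
qed

lemma L2_const [simp]: "L2 (\<lambda>x. c)"
  by (simp add: L2_on_U)

lemma L2_integrable: "L2 f \<Longrightarrow> integrable U f"
  using L2_mult_integrable[of f "\<lambda>x. 1"] by simp

lemma L2_add:
  assumes "L2 f" "L2 g"
  shows "L2 (\<lambda>x. f x + g x)"
proof -
  have "integrable U (\<lambda>x. (f x)\<^sup>2 + (g x)\<^sup>2 + 2 * (f x * g x))"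
    using assms by (intro Bochner_Integration.integrable_add integrable_mult_right L2_square L2_mult_integrable)
  then show ?thesis
    using assms by (auto simp: L2_on_U power2_sum algebra_simps)
qed

lemma L2_cmult: "L2 f \<Longrightarrow> L2 (\<lambda>x. c * f x)"
  by (auto simp: L2_on_U power_mult_distrib intro: borel_measurable_times)

lemma L2_diff: "L2 f \<Longrightarrow> L2 g \<Longrightarrow> L2 (\<lambda>x. f x - g x)"
  using L2_add[OF _ L2_cmult[where c="-1"], of f g] by simp

lemma L2_uminus: "L2 f \<Longrightarrow> L2 (\<lambda>x. - f x)"
  using L2_cmult[of f "-1"] by simp

lemma L2_mult_bounded:
  assumes "L2 f" "g \<in> borel_measurable U" "\<And>x. x \<in> {0<..<1} \<Longrightarrow> \<bar>g x\<bar> \<le> B"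
  shows "L2 (\<lambda>x. f x * g x)"
proof -
  have "integrable U (\<lambda>x. (f x * g x)\<^sup>2)"
  proof (rule Bochner_Integration.integrable_bound)
    show "integrable U (\<lambda>x. B\<^sup>2 * (f x)\<^sup>2)"
      using assms by (simp add: L2_square)
    show "(\<lambda>x. (f x * g x)\<^sup>2) \<in> borel_measurable U"
      using borel_measurable_power[OF borel_measurable_times[OF L2_measurable[OF assms(1)] assms(2)]] .
    have "(f x * g x)\<^sup>2 \<le> B\<^sup>2 * (f x)\<^sup>2" if "x \<in> {0<..<1}" for x
    proof -
      have "(g x)\<^sup>2 \<le> B\<^sup>2"
        using power_mono[OF assms(3)[OF that], of 2] by simp
      then show ?thesis
        unfolding power_mult_distrib mult.commute[of "B\<^sup>2"] by (rule mult_left_mono) simp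
    qed
    then show "AE x in U. norm ((f x * g x)\<^sup>2) \<le> norm (B\<^sup>2 * (f x)\<^sup>2)"
      by (intro AE_I2) simp
  qed
  then show ?thesis
    using borel_measurable_times[OF L2_measurable[OF assms(1)] assms(2)] by (simp add: L2_on_U)
qed

lemma continuous_measurable_U:
  fixes g :: "real \<Rightarrow> real"
  assumes "continuous_on {0..1} g"
  shows "g \<in> borel_measurable U"
  unfolding borel_measurable_U set_borel_measurable_def
  using borel_measurable_continuous_on_indicator[of "{0<..<1}" g] continuous_on_subset[OF assms]
  by (simp add: subset_eq)

lemma continuous_bounded_unit:
  fixes g :: "real \<Rightarrow> real"
  assumes "continuous_on {0..1} g"
  obtains B where "0 < B" "\<And>x. x \<in> {0..1} \<Longrightarrow> \<bar>g x\<bar> \<le> B"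
proof -
  have "\<exists>B>0. \<forall>y\<in>g ` {0..1}. norm y \<le> B"
    using compact_imp_bounded[OF compact_continuous_image[OF assms compact_Icc]]
    unfolding bounded_pos .
  then show thesis
    using that by (metis image_eqI real_norm_def)
qed

lemma continuous_L2:
  fixes g :: "real \<Rightarrow> real"
  assumes "continuous_on {0..1} g"
  shows "L2 g"
proof -
  obtain B where B: "\<And>x. x \<in> {0..1} \<Longrightarrow> \<bar>g x\<bar> \<le> B"
    using continuous_bounded_unit[OF assms] by blast
  then show ?thesis
    using L2_mult_bounded[OF L2_const continuous_measurable_U[OF assms], of B 1] by simp
qed

lemma L2_mult_continuous:
  fixes g :: "real \<Rightarrow> real"
  assumes "L2 f" "continuous_on {0..1} g"
  shows "L2 (\<lambda>x. f x * g x)"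
proof -
  obtain B where B: "\<And>x. x \<in> {0..1} \<Longrightarrow> \<bar>g x\<bar> \<le> B"
    using continuous_bounded_unit[OF assms(2)] by blast
  then show ?thesis
    using L2_mult_bounded[OF assms(1) continuous_measurable_U[OF assms(2)], of B] by simp
qed

lemma integrable_mult_continuous:
  fixes f g :: "real \<Rightarrow> real"
  assumes "integrable U f" "continuous_on {0..1} g"
  shows "integrable U (\<lambda>x. f x * g x)"
proof -
  obtain B where B: "\<And>x. x \<in> {0..1} \<Longrightarrow> \<bar>g x\<bar> \<le> B"
    using continuous_bounded_unit[OF assms(2)] by blast
  show ?thesis
  proof (rule Bochner_Integration.integrable_bound)
    show "integrable U (\<lambda>x. f x * B)"
      using assms(1) by simp
    show "(\<lambda>x. f x * g x) \<in> borel_measurable U"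
      using continuous_measurable_U[OF assms(2)] assms(1) by simp
    have "norm (f x * g x) \<le> norm (f x * B)" if "x \<in> space U" for x
    proof -
      have "\<bar>g x\<bar> \<le> \<bar>B\<bar>"
        using B[of x] that by fastforce
      then show ?thesis
        by (simp add: abs_mult mult_left_mono)
    qed
    then show "AE x in U. norm (f x * g x) \<le> norm (f x * B)"
      by (rule AE_I2)
  qed
qed

text \<open>The variance of \<open>\<bar>f\<bar>\<close> about its mean is nonnegative; the constant
  is 1 because \<open>U\<close> has total mass one.\<close>

lemma square_integral_le:
  assumes "L2 f"
  shows "(\<integral>x. \<bar>f x\<bar> \<partial>U)\<^sup>2 \<le> sqnorm f"
proof -
  define m where "m = (\<integral>x. \<bar>f x\<bar> \<partial>U)"
  have i: "integrable U (\<lambda>x. \<bar>f x\<bar>)" "integrable U (\<lambda>x. (f x)\<^sup>2)"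
    using assms L2_integrable L2_square by auto
  have "0 \<le> (\<integral>x. (\<bar>f x\<bar> - m)\<^sup>2 \<partial>U)"
    by simp
  also have "\<dots> = (\<integral>x. (f x)\<^sup>2 - 2 * m * \<bar>f x\<bar> + m\<^sup>2 \<partial>U)"
    by (simp add: power2_diff algebra_simps)
  also have "\<dots> = sqnorm f - 2 * m * m + m\<^sup>2"
    using i by (simp add: m_def)
  finally show ?thesis
    by (simp add: m_def power2_eq_square)
qed

section \<open>Primitives of integrable functions\<close>

interpretation UU: pair_sigma_finite U U ..

text \<open>The variable runs over the whole line, and \<open>cumul f\<close> is constant outside
  the unit interval. It is thus continuous on \<open>UNIV\<close> and has an antiderivative there,
  so that the potentials built from it are differentiable everywhere, as \<open>C1_plane\<close>
  asks of test functions.\<close>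

definition cumul :: "(real \<Rightarrow> real) \<Rightarrow> real \<Rightarrow> real" where
  "cumul f x = (\<integral>z. indicator {..x} z * f z \<partial>U)"

lemma integrable_indicator_U:
  assumes "integrable U f" "A \<in> sets borel"
  shows "integrable U (\<lambda>z. indicator A z * f z :: real)"
proof (rule Bochner_Integration.integrable_bound[OF assms(1)])
  have "indicator A \<in> borel_measurable U"
    using assms(2) by (intro borel_measurable_UI) simp
  then show "(\<lambda>z. indicator A z * f z) \<in> borel_measurable U"
    using borel_measurable_times[OF _ borel_measurable_integrable[OF assms(1)]] by blast
qed (auto simp: indicator_def)

lemma cumul_0 [simp]: "x \<le> 0 \<Longrightarrow> cumul f x = 0"
  unfolding cumul_def by (rule integral_eq_zero_AE, rule AE_I2) (auto simp: indicator_def)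

lemma cumul_1: "1 \<le> x \<Longrightarrow> cumul f x = (\<integral>z. f z \<partial>U)"
  unfolding cumul_def by (rule Bochner_Integration.integral_cong) (auto simp: indicator_def)

lemma cumul_add:
  "integrable U f \<Longrightarrow> integrable U g \<Longrightarrow> cumul (\<lambda>z. f z + g z) x = cumul f x + cumul g x"
  by (simp add: cumul_def distrib_left integrable_indicator_U)

lemma cumul_cmult: "cumul (\<lambda>z. c * f z) x = c * cumul f x"
  unfolding cumul_def by (subst integral_mult_right_zero[symmetric]) (simp add: ac_simps)

lemma AE_U_neq: "AE z in U. z \<noteq> a"
  unfolding AE_U using AE_lborel_singleton[of a] by (auto elim: eventually_mono)

text \<open>Dominated convergence: the indicators of the half-lines converge off the single point
  \<open>a\<close>.\<close>

lemma continuous_cumul: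
  assumes "integrable U f"
  shows "continuous_on UNIV (cumul f)"
proof (rule continuous_on_sequentiallyI)
  fix u :: "nat \<Rightarrow> real" and a
  assume u: "u \<longlonglongrightarrow> a"
  show "(\<lambda>n. cumul f (u n)) \<longlonglongrightarrow> cumul f a"
    unfolding cumul_def
  proof (rule integral_dominated_convergence)
    show "(\<lambda>z. indicator {..a} z * f z) \<in> borel_measurable U"
      using assms by (intro borel_measurable_integrable integrable_indicator_U) auto
    show "(\<lambda>z. indicator {..u n} z * f z) \<in> borel_measurable U" for n
      using assms by (intro borel_measurable_integrable integrable_indicator_U) auto
    show "integrable U (\<lambda>z. \<bar>f z\<bar>)"
      using assms by simp
    show "AE z in U. (\<lambda>n. indicator {..u n} z * f z) \<longlonglongrightarrow> indicator {..a} z * f z"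
      using AE_U_neq[of a]
    proof (eventually_elim)
      case (elim z)
      have "eventually (\<lambda>n. indicator {..u n} z = (indicator {..a} z :: real)) sequentially"
      proof (cases "z < a")
        case True
        from order_tendstoD(1)[OF u this] show ?thesis
          by eventually_elim (use True in auto)
      next
        case False
        with elim have "a < z" by simp
        from order_tendstoD(2)[OF u this] show ?thesis
          by eventually_elim (use \<open>a < z\<close> in auto)
      qed
      then show ?case
        by (intro tendsto_mult tendsto_const) (rule tendsto_eventually)
    qed
    show "AE z in U. norm (indicator {..u n} z * f z) \<le> \<bar>f z\<bar>" for n
      by (rule AE_I2) (auto simp: indicator_def)
  qed
qed

lemma integrable_UU_product:
  assumes "integrable U p" "integrable U q"
  shows "integrable (U \<Otimes>\<^sub>M U) (\<lambda>(z, w). p z * q w :: real)"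
proof (rule UU.Fubini_integrable)
  have [measurable]: "p \<in> borel_measurable U" "q \<in> borel_measurable U"
    using assms by auto
  show "(\<lambda>(z, w). p z * q w) \<in> borel_measurable (U \<Otimes>\<^sub>M U)"
    by measurable
  have "(\<lambda>x. \<integral>y. norm (case (x, y) of (z, w) \<Rightarrow> p z * q w) \<partial>U) = (\<lambda>x. \<bar>p x\<bar> * (\<integral>y. \<bar>q y\<bar> \<partial>U))"
    by (simp add: abs_mult)
  then show "integrable U (\<lambda>x. \<integral>y. norm (case (x, y) of (z, w) \<Rightarrow> p z * q w) \<partial>U)"
    using assms by simp
  show "AE x in U. integrable U (\<lambda>y. case (x, y) of (z, w) \<Rightarrow> p z * q w)"
    using assms by simp
qed

text \<open>The square is cut along its diagonal, which gives integration by parts.\<close>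

lemma product_of_integrals:
  assumes p: "integrable U p" and q: "integrable U q"
  shows "(\<integral>z. p z \<partial>U) * (\<integral>w. q w \<partial>U) = (\<integral>z. p z * cumul q z \<partial>U) + (\<integral>w. cumul p w * q w \<partial>U)"
proof -
  have [measurable]: "p \<in> borel_measurable U" "q \<in> borel_measurable U"
    using assms by auto
  have [measurable]: "(\<lambda>z. z) \<in> borel_measurable U"
    by (rule borel_measurable_UI) simp
  have i: "integrable (U \<Otimes>\<^sub>M U) (\<lambda>(z, w). p z * q w)"
    by (rule integrable_UU_product[OF p q])
  have i1: "integrable (U \<Otimes>\<^sub>M U) (\<lambda>(z, w). p z * (indicator {..z} w * q w))"
    by (rule Bochner_Integration.integrable_bound[OF i]) (measurable, auto simp: indicator_def)
  have i2: "integrable (U \<Otimes>\<^sub>M U) (\<lambda>(z, w). indicator {..<w} z * p z * q w)"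
    by (rule Bochner_Integration.integrable_bound[OF i]) (measurable, auto simp: indicator_def)
  have "(\<integral>z. p z \<partial>U) * (\<integral>w. q w \<partial>U) = (\<integral>z. (\<integral>w. p z * q w \<partial>U) \<partial>U)"
    by simp
  also have "\<dots> = (\<integral>(z, w). p z * q w \<partial>(U \<Otimes>\<^sub>M U))"
    by (rule UU.integral_fst[OF i])
  also have "\<dots> = (\<integral>(z, w). p z * (indicator {..z} w * q w) + indicator {..<w} z * p z * q w \<partial>(U \<Otimes>\<^sub>M U))"
    by (rule Bochner_Integration.integral_cong) (auto simp: indicator_def)
  also have "\<dots> = (\<integral>(z, w). p z * (indicator {..z} w * q w) \<partial>(U \<Otimes>\<^sub>M U))
      + (\<integral>(z, w). indicator {..<w} z * p z * q w \<partial>(U \<Otimes>\<^sub>M U))"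
    using Bochner_Integration.integral_add[OF i1 i2] by (simp add: case_prod_unfold)
  also have "(\<integral>(z, w). p z * (indicator {..z} w * q w) \<partial>(U \<Otimes>\<^sub>M U)) = (\<integral>z. p z * cumul q z \<partial>U)"
    unfolding UU.integral_fst[OF i1, symmetric] cumul_def by simp
  also have "(\<integral>(z, w). indicator {..<w} z * p z * q w \<partial>(U \<Otimes>\<^sub>M U)) = (\<integral>w. cumul p w * q w \<partial>U)"
  proof -
    have "(\<integral>z. indicator {..<w} z * p z \<partial>U) = cumul p w" for w
      unfolding cumul_def
    proof (rule integral_cong_AE)
      show "(\<lambda>z. indicator {..<w} z * p z) \<in> borel_measurable U" "(\<lambda>z. indicator {..w} z * p z) \<in> borel_measurable U"
        using p by (auto intro!: borel_measurable_integrable integrable_indicator_U)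
      show "AE z in U. indicator {..<w} z * p z = indicator {..w} z * p z"
        using AE_U_neq[of w] by eventually_elim (auto simp: indicator_def)
    qed
    then show ?thesis
      unfolding UU.integral_snd[OF i2, symmetric] by simp
  qed
  finally show ?thesis .
qed

text \<open>Absolute continuity on the closed interval. \<open>F\<close> is fixed at every point,
  the end points included, while \<open>f\<close> matters only up to null sets; boundary values and
  integration by parts are then available for densities that are merely integrable.\<close>

definition prim :: "(real \<Rightarrow> real) \<Rightarrow> (real \<Rightarrow> real) \<Rightarrow> bool" where
  "prim F f \<longleftrightarrow> integrable U f \<and> (\<forall>x\<in>{0..1}. F x = F 0 + cumul f x)"

lemma prim_integrable: "prim F f \<Longrightarrow> integrable U f"
  unfolding prim_def by blast

lemma prim_eq: "prim F f \<Longrightarrow> x \<in> {0..1} \<Longrightarrow> F x = F 0 + cumul f x"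
  unfolding prim_def by blast

lemma primI:
  "integrable U f \<Longrightarrow> (\<And>x. x \<in> {0..1} \<Longrightarrow> F x = F 0 + cumul f x) \<Longrightarrow> prim F f"
  unfolding prim_def by blast

lemma prim_FTC: "prim F f \<Longrightarrow> (\<integral>x. f x \<partial>U) = F 1 - F 0"
  using prim_eq[of F f 1] by (simp add: cumul_1)

lemma prim_continuous:
  assumes "prim F f"
  shows "continuous_on {0..1} F"
proof -
  have "continuous_on {0..1} (\<lambda>x. F 0 + cumul f x)"
    by (intro continuous_on_add continuous_on_const
        continuous_on_subset[OF continuous_cumul[OF prim_integrable[OF assms]]] subset_UNIV)
  then show ?thesis
    by (rule continuous_on_eq) (rule prim_eq[OF assms, symmetric])
qed

text \<open>Cutting both densities off at \<open>x\<close> reduces the claim to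
  \<open>product_of_integrals\<close>: the total integrals become \<open>cumul f x\<close> and
  \<open>cumul g x\<close>, and left of \<open>x\<close> the primitives of the cut densities differ
  from \<open>F\<close> and \<open>G\<close> by the constants \<open>F 0\<close> and
  \<open>G 0\<close>.\<close>

lemma prim_mult:
  assumes "prim F f" "prim G g"
  shows "prim (\<lambda>x. F x * G x) (\<lambda>x. f x * G x + F x * g x)"
  unfolding prim_def
proof (intro conjI ballI)
  have f: "integrable U f" and g: "integrable U g"
    using assms by (auto dest: prim_integrable)
  have fG: "integrable U (\<lambda>x. f x * G x)"
    by (rule integrable_mult_continuous[OF f prim_continuous[OF assms(2)]])
  have Fg: "integrable U (\<lambda>x. F x * g x)"
    using integrable_mult_continuous[OF g prim_continuous[OF assms(1)]] by (simp add: mult.commute)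
  show "integrable U (\<lambda>x. f x * G x + F x * g x)"
    using fG Fg by simp
  fix x :: real assume x: "x \<in> {0..1}"
  define p where "p = (\<lambda>z. indicator {..x} z * f z)"
  define q where "q = (\<lambda>z. indicator {..x} z * g z)"
  have pi: "integrable U p" and qi: "integrable U q"
    unfolding p_def q_def using f g by (auto intro: integrable_indicator_U)
  have c: "cumul p z = cumul f z" "cumul q z = cumul g z" if "z \<le> x" for z
    unfolding cumul_def p_def q_def using that
    by (auto intro!: Bochner_Integration.integral_cong simp: indicator_def)
  have ig: "integrable U (\<lambda>z. p z * G z)" "integrable U (\<lambda>z. F z * q z)"
    unfolding p_def q_def using integrable_indicator_U[OF fG, of "{..x}"] integrable_indicator_U[OF Fg, of "{..x}"]
    by (simp_all add: ac_simps)
  have "cumul f x * cumul g x = (\<integral>z. p z * cumul q z \<partial>U) + (\<integral>w. cumul p w * q w \<partial>U)"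
    using product_of_integrals[OF pi qi] by (simp add: cumul_def p_def q_def)
  also have "(\<integral>z. p z * cumul q z \<partial>U) = (\<integral>z. p z * G z - G 0 * p z \<partial>U)"
  proof (rule Bochner_Integration.integral_cong)
    fix z assume z: "z \<in> space U"
    show "p z * cumul q z = p z * G z - G 0 * p z"
    proof (cases "z \<le> x")
      case True
      with z show ?thesis using c(2)[OF True] prim_eq[OF assms(2), of z] by (simp add: algebra_simps)
    qed (simp add: p_def)
  qed simp
  also have "\<dots> = (\<integral>z. p z * G z \<partial>U) - G 0 * cumul f x"
    using ig pi by (simp add: cumul_def p_def)
  also have "(\<integral>z. cumul p z * q z \<partial>U) = (\<integral>z. F z * q z - F 0 * q z \<partial>U)"
  proof (rule Bochner_Integration.integral_cong)
    fix z assume z: "z \<in> space U"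
    show "cumul p z * q z = F z * q z - F 0 * q z"
    proof (cases "z \<le> x")
      case True
      with z show ?thesis using c(1)[OF True] prim_eq[OF assms(1), of z] by (simp add: algebra_simps)
    qed (simp add: q_def)
  qed simp
  also have "\<dots> = (\<integral>z. F z * q z \<partial>U) - F 0 * cumul g x"
    using ig qi by (simp add: cumul_def q_def)
  finally have e: "cumul f x * cumul g x + G 0 * cumul f x + F 0 * cumul g x = (\<integral>z. p z * G z \<partial>U) + (\<integral>z. F z * q z \<partial>U)"
    by simp
  have "cumul (\<lambda>x. f x * G x + F x * g x) x = (\<integral>z. p z * G z + F z * q z \<partial>U)"
    unfolding cumul_def p_def q_def by (rule Bochner_Integration.integral_cong) (auto simp: algebra_simps)
  also have "\<dots> = (\<integral>z. p z * G z \<partial>U) + (\<integral>z. F z * q z \<partial>U)"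
    using ig by simp
  finally show "F x * G x = F 0 * G 0 + cumul (\<lambda>x. f x * G x + F x * g x) x"
    unfolding e[symmetric] using prim_eq[OF assms(1) x] prim_eq[OF assms(2) x] by (simp add: algebra_simps)
qed

lemma prim_add:
  assumes F: "prim F f" and G: "prim G g"
  shows "prim (\<lambda>x. F x + G x) (\<lambda>x. f x + g x)"
proof (rule primI)
  show "integrable U (\<lambda>x. f x + g x)"
    using F G by (simp add: prim_integrable)
  show "F x + G x = F 0 + G 0 + cumul (\<lambda>x. f x + g x) x" if "x \<in> {0..1}" for x
    using prim_eq[OF F that] prim_eq[OF G that] F G by (simp add: cumul_add prim_integrable)
qed

lemma prim_cmult:
  assumes F: "prim F f"
  shows "prim (\<lambda>x. c * F x) (\<lambda>x. c * f x)"
proof (rule primI)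
  show "integrable U (\<lambda>x. c * f x)"
    using F by (simp add: prim_integrable)
  show "c * F x = c * F 0 + cumul (\<lambda>x. c * f x) x" if "x \<in> {0..1}" for x
    using prim_eq[OF F that] by (simp add: cumul_cmult algebra_simps)
qed

lemma prim_diff: "prim F f \<Longrightarrow> prim G g \<Longrightarrow> prim (\<lambda>x. F x - G x) (\<lambda>x. f x - g x)"
  using prim_add[OF _ prim_cmult[where c="-1"], of F f G g] by simp

text \<open>For \<open>n = 1\<close> the first derivative of the velocity is only a class; this lets
  a continuous representative take its place.\<close>

lemma prim_cong_AE:
  assumes "prim F f" "AE x in U. f x = g x" "g \<in> borel_measurable U"
  shows "prim F g"
proof -
  have f: "integrable U f"
    using assms(1) by (rule prim_integrable)
  have "AE x in U. g x = f x"
    using assms(2) by eventually_elim simp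
  then have g: "integrable U g"
    using Bochner_Integration.integrable_cong_AE_imp[OF f assms(3)] assms(2) by blast
  have "cumul f x = cumul g x" for x
    unfolding cumul_def
  proof (rule integral_cong_AE)
    show "(\<lambda>z. indicator {..x} z * f z) \<in> borel_measurable U" "(\<lambda>z. indicator {..x} z * g z) \<in> borel_measurable U"
      using f g by (auto intro!: borel_measurable_integrable integrable_indicator_U)
    show "AE z in U. indicator {..x} z * f z = indicator {..x} z * g z"
      using assms(2) by eventually_elim simp
  qed
  then show ?thesis
    using prim_eq[OF assms(1)] by (intro primI[OF g]) presburger
qed

lemma prim_cumul: "integrable U f \<Longrightarrow> prim (\<lambda>x. c + cumul f x) f"
  by (simp add: prim_def)

lemma prim_C1:
  assumes "\<And>x. (F has_real_derivative f x) (at x)" "continuous_on UNIV f"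
  shows "prim F f"
  unfolding prim_def
proof (intro conjI ballI)
  have f: "continuous_on {0..1} f"
    using assms(2) continuous_on_subset by blast
  show "integrable U f"
    by (rule L2_integrable[OF continuous_L2[OF f]])
  fix x :: real assume x: "x \<in> {0..1}"
  have "cumul f x = (\<integral>z. indicator {..x} z * f z * indicator {0<..<1} z \<partial>lborel)"
    by (simp add: cumul_def integral_U set_lebesgue_integral_def ac_simps)
  also have "\<dots> = (\<integral>z. f z * indicator {0..x} z \<partial>lborel)"
  proof (rule integral_cong_AE)
    have [measurable]: "f \<in> borel_measurable borel"
      using assms(2) by (rule borel_measurable_continuous_onI)
    show "(\<lambda>z. indicator {..x} z * f z * indicator {0<..<1} z) \<in> borel_measurable lborel"
         "(\<lambda>z. f z * indicator {0..x} z) \<in> borel_measurable lborel"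
      by simp_all
    show "AE z in lborel. indicator {..x} z * f z * indicator {0<..<1} z = f z * indicator {0..x} z"
      using AE_lborel_singleton[of 0] AE_lborel_singleton[of 1]
      by eventually_elim (use x in \<open>auto simp: indicator_def\<close>)
  qed
  also have "\<dots> = F x - F 0"
  proof (rule integral_FTC_Icc_real)
    show "0 \<le> x" using x by simp
    show "DERIV F z :> f z" for z by (rule assms(1))
    show "isCont f z" for z using assms(2) by (simp add: continuous_on_eq_continuous_at)
  qed
  finally show "F x = F 0 + cumul f x"
    by simp
qed

section \<open>Weak derivatives\<close>

text \<open>Dynkin's argument: the sets over which \<open>f\<close> integrates to zero contain the
  intersection-stable half-lines, are closed under disjoint unions, and by \<open>tot\<close> also
  under complements, so they include every Borel set.\<close>

lemma AE_zero_if_half_line_integrals_zero: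
  fixes f :: "real \<Rightarrow> real"
  assumes f: "integrable lborel f" and tot: "(\<integral>x. f x \<partial>lborel) = 0"
    and half: "\<And>x. (\<integral>z. indicator {..x} z * f z \<partial>lborel) = 0"
  shows "AE x in lborel. f x = 0"
proof (rule sigma_finite_measure.density_zero[OF lborel.sigma_finite_measure_axioms f])
  fix A :: "real set" assume "A \<in> sets lborel"
  then have A: "A \<in> sigma_sets UNIV (range atMost)"
    by (simp add: borel_eq_atMost)
  have ind: "integrable lborel (\<lambda>z. indicator B z * f z)" if "B \<in> sets borel" for B
    using integrable_mult_indicator[OF _ f, of B] that by simp
  have sets: "B \<in> sets borel" if "B \<in> sigma_sets UNIV (range atMost)" for B :: "real set"
    using that by (simp add: borel_eq_atMost)
  have "Int_stable (range (atMost :: real \<Rightarrow> real set))"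
    by (auto simp: Int_stable_def Int_atMost)
  moreover have "range atMost \<subseteq> Pow (UNIV :: real set)"
    by auto
  ultimately have "(\<integral>z. indicator A z * f z \<partial>lborel) = 0"
    using A
  proof (induction rule: sigma_sets_induct_disjoint)
    case (basic B)
    then show ?case using half by auto
  next
    case empty
    then show ?case by simp
  next
    case (compl B)
    have "(\<integral>z. indicator (UNIV - B) z * f z \<partial>lborel) = (\<integral>z. f z - indicator B z * f z \<partial>lborel)"
      by (rule Bochner_Integration.integral_cong) (auto simp: indicator_def)
    then show ?case
      using compl.IH tot f ind[OF sets[OF compl.hyps]] by simp
  next
    case (union B)
    have m: "B i \<in> sets lborel" for i
      using sets[of "B i"] union.hyps(2) by auto
    have "(LINT z:(\<Union>i. B i)|lborel. f z) = (\<Sum>i. (LINT z:(B i)|lborel. f z))"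
    proof (rule lebesgue_integral_countable_add)
      show "B i \<inter> B j = {}" if "i \<noteq> j" for i j
        using union.hyps(1) that by (auto simp: disjoint_family_on_def)
      show "set_integrable lborel (\<Union> (range B)) f"
        unfolding set_integrable_def using ind[of "\<Union> (range B)"] m by auto
    qed (use m in auto)
    then show ?case
      using union.IH by (simp add: set_lebesgue_integral_def)
  qed
  then show "(LINT z:A|lborel. f z) = 0"
    by (simp add: set_lebesgue_integral_def)
qed

lemma AE_zero_if_cumul_zero:
  assumes f: "integrable U f" and zero: "\<And>x. x \<in> {0..1} \<Longrightarrow> cumul f x = 0"
  shows "AE x in U. f x = 0"
proof -
  define g where "g z = indicator {0<..<1} z * f z" for z
  have "AE x in lborel. g x = 0"
  proof (rule AE_zero_if_half_line_integrals_zero)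
    show "integrable lborel g"
      using f by (simp add: integrable_U set_integrable_def g_def[abs_def])
    show "(\<integral>x. g x \<partial>lborel) = 0"
      using zero[of 1] by (simp add: cumul_1 integral_U set_lebesgue_integral_def g_def)
    fix x :: real
    have "cumul f x = 0"
    proof -
      consider "x \<le> 0" | "x \<in> {0..1}" | "1 \<le> x" by fastforce
      then show ?thesis
        using zero[of x] zero[of 1] by cases (simp_all add: cumul_1)
    qed
    then show "(\<integral>z. indicator {..x} z * g z \<partial>lborel) = 0"
      by (simp add: cumul_def integral_U set_lebesgue_integral_def g_def ac_simps)
  qed
  then show ?thesis
    unfolding AE_U g_def by eventually_elim auto
qed

lemma integral_U_HK:
  fixes k :: "real \<Rightarrow> real"
  assumes "continuous_on {0..1} k"
  shows "integral\<^sup>L U k = integral {0..1} k"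
proof -
  have "set_integrable lborel {0<..<1} k"
    using L2_integrable[OF continuous_L2[OF assms]] by (simp add: integrable_U)
  then show ?thesis
    by (simp add: integral_U set_borel_integral_eq_integral integral_open_interval_real)
qed

lemma continuous_integral_zero:
  fixes k :: "real \<Rightarrow> real"
  assumes "continuous_on {0..1} k" "\<And>x. x \<in> {0..1} \<Longrightarrow> 0 \<le> k x" "integral\<^sup>L U k = 0" "x \<in> {0..1}"
  shows "k x = 0"
  using integral_eq_0_iff[OF assms(1)] assms(2-) unfolding integral_U_HK[OF assms(1)] by auto

lemma antiderivative_real:
  fixes h :: "real \<Rightarrow> real"
  assumes "continuous_on UNIV h"
  shows "\<exists>F. F 0 = 0 \<and> (\<forall>x. (F has_real_derivative h x) (at x))"
proof -
  have "\<exists>F. \<forall>x::real. -\<infinity> < ereal x \<longrightarrow> ereal x < \<infinity> \<longrightarrow> (F has_vector_derivative h x) (at x)"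
    by (rule einterval_antiderivative) (use assms in \<open>auto simp: continuous_on_eq_continuous_at\<close>)
  then obtain F where F: "\<And>x. (F has_vector_derivative h x) (at x)"
    by auto
  have "((\<lambda>x. F x - F 0) has_real_derivative h x) (at x)" for x
    using DERIV_diff[OF F[of x, folded has_real_derivative_iff_has_vector_derivative] DERIV_const] by simp
  then show ?thesis
    by (intro exI[of _ "\<lambda>x. F x - F 0"]) simp
qed

lemma prim_imp_weak_deriv:
  assumes "prim F f"
  shows "weak_deriv F f"
  unfolding weak_deriv_def integral_U[symmetric]
proof (intro allI impI, elim conjE)
  fix \<psi> \<psi>' K
  assume \<psi>: "\<forall>x. (\<psi> has_real_derivative \<psi>' x) (at x)" "continuous_on UNIV \<psi>'"
    and K: "K \<subseteq> {0<..<1::real}" "\<forall>x. x \<notin> K \<longrightarrow> \<psi> x = 0"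
  have p: "prim \<psi> \<psi>'"
    using \<psi> by (intro prim_C1) auto
  have "0 \<notin> K" "1 \<notin> K"
    using K(1) by auto
  then have "\<psi> 0 = 0" "\<psi> 1 = 0"
    using K(2) by auto
  then have "(\<integral>x. f x * \<psi> x + F x * \<psi>' x \<partial>U) = 0"
    using prim_FTC[OF prim_mult[OF assms p]] by simp
  moreover have "integrable U (\<lambda>x. f x * \<psi> x)" "integrable U (\<lambda>x. F x * \<psi>' x)"
    using integrable_mult_continuous[OF prim_integrable[OF assms] prim_continuous[OF p]]
      integrable_mult_continuous[OF prim_integrable[OF p] prim_continuous[OF assms]]
    by (simp_all add: mult.commute)
  ultimately show "(\<integral>x. F x * \<psi>' x \<partial>U) = - (\<integral>x. f x * \<psi> x \<partial>U)"
    by simp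
qed

text \<open>A continuous function with compact support in the open interval and mean zero is the
  derivative of an admissible test function, and \<open>u\<close> and \<open>cumul u'\<close> give
  the same result when paired with such a derivative.\<close>

lemma weak_deriv_test:
  assumes wd: "weak_deriv u u'" and u: "L2 u" and u': "integrable U u'"
    and h: "continuous_on UNIV h" and supp: "\<And>x. x \<notin> {\<delta>..1-\<delta>} \<Longrightarrow> h x = 0"
    and \<delta>: "0 < \<delta>" "\<delta> < 1" and mean: "(\<integral>x. h x \<partial>U) = 0"
  shows "(\<integral>x. u x * h x \<partial>U) = (\<integral>x. cumul u' x * h x \<partial>U)"
proof -
  obtain \<psi> where \<psi>0: "\<psi> 0 = 0" and \<psi>: "\<And>x. (\<psi> has_real_derivative h x) (at x)"
    using antiderivative_real[OF h] by blast
  have p: "prim \<psi> h"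
    by (rule prim_C1[OF \<psi> h])
  have \<psi>1: "\<psi> 1 = 0"
    using prim_FTC[OF p] mean \<psi>0 by simp
  \<comment> \<open>Left of the support of \<open>h\<close> the function \<open>\<psi>\<close> keeps
    its value at 0, right of it its value at 1; the latter vanishes by the mean condition.\<close>
  have out: "\<psi> x = 0" if x: "x \<notin> {\<delta>..1-\<delta>}" for x
  proof -
    have *: "\<psi> a = \<psi> b" if "a < b" "\<And>z. a < z \<Longrightarrow> z < b \<Longrightarrow> z \<notin> {\<delta>..1-\<delta>}" for a b
      using MVT2[OF that(1), of \<psi> h] \<psi> supp that(2) by auto
    consider "x < 0" | "x = 0" | "0 < x" "x < \<delta>" | "1 - \<delta> < x" "x < 1" | "x = 1" | "1 < x"
      using x unfolding atLeastAtMost_iff by linarith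
    then show ?thesis
    proof cases
      case 1
      then show ?thesis using *[of x 0] \<delta> \<psi>0 by auto
    next
      case 3
      then show ?thesis using *[of 0 x] \<delta> \<psi>0 by auto
    next
      case 4
      then show ?thesis using *[of x 1] \<delta> \<psi>1 by auto
    next
      case 6
      then show ?thesis using *[of 1 x] \<delta> \<psi>1 by auto
    qed (use \<psi>0 \<psi>1 in auto)
  qed
  have "{\<delta>..1-\<delta>} \<subseteq> {0<..<1}"
    using \<delta> by auto
  then have "(\<integral>x. u x * h x \<partial>U) = - (\<integral>x. u' x * \<psi> x \<partial>U)"
    using wd[unfolded weak_deriv_def integral_U[symmetric], rule_format, of \<psi> h "{\<delta>..1-\<delta>}"] \<psi> h out \<delta> by auto
  moreover have pc: "prim (cumul u') u'"
    using prim_cumul[OF u', of 0] by simp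
  have "(\<integral>x. u' x * \<psi> x + cumul u' x * h x \<partial>U) = 0"
    using prim_FTC[OF prim_mult[OF pc p]] \<psi>0 \<psi>1 by simp
  moreover have "integrable U (\<lambda>x. u' x * \<psi> x)" "integrable U (\<lambda>x. cumul u' x * h x)"
    using integrable_mult_continuous[OF u' prim_continuous[OF p]]
      integrable_mult_continuous[OF prim_integrable[OF p] prim_continuous[OF pc]]
    by (simp_all add: mult.commute)
  ultimately show ?thesis
    by simp
qed

text \<open>The lemma of du Bois-Reymond: the test function is the weight \<open>\<eta>\<close> times the deviation of
  \<open>u - \<integral> u'\<close> from its \<open>\<eta>\<close>-weighted mean.\<close>

lemma weak_deriv_imp_prim:
  assumes wd: "weak_deriv u u'" and u: "continuous_on {0..1} u" and u': "integrable U u'"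
  shows "prim u u'"
proof -
  define w where "w x = u x - cumul u' x" for x
  have cu': "continuous_on {0..1} (cumul u')"
    by (rule continuous_on_subset[OF continuous_cumul[OF u']]) simp
  have w: "continuous_on {0..1} w"
    unfolding w_def by (intro continuous_on_diff u cu')
  have const: "w x = w (1/2)" if x: "x \<in> {0<..<1}" for x
  proof -
    \<comment> \<open>This margin puts both \<open>x\<close> and 1/2 strictly inside the support of
      the weight \<open>\<eta>\<close>, so that both values of \<open>w\<close> are compared with
      the same \<open>m\<close>.\<close>
    define \<delta> where "\<delta> = min x (1 - x) / 2"
    have \<delta>: "0 < \<delta>" "\<delta> < 1/2" "x \<in> {\<delta><..<1-\<delta>}"
      using x by (auto simp: \<delta>_def min_def field_simps)
    define \<eta> where "\<eta> z = max 0 (min (z - \<delta>) (1 - \<delta> - z))" for z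
    have \<eta>: "continuous_on UNIV \<eta>" "continuous_on {0..1} \<eta>"
      unfolding \<eta>_def by (intro continuous_intros)+
    have \<eta>0: "\<eta> z = 0" if "z \<notin> {\<delta>..1-\<delta>}" for z
      using that by (auto simp: \<eta>_def)
    have \<eta>pos: "0 < \<eta> z" if "z \<in> {\<delta><..<1-\<delta>}" for z
      using that by (auto simp: \<eta>_def)
    have \<eta>nn: "0 \<le> \<eta> z" for z
      by (simp add: \<eta>_def)
    have I: "(\<integral>z. \<eta> z \<partial>U) \<noteq> 0"
      using continuous_integral_zero[OF \<eta>(2) \<eta>nn, of x] \<eta>pos[OF \<delta>(3)] x by auto
    define m where "m = (\<integral>z. \<eta> z * w z \<partial>U) / (\<integral>z. \<eta> z \<partial>U)"
    \<comment> \<open>The clamp extends \<open>w\<close> continuously to the whole line;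
      \<open>\<eta>\<close> vanishes wherever the clamp moves the argument.\<close>
    define h where "h z = \<eta> z * (w (max 0 (min 1 z)) - m)" for z
    have "continuous_on UNIV (\<lambda>z. w (max 0 (min 1 z)))"
      by (rule continuous_on_compose2[OF w]) (auto intro!: continuous_intros)
    then have h: "continuous_on UNIV h"
      unfolding h_def by (intro continuous_on_mult \<eta> continuous_on_diff continuous_on_const)
    have hU: "h z = \<eta> z * w z - m * \<eta> z" if "z \<in> {0..1}" for z
      using that by (auto simp: h_def algebra_simps)
    have i: "integrable U (\<lambda>z. \<eta> z * w z)" "integrable U \<eta>"
      by (intro L2_integrable continuous_L2 continuous_on_mult \<eta> w)+
    have "(\<integral>z. h z \<partial>U) = (\<integral>z. \<eta> z * w z - m * \<eta> z \<partial>U)"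
      by (rule Bochner_Integration.integral_cong) (auto simp: hU)
    also have "\<dots> = 0"
      using i I by (simp add: m_def)
    finally have mean: "(\<integral>z. h z \<partial>U) = 0" .
    have "(\<integral>z. u z * h z \<partial>U) = (\<integral>z. cumul u' z * h z \<partial>U)"
    proof (rule weak_deriv_test[OF wd continuous_L2[OF u] u' h _ _ _ mean])
      show "h z = 0" if "z \<notin> {\<delta>..1-\<delta>}" for z
        unfolding h_def \<eta>0[OF that] by simp
    qed (use \<delta> in simp_all)
    moreover have hc: "continuous_on {0..1} h"
      by (rule continuous_on_subset[OF h]) simp
    have ih: "integrable U (\<lambda>z. u z * h z)" "integrable U (\<lambda>z. cumul u' z * h z)" "integrable U h"
      by (intro L2_integrable continuous_L2 continuous_on_mult u hc cu')+
    ultimately have wh: "(\<integral>z. w z * h z \<partial>U) = 0"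
      by (simp add: w_def left_diff_distrib)
    have iwh: "integrable U (\<lambda>z. w z * h z)"
      by (intro L2_integrable continuous_L2 continuous_on_mult w hc)
    have "(\<integral>z. \<eta> z * (w z - m)\<^sup>2 \<partial>U) = (\<integral>z. w z * h z - m * h z \<partial>U)"
      by (rule Bochner_Integration.integral_cong) (auto simp: hU power2_eq_square algebra_simps)
    also have "\<dots> = 0"
      using wh mean iwh ih by simp
    finally have int0: "(\<integral>z. \<eta> z * (w z - m)\<^sup>2 \<partial>U) = 0" .
    have zero: "\<eta> z * (w z - m)\<^sup>2 = 0" if "z \<in> {0..1}" for z
    proof (rule continuous_integral_zero[OF _ _ int0 that])
      show "continuous_on {0..1} (\<lambda>z. \<eta> z * (w z - m)\<^sup>2)"
        by (intro continuous_on_mult continuous_on_power continuous_on_diff continuous_on_const \<eta> w)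
    qed (simp_all add: \<eta>nn)
    have "w z = m" if "z \<in> {\<delta><..<1-\<delta>}" for z
    proof -
      have "z \<in> {0..1}"
        using that \<delta>(1) by simp
      then show ?thesis
        using zero[of z] \<eta>pos[OF that] by simp
    qed
    from this[OF \<delta>(3)] this[of "1/2"] show ?thesis
      using \<delta> by simp
  qed
  have "w x = w (1/2)" if "x \<in> {0..1}" for x
  proof (rule continuous_constant_on_closure[where f=w and S="{0<..<1}"])
    have cl: "closure {0<..<1::real} = {0..1}"
      by (rule closure_greaterThanLessThan) simp
    show "continuous_on (closure {0<..<1}) w" "x \<in> closure {0<..<1}"
      unfolding cl by (rule w, rule that)
  qed (rule const)
  then have "w x = w 0" if "x \<in> {0..1}" for x
    using that by (metis atLeastAtMost_iff order_refl zero_le_one)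
  then have "u x = u 0 + cumul u' x" if "x \<in> {0..1}" for x
    using \<open>x \<in> {0..1}\<close> unfolding w_def by fastforce
  then show ?thesis
    by (rule primI[OF u'])
qed

text \<open>From here on weak derivatives are replaced by chains of primitives. The forward
  direction serves the given velocities, the backward one the construction of lifts and of test
  functions in \<open>H^n_0\<close>.\<close>

lemma Hn_jet_iff:
  "Hn_jet n d \<longleftrightarrow> (\<forall>i\<le>n. L2 (d i)) \<and> (\<forall>i<n. prim (d i) (d (Suc i)))"
proof
  assume d: "Hn_jet n d"
  have "prim (d i) (d (Suc i))" if "i < n" for i
  proof (rule weak_deriv_imp_prim)
    show "weak_deriv (d i) (d (Suc i))" "continuous_on {0..1} (d i)"
      using d that unfolding Hn_jet_def by blast+
    have "L2 (d (Suc i))"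
      using d that unfolding Hn_jet_def by (meson Suc_leI)
    then show "integrable U (d (Suc i))"
      by (rule L2_integrable)
  qed
  then show "(\<forall>i\<le>n. L2 (d i)) \<and> (\<forall>i<n. prim (d i) (d (Suc i)))"
    using d unfolding Hn_jet_def by blast
next
  assume "(\<forall>i\<le>n. L2 (d i)) \<and> (\<forall>i<n. prim (d i) (d (Suc i)))"
  then show "Hn_jet n d"
    unfolding Hn_jet_def by (blast intro: prim_imp_weak_deriv prim_continuous)
qed

text \<open>The test function is the primitive of \<open>h\<close>, the deviation of
  \<open>w - cumul r\<close> from its mean. It vanishes at both ends because \<open>h\<close> has
  mean zero, and the hypothesis then says that \<open>h\<close> has mean square zero. In contrast to
  \<open>weak_deriv_imp_prim\<close>, \<open>w\<close> is only a class here.\<close>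

lemma weak_constancy:
  assumes w: "L2 w" and r: "L2 r"
    and test: "\<And>g g'. prim g g' \<Longrightarrow> L2 g' \<Longrightarrow> g 0 = 0 \<Longrightarrow> g 1 = 0 \<Longrightarrow>
      (\<integral>x. r x * g x + w x * g' x \<partial>U) = 0"
  obtains c where "AE x in U. w x = c + cumul r x"
proof -
  have ri: "integrable U r"
    by (rule L2_integrable[OF r])
  have pr: "prim (cumul r) r"
    using prim_cumul[OF ri, of 0] by simp
  have q: "L2 (\<lambda>x. w x - cumul r x)"
    by (rule L2_diff[OF w continuous_L2[OF prim_continuous[OF pr]]])
  define m where "m = (\<integral>x. w x - cumul r x \<partial>U)"
  define h where "h x = w x - cumul r x - m" for x
  have h: "L2 h"
    unfolding h_def by (rule L2_diff[OF q]) simp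
  have h0: "(\<integral>x. h x \<partial>U) = 0"
    using L2_integrable[OF q] by (simp add: h_def m_def)
  have ph: "prim (cumul h) h"
    using prim_cumul[OF L2_integrable[OF h], of 0] by simp
  have ch1: "cumul h 1 = 0"
    by (simp add: cumul_1 h0)
  have a: "(\<integral>x. r x * cumul h x + w x * h x \<partial>U) = 0"
    by (rule test[OF ph h]) (simp_all add: ch1)
  have b: "(\<integral>x. r x * cumul h x + cumul r x * h x \<partial>U) = 0"
    using prim_FTC[OF prim_mult[OF pr ph]] ch1 by simp
  have i: "integrable U (\<lambda>x. r x * cumul h x)" "integrable U (\<lambda>x. w x * h x)" "integrable U (\<lambda>x. cumul r x * h x)"
    using integrable_mult_continuous[OF ri prim_continuous[OF ph]] L2_mult_integrable[OF w h]
      L2_mult_integrable[OF continuous_L2[OF prim_continuous[OF pr]] h] by auto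
  have "sqnorm h = (\<integral>x. w x * h x - cumul r x * h x - m * h x \<partial>U)"
    by (simp add: h_def power2_eq_square algebra_simps)
  also have "\<dots> = 0"
    using a b i h0 L2_integrable[OF h] by simp
  finally have "AE x in U. (h x)\<^sup>2 = 0"
    using integral_nonneg_eq_0_iff_AE[OF L2_square[OF h]] by simp
  then have "AE x in U. w x = m + cumul r x"
    by eventually_elim (simp add: h_def)
  then show thesis
    by (rule that)
qed

section \<open>Energy estimates\<close>

lemma integral_young:
  assumes "L2 f" "L2 g" "0 < a"
  shows "\<bar>\<integral>x. f x * g x \<partial>U\<bar> \<le> (a * sqnorm f + sqnorm g / a) / 2"
proof -
  have *: "\<bar>p * q\<bar> \<le> (a * p\<^sup>2 + q\<^sup>2 / a) / 2" for p q :: real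
  proof -
    have "0 \<le> (a * \<bar>p\<bar> - \<bar>q\<bar>)\<^sup>2 / a"
      using assms(3) by simp
    also have "\<dots> = a * p\<^sup>2 + q\<^sup>2 / a - 2 * \<bar>p * q\<bar>"
      using assms(3) by (simp add: power2_diff abs_mult field_simps power2_eq_square)
    finally show ?thesis by simp
  qed
  have i: "integrable U (\<lambda>x. f x * g x)" "integrable U (\<lambda>x. (f x)\<^sup>2)" "integrable U (\<lambda>x. (g x)\<^sup>2)"
    using assms L2_mult_integrable L2_square by auto
  have "\<bar>\<integral>x. f x * g x \<partial>U\<bar> \<le> (\<integral>x. \<bar>f x * g x\<bar> \<partial>U)"
    by (rule integral_abs_bound)
  also have "\<dots> \<le> (\<integral>x. (a * (f x)\<^sup>2 + (g x)\<^sup>2 / a) / 2 \<partial>U)"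
    by (rule integral_mono) (use i * in auto)
  also have "\<dots> = (a * sqnorm f + sqnorm g / a) / 2"
    using i by simp
  finally show ?thesis .
qed

lemma integral_square_mult_le:
  assumes f: "L2 f" and g: "g \<in> borel_measurable U" and B: "\<And>x. x \<in> {0<..<1} \<Longrightarrow> (g x)\<^sup>2 \<le> B"
  shows "(\<integral>x. (f x * g x)\<^sup>2 \<partial>U) \<le> B * sqnorm f"
proof -
  have "\<bar>g x\<bar> \<le> sqrt B" if "x \<in> {0<..<1}" for x
    using real_sqrt_le_mono[OF B[OF that]] by simp
  then have "L2 (\<lambda>x. f x * g x)"
    by (rule L2_mult_bounded[OF f g])
  then have "(\<integral>x. (f x * g x)\<^sup>2 \<partial>U) \<le> (\<integral>x. B * (f x)\<^sup>2 \<partial>U)"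
  proof (intro integral_mono)
    show "(f x * g x)\<^sup>2 \<le> B * (f x)\<^sup>2" if "x \<in> space U" for x
      using mult_right_mono[OF B, of x "(f x)\<^sup>2"] that by (simp add: power_mult_distrib mult.commute)
  qed (use f in \<open>auto simp: L2_square\<close>)
  then show ?thesis
    by simp
qed

text \<open>The one-dimensional Sobolev bound: an increment of \<open>F\<close> is at most the mean
  of \<open>\<bar>f\<bar>\<close>, hence at most the root mean square of \<open>f\<close>.\<close>

lemma prim_square_le:
  assumes F: "prim F f" and f: "L2 f" and x: "x \<in> {0..1}"
  shows "(F x - F 0)\<^sup>2 \<le> sqnorm f"
proof -
  have i: "integrable U f"
    by (rule L2_integrable[OF f])
  have "\<bar>F x - F 0\<bar> = \<bar>\<integral>z. indicator {..x} z * f z \<partial>U\<bar>"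
    using prim_eq[OF F x] by (simp add: cumul_def)
  also have "\<dots> \<le> (\<integral>z. \<bar>indicator {..x} z * f z\<bar> \<partial>U)"
    by (rule integral_abs_bound)
  also have "\<dots> \<le> (\<integral>z. \<bar>f z\<bar> \<partial>U)"
    by (rule integral_mono) (use i integrable_indicator_U[OF i, of "{..x}"] in \<open>auto simp: indicator_def\<close>)
  finally have "(F x - F 0)\<^sup>2 \<le> (\<integral>z. \<bar>f z\<bar> \<partial>U)\<^sup>2"
    using power_mono[of "\<bar>F x - F 0\<bar>" _ 2] by simp
  also have "\<dots> \<le> sqnorm f"
    by (rule square_integral_le[OF f])
  finally show ?thesis .
qed

text \<open>\<open>l\<close> and \<open>r\<close> tell whether the fluid enters at the left and at the right end. The condition is
  of Dirichlet type at an outflow end, where nothing is known about the trace of \<open>Y\<close>, and of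
  Robin type at an inflow end.\<close>

definition potential :: "bool \<Rightarrow> bool \<Rightarrow> (real \<Rightarrow> real) \<Rightarrow> (real \<Rightarrow> real) \<Rightarrow> (real \<Rightarrow> real) \<Rightarrow> bool" where
  "potential l r Y W W' \<longleftrightarrow>
     (\<forall>x. (W has_real_derivative W' x) (at x)) \<and> continuous_on UNIV W' \<and> L2 Y \<and> prim W' (\<lambda>x. - Y x) \<and>
     W 0 = (if l then W' 0 else 0) \<and> W 1 = (if r then - W' 1 else 0)"

text \<open>The Dirichlet integral with the Robin terms of both ends. At an outflow end the square
  is zero, so one formula serves all four combinations of \<open>l\<close> and
  \<open>r\<close>.\<close>

definition energy :: "(real \<Rightarrow> real) \<Rightarrow> (real \<Rightarrow> real) \<Rightarrow> real" where
  "energy W W' = sqnorm W' + (W 0)\<^sup>2 + (W 1)\<^sup>2"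

lemma potential_exists:
  assumes Y: "L2 Y"
  shows "\<exists>W W'. potential l r Y W W'"
proof -
  have iY: "integrable U Y"
    by (rule L2_integrable[OF Y])
  obtain P where P0: "P 0 = 0" and P: "\<And>x. (P has_real_derivative cumul Y x) (at x)"
    using antiderivative_real[OF continuous_cumul[OF iY]] by blast
  define Z where "Z = cumul Y 1"
  \<comment> \<open>Here \<open>W' 0 = c\<close> and \<open>W' 1 = c - Z\<close>, so the condition
    at the right end is a linear equation for \<open>c\<close>. Its coefficient is 3, 2, 2 or 1 in
    the four cases, never 0 as it would be for Neumann conditions at both ends.\<close>
  define c where "c = (if l then if r then (Z + P 1) / 3 else P 1 / 2 else if r then (Z + P 1) / 2 else P 1)"
  define d where "d = (if l then c else 0)"
  have "potential l r Y (\<lambda>x. d + c * x - P x) (\<lambda>x. c - cumul Y x)"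
    unfolding potential_def
  proof (intro conjI allI)
    show "((\<lambda>x. d + c * x - P x) has_real_derivative c - cumul Y x) (at x)" for x
      by (auto intro!: derivative_eq_intros P)
    show "continuous_on UNIV (\<lambda>x. c - cumul Y x)"
      by (intro continuous_on_diff continuous_on_const continuous_cumul[OF iY])
    show "L2 Y" by fact
    have "prim (\<lambda>x. c + cumul (\<lambda>x. - Y x) x) (\<lambda>x. - Y x)"
      using iY by (intro prim_cumul) simp
    then show "prim (\<lambda>x. c - cumul Y x) (\<lambda>x. - Y x)"
      using cumul_cmult[of "-1" Y] by simp
  qed (auto simp: d_def P0 c_def Z_def[symmetric] field_simps)
  then show ?thesis by blast
qed

context
  fixes l r Y W W'
  assumes pot: "potential l r Y W W'"
begin

lemma potential_DERIV: "(W has_real_derivative W' x) (at x)"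
  and potential_cont': "continuous_on UNIV W'"
  and potential_L2: "L2 Y"
  and potential_prim': "prim W' (\<lambda>x. - Y x)"
  and potential_0: "W 0 = (if l then W' 0 else 0)"
  and potential_1: "W 1 = (if r then - W' 1 else 0)"
  using pot unfolding potential_def by blast+

lemma potential_prim: "prim W W'"
  by (rule prim_C1[OF potential_DERIV potential_cont'])

lemma potential_cont: "continuous_on {0..1} W"
  by (rule prim_continuous[OF potential_prim])

lemma potential_cont'_unit: "continuous_on {0..1} W'"
  by (rule prim_continuous[OF potential_prim'])

lemma potential_L2': "L2 W'"
  by (rule continuous_L2[OF potential_cont'_unit])

lemma potential_cmult: "potential l r (\<lambda>x. c * Y x) (\<lambda>x. c * W x) (\<lambda>x. c * W' x)"
  unfolding potential_def
proof (intro conjI allI)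
  show "((\<lambda>x. c * W x) has_real_derivative c * W' x) (at x)" for x
    by (rule DERIV_cmult[OF potential_DERIV])
  show "continuous_on UNIV (\<lambda>x. c * W' x)"
    by (intro continuous_on_mult continuous_on_const potential_cont')
  show "L2 (\<lambda>x. c * Y x)"
    by (rule L2_cmult[OF potential_L2])
  show "prim (\<lambda>x. c * W' x) (\<lambda>x. - (c * Y x))"
    using prim_cmult[OF potential_prim', of c] by simp
qed (simp_all add: potential_0 potential_1)

text \<open>Integration by parts of \<open>- W'' = Y\<close>. At an inflow end the Robin condition
  trades the slope for the boundary value; at an outflow end the boundary term disappears with
  \<open>g\<close>.\<close>

lemma potential_pairing:
  assumes g: "prim g g'" and "\<not> l \<Longrightarrow> g 0 = 0" "\<not> r \<Longrightarrow> g 1 = 0"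
  shows "(\<integral>x. Y x * g x \<partial>U) = (\<integral>x. W' x * g' x \<partial>U) + W 0 * g 0 + W 1 * g 1"
proof -
  have "(\<integral>x. - Y x * g x + W' x * g' x \<partial>U) = W' 1 * g 1 - W' 0 * g 0"
    using prim_FTC[OF prim_mult[OF potential_prim' g]] .
  moreover have "integrable U (\<lambda>x. Y x * g x)" "integrable U (\<lambda>x. W' x * g' x)"
    using integrable_mult_continuous[OF L2_integrable[OF potential_L2] prim_continuous[OF g]]
      integrable_mult_continuous[OF prim_integrable[OF g] potential_cont'_unit]
    by (simp_all add: mult.commute)
  moreover have "W' 1 * g 1 = - (W 1 * g 1)" "W' 0 * g 0 = W 0 * g 0"
    using assms(2,3) potential_0 potential_1 by auto
  ultimately show ?thesis
    by simp
qed

lemma energy_eq: "energy W W' = (\<integral>x. Y x * W x \<partial>U)"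
proof -
  have "(\<integral>x. Y x * W x \<partial>U) = (\<integral>x. W' x * W' x \<partial>U) + W 0 * W 0 + W 1 * W 1"
    by (rule potential_pairing[OF potential_prim]) (simp_all add: potential_0 potential_1)
  then show ?thesis
    by (simp add: energy_def power2_eq_square)
qed

lemma energy_nonneg: "0 \<le> energy W W'"
  by (simp add: energy_def)

lemma energy_ge: "sqnorm W' \<le> energy W W'"
  by (simp add: energy_def)

lemma potential_square_le:
  assumes "x \<in> {0..1}"
  shows "(W x)\<^sup>2 \<le> 2 * energy W W'"
proof -
  have "(W x)\<^sup>2 \<le> 2 * (W x - W 0)\<^sup>2 + 2 * (W 0)\<^sup>2"
    using zero_le_power2[of "W x - 2 * W 0"] by (simp add: power2_eq_square algebra_simps)
  also have "\<dots> \<le> 2 * energy W W'"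
    using prim_square_le[OF potential_prim potential_L2' assms] zero_le_power2[of "W 1"]
    unfolding energy_def distrib_left by linarith
  finally show ?thesis .
qed

text \<open>Young's inequality with weight 2 bounds the energy by \<open>sqnorm Y\<close> plus a
  quarter of \<open>sqnorm W\<close>, and the latter is at most half the energy, which is
  absorbed.\<close>

lemma energy_le: "energy W W' \<le> 2 * sqnorm Y"
proof -
  have L: "L2 W"
    by (rule continuous_L2[OF potential_cont])
  have "(\<integral>x. (1 * W x)\<^sup>2 \<partial>U) \<le> 2 * energy W W' * (\<integral>x. 1\<^sup>2 \<partial>U)"
    by (rule integral_square_mult_le) (use potential_square_le L in \<open>auto simp: L2_measurable\<close>)
  then have "sqnorm W \<le> 2 * energy W W'"
    by simp
  then show ?thesis
    using integral_young[OF potential_L2 L, of 2] energy_eq by (simp add: abs_le_iff)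
qed

lemma energy_zero:
  assumes "energy W W' = 0"
  shows "AE x in U. Y x = 0"
proof (rule AE_zero_if_cumul_zero)
  show "integrable U Y"
    by (rule L2_integrable[OF potential_L2])
  have 0: "sqnorm W' = 0"
  proof -
    have "0 \<le> sqnorm W'"
      by simp
    then show ?thesis
      using assms zero_le_power2[of "W 0"] zero_le_power2[of "W 1"] unfolding energy_def by linarith
  qed
  have "(W' x)\<^sup>2 = 0" if "x \<in> {0..1}" for x
    by (rule continuous_integral_zero[OF continuous_on_power[OF potential_cont'_unit] _ 0 that]) simp
  then have "W' x = 0" if "x \<in> {0..1}" for x
    using that by simp
  then have "cumul (\<lambda>x. - Y x) x = 0" if "x \<in> {0..1}" for x
    using prim_eq[OF potential_prim' that] that by simp
  then show "cumul Y x = 0" if "x \<in> {0..1}" for x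
    using cumul_cmult[of "-1" Y x] that by simp
qed

end

section \<open>Linearity and symmetry of the solution operator\<close>

lemma potential_add:
  assumes a: "potential l r Y W W'" and b: "potential l r X V V'"
  shows "potential l r (\<lambda>x. Y x + X x) (\<lambda>x. W x + V x) (\<lambda>x. W' x + V' x)"
  unfolding potential_def
proof (intro conjI allI)
  show "((\<lambda>x. W x + V x) has_real_derivative W' x + V' x) (at x)" for x
    by (rule DERIV_add[OF potential_DERIV[OF a] potential_DERIV[OF b]])
  show "continuous_on UNIV (\<lambda>x. W' x + V' x)"
    by (rule continuous_on_add[OF potential_cont'[OF a] potential_cont'[OF b]])
  show "L2 (\<lambda>x. Y x + X x)"
    by (rule L2_add[OF potential_L2[OF a] potential_L2[OF b]])
  show "prim (\<lambda>x. W' x + V' x) (\<lambda>x. - (Y x + X x))"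
    using prim_add[OF potential_prim'[OF a] potential_prim'[OF b]] by simp
qed (simp_all add: potential_0[OF a] potential_1[OF a] potential_0[OF b] potential_1[OF b])

lemma potential_diff:
  assumes "potential l r Y W W'" "potential l r X V V'"
  shows "potential l r (\<lambda>x. Y x - X x) (\<lambda>x. W x - V x) (\<lambda>x. W' x - V' x)"
  using potential_add[OF assms(1) potential_cmult[OF assms(2), of "-1"]] by simp

text \<open>Each potential vanishes at the outflow ends and is therefore an admissible partner in
  \<open>potential_pairing\<close> for the other; both pairings yield the same symmetric
  form.\<close>

lemma potential_symmetric:
  assumes a: "potential l r Y W W'" and b: "potential l r X V V'"
  shows "(\<integral>x. Y x * V x \<partial>U) = (\<integral>x. X x * W x \<partial>U)"
proof -
  have "(\<integral>x. Y x * V x \<partial>U) = (\<integral>x. W' x * V' x \<partial>U) + W 0 * V 0 + W 1 * V 1"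
    by (rule potential_pairing[OF a potential_prim[OF b]]) (simp_all add: potential_0[OF b] potential_1[OF b])
  moreover have "(\<integral>x. X x * W x \<partial>U) = (\<integral>x. V' x * W' x \<partial>U) + V 0 * W 0 + V 1 * W 1"
    by (rule potential_pairing[OF b potential_prim[OF a]]) (simp_all add: potential_0[OF a] potential_1[OF a])
  ultimately show ?thesis
    by (simp add: mult.commute)
qed

lemma energy_diff_eq:
  assumes a: "potential l r Y W W'" and b: "potential l r X V V'"
  shows "energy W W' - energy V V' = (\<integral>x. (Y x - X x) * (W x + V x) \<partial>U)"
proof -
  have i: "integrable U (\<lambda>x. Y x * W x)" "integrable U (\<lambda>x. Y x * V x)"
      "integrable U (\<lambda>x. X x * W x)" "integrable U (\<lambda>x. X x * V x)"
    by (intro L2_mult_integrable potential_L2[OF a] potential_L2[OF b] continuous_L2 potential_cont[OF a] potential_cont[OF b])+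
  have "(\<integral>x. (Y x - X x) * (W x + V x) \<partial>U) = (\<integral>x. Y x * W x + Y x * V x - X x * W x - X x * V x \<partial>U)"
    by (simp add: algebra_simps)
  also have "\<dots> = energy W W' - energy V V'"
    using i potential_symmetric[OF a b] by (simp add: energy_eq[OF a] energy_eq[OF b])
  finally show ?thesis by simp
qed

text \<open>With \<open>Y = y1 - y2\<close>, \<open>v = v1\<close>, \<open>z = y2\<close> and
  \<open>D = v1 - v2\<close> one has \<open>y1 v1 - y2 v2 = Y v + z D\<close>, and likewise for the
  space derivatives of the velocities. The integrand is thus the difference of the two weak
  integrands for a test function \<open>g\<close> that does not depend on time.\<close>

definition flux ::
    "(real \<Rightarrow> real) \<Rightarrow> (real \<Rightarrow> real) \<Rightarrow> (real \<Rightarrow> real) \<Rightarrow> (real \<Rightarrow> real) \<Rightarrow> (real \<Rightarrow> real) \<Rightarrow>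
     (real \<Rightarrow> real) \<Rightarrow> (real \<Rightarrow> real) \<Rightarrow> (real \<Rightarrow> real) \<Rightarrow> real" where
  "flux Y v v' z D D' g g' =
     (\<integral>x. (Y x * v x + z x * D x) * g' x - (Y x * v' x + z x * D' x) * g x \<partial>U)"

text \<open>Pointwise bounds are asked of \<open>v\<close> and \<open>v'\<close> only;
  \<open>Y\<close>, \<open>z\<close> and \<open>v''\<close> are controlled in mean square. The last
  clause is the elliptic equation for \<open>D\<close> tested with \<open>D\<close>, of which only
  the first-order square is kept.\<close>

definition flux_coeffs ::
    "real \<Rightarrow> (real \<Rightarrow> real) \<Rightarrow> (real \<Rightarrow> real) \<Rightarrow> (real \<Rightarrow> real) \<Rightarrow> (real \<Rightarrow> real) \<Rightarrow>
     (real \<Rightarrow> real) \<Rightarrow> (real \<Rightarrow> real) \<Rightarrow> (real \<Rightarrow> real) \<Rightarrow> bool" where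
  "flux_coeffs M Y v v' v'' z D D' \<longleftrightarrow>
     L2 Y \<and> prim v v' \<and> prim v' v'' \<and> L2 v'' \<and> L2 z \<and> prim D D' \<and> L2 D' \<and> D 0 = 0 \<and> D 1 = 0 \<and>
     0 < M \<and> (\<forall>x\<in>{0..1}. \<bar>v x\<bar> \<le> M \<and> \<bar>v' x\<bar> \<le> M) \<and> sqnorm v'' \<le> M\<^sup>2 \<and>
     sqnorm z \<le> M\<^sup>2 \<and> sqnorm Y \<le> 4 * M\<^sup>2 \<and>
     sqnorm D' \<le> (\<integral>x. Y x * D x \<partial>U)"

section \<open>Estimates of the flux in terms of the energy\<close>

context
  fixes Y v v' v'' z D D' :: "real \<Rightarrow> real" and M :: real
  assumes coeffs: "flux_coeffs M Y v v' v'' z D D'"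
begin

lemma coeff_Y: "L2 Y"
  and coeff_v: "prim v v'"
  and coeff_v': "prim v' v''"
  and coeff_v'': "L2 v''"
  and coeff_z: "L2 z"
  and coeff_D: "prim D D'" "L2 D'" "D 0 = 0" "D 1 = 0"
  and coeff_M: "0 < M" "\<And>x. x \<in> {0..1} \<Longrightarrow> \<bar>v x\<bar> \<le> M" "\<And>x. x \<in> {0..1} \<Longrightarrow> \<bar>v' x\<bar> \<le> M"
    "sqnorm v'' \<le> M\<^sup>2" "sqnorm z \<le> M\<^sup>2"
  and coeff_YM: "sqnorm Y \<le> 4 * M\<^sup>2"
  and coeff_DY: "sqnorm D' \<le> (\<integral>x. Y x * D x \<partial>U)"
  using coeffs unfolding flux_coeffs_def by blast+

lemma flux_integrable:
  assumes g: "continuous_on {0..1} g" and g': "continuous_on {0..1} g'"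
  shows "integrable U (\<lambda>x. (Y x * v x + z x * D x) * g' x - (Y x * v' x + z x * D' x) * g x)"
proof -
  have "integrable U (\<lambda>x. (Y x * v x) * g' x)" "integrable U (\<lambda>x. (z x * D x) * g' x)"
      "integrable U (\<lambda>x. (Y x * v' x) * g x)" "integrable U (\<lambda>x. D' x * (z x * g x))"
    by (intro L2_mult_integrable L2_mult_continuous coeff_Y coeff_z coeff_D(2) continuous_L2 g g'
        prim_continuous[OF coeff_v] prim_continuous[OF coeff_v'] prim_continuous[OF coeff_D(1)])+
  then have "integrable U (\<lambda>x. (Y x * v x) * g' x + (z x * D x) * g' x
      - ((Y x * v' x) * g x + D' x * (z x * g x)))"
    by simp
  then show ?thesis
    by (simp add: algebra_simps)
qed

lemma flux_add:
  assumes "continuous_on {0..1} g" "continuous_on {0..1} g'" "continuous_on {0..1} h" "continuous_on {0..1} h'"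
  shows "flux Y v v' z D D' (\<lambda>x. g x + h x) (\<lambda>x. g' x + h' x) = flux Y v v' z D D' g g' + flux Y v v' z D D' h h'"
  unfolding flux_def
  by (subst Bochner_Integration.integral_add[symmetric, OF flux_integrable[OF assms(1,2)] flux_integrable[OF assms(3,4)]])
    (rule Bochner_Integration.integral_cong, auto simp: algebra_simps)

lemma flux_cmult: "flux Y v v' z D D' (\<lambda>x. c * g x) (\<lambda>x. c * g' x) = c * flux Y v v' z D D' g g'"
  unfolding flux_def integral_mult_right_zero[symmetric]
  by (rule Bochner_Integration.integral_cong) (auto simp: algebra_simps)

lemma flux_split:
  assumes g: "continuous_on {0..1} g" and g': "continuous_on {0..1} g'"
  shows "flux Y v v' z D D' g g' =
    (\<integral>x. (Y x * v x) * g' x \<partial>U) + (\<integral>x. (z x * D x) * g' x \<partial>U)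
    - (\<integral>x. (Y x * v' x) * g x \<partial>U) - (\<integral>x. D' x * (z x * g x) \<partial>U)"
proof -
  note Y = coeff_Y and v = coeff_v and v' = coeff_v' and v'' = coeff_v'' and z = coeff_z
    and D = coeff_D and M = coeff_M
  have i: "integrable U (\<lambda>x. (Y x * v x) * g' x)" "integrable U (\<lambda>x. (z x * D x) * g' x)"
      "integrable U (\<lambda>x. (Y x * v' x) * g x)" "integrable U (\<lambda>x. D' x * (z x * g x))"
    by (intro L2_mult_integrable L2_mult_continuous Y z D(2) continuous_L2 g g' prim_continuous[OF v]
        prim_continuous[OF v'] prim_continuous[OF D(1)])+
  have "flux Y v v' z D D' g g' = (\<integral>x. (Y x * v x) * g' x + (z x * D x) * g' x
      - (Y x * v' x) * g x - D' x * (z x * g x) \<partial>U)"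
    by (simp add: flux_def algebra_simps)
  then show ?thesis
    using i by simp
qed

text \<open>Since \<open>D\<close> vanishes at both ends, the pairing has no boundary terms whatever
  \<open>l\<close> and \<open>r\<close> are. The bound can thus be combined with any potential of
  \<open>Y\<close>, also with the Dirichlet one.\<close>

lemma deriv_le_energy:
  assumes p: "potential l r Y W W'"
  shows "sqnorm D' \<le> energy W W'"
proof -
  note Y = coeff_Y and v = coeff_v and v' = coeff_v' and v'' = coeff_v'' and z = coeff_z
    and D = coeff_D and M = coeff_M
  have "(\<integral>x. Y x * D x \<partial>U) = (\<integral>x. W' x * D' x \<partial>U)"
    using potential_pairing[OF p D(1)] D by simp
  then show ?thesis
    using coeff_DY integral_young[OF potential_L2'[OF p] D(2), of 1] energy_ge[OF p] by simp
qed

lemma diff_square_le_energy: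
  assumes p: "potential l r Y W W'" and x: "x \<in> {0..1}"
  shows "(D x)\<^sup>2 \<le> energy W W'"
  using prim_square_le[OF coeff_D(1,2) x] coeff_D(3) deriv_le_energy[OF p] by simp

text \<open>The two terms with \<open>Y\<close> are integrated by parts through
  \<open>Y = - W''\<close>. The two terms with \<open>z\<close> are already of the order of the
  energy, because \<open>D\<close> and \<open>D'\<close> are bounded by its square root, the former
  pointwise.\<close>

lemma flux_le_energy:
  assumes p: "potential l r Y W W'" and sign: "\<not> l \<Longrightarrow> v 0 \<le> 0" "\<not> r \<Longrightarrow> 0 \<le> v 1"
  shows "flux Y v v' z D D' W W' \<le> (1 + 3 * M + 2 * M\<^sup>2) * energy W W'"
proof -
  note Y = coeff_Y and v = coeff_v and v' = coeff_v' and v'' = coeff_v'' and z = coeff_z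
    and D = coeff_D and M = coeff_M
  define E where "E = energy W W'"
  note W = potential_prim[OF p] and W' = potential_prim'[OF p]
  note c = potential_cont[OF p] potential_cont'_unit[OF p]
    prim_continuous[OF v] prim_continuous[OF v'] prim_continuous[OF D(1)]
  define A where "A = sqnorm W'"
  define b where "b = (W 0)\<^sup>2 + (W 1)\<^sup>2"
  have E: "E = A + b" "0 \<le> A" "0 \<le> b"
    by (simp_all add: E_def energy_def A_def b_def)
  have iA: "integrable U (\<lambda>x. (W' x)\<^sup>2)"
    by (rule L2_square[OF potential_L2'[OF p]])
  have i1: "integrable U (\<lambda>x. (Y x * v x) * W' x)"
    by (intro L2_mult_integrable L2_mult_continuous Y continuous_L2 c)
  have i2: "integrable U (\<lambda>x. (Y x * v' x) * W x)"
    by (intro L2_mult_integrable L2_mult_continuous Y continuous_L2 c)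
  have i3: "integrable U (\<lambda>x. (W' x)\<^sup>2 * v' x)"
    by (intro integrable_mult_continuous iA c)
  have i4: "integrable U (\<lambda>x. (W' x * W x) * v'' x)"
    by (intro L2_mult_integrable v'' continuous_L2 continuous_on_mult c)
  have J: "\<bar>\<integral>x. (W' x)\<^sup>2 * v' x \<partial>U\<bar> \<le> M * A"
  proof -
    have "\<bar>\<integral>x. (W' x)\<^sup>2 * v' x \<partial>U\<bar> \<le> (\<integral>x. \<bar>(W' x)\<^sup>2 * v' x\<bar> \<partial>U)"
      by (rule integral_abs_bound)
    also have "\<dots> \<le> (\<integral>x. M * (W' x)\<^sup>2 \<partial>U)"
    proof (rule integral_mono)
      show "\<bar>(W' x)\<^sup>2 * v' x\<bar> \<le> M * (W' x)\<^sup>2" if "x \<in> space U" for x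
        using M(3)[of x] that mult_left_mono[of "\<bar>v' x\<bar>" M "(W' x)\<^sup>2"] by (simp add: abs_mult mult.commute)
    qed (use i3 iA in auto)
    finally show ?thesis by (simp add: A_def)
  qed
  \<comment> \<open>The identity behind this is \<open>2 Y v W' = v' W'^2 - (v W'^2)'\<close>. At an
    inflow end \<open>W'^2 = W^2\<close> puts the boundary term into the energy; at an outflow end
    its sign is favourable.\<close>
  have T1: "(\<integral>x. (Y x * v x) * W' x \<partial>U) \<le> M / 2 * E"
  proof -
    have "(\<integral>x. (- Y x * W' x + W' x * - Y x) * v x + (W' x * W' x) * v' x \<partial>U) = W' 1 * W' 1 * v 1 - W' 0 * W' 0 * v 0"
      using prim_FTC[OF prim_mult[OF prim_mult[OF W' W'] v]] .
    moreover have "(\<integral>x. (- Y x * W' x + W' x * - Y x) * v x + (W' x * W' x) * v' x \<partial>U)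
        = (\<integral>x. (W' x)\<^sup>2 * v' x - 2 * ((Y x * v x) * W' x) \<partial>U)"
      by (rule Bochner_Integration.integral_cong) (auto simp: power2_eq_square algebra_simps)
    moreover have "\<dots> = (\<integral>x. (W' x)\<^sup>2 * v' x \<partial>U) - 2 * (\<integral>x. (Y x * v x) * W' x \<partial>U)"
      using i1 i3 by simp
    moreover have "- (W' 1 * W' 1 * v 1) \<le> M * (W 1)\<^sup>2"
    proof (cases r)
      case True
      then have "(W 1)\<^sup>2 = W' 1 * W' 1"
        using potential_1[OF p] by (simp add: power2_eq_square)
      then show ?thesis
        using mult_left_mono[of "- v 1" M "W' 1 * W' 1"] M(2)[of 1] by (simp add: mult.commute)
    next
      case False
      then have "0 \<le> W' 1 * W' 1 * v 1"
        using sign(2) by simp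
      moreover have "0 \<le> M * (W 1)\<^sup>2"
        using M(1) by simp
      ultimately show ?thesis
        by linarith
    qed
    moreover have "W' 0 * W' 0 * v 0 \<le> M * (W 0)\<^sup>2"
    proof (cases l)
      case True
      then have "(W 0)\<^sup>2 = W' 0 * W' 0"
        using potential_0[OF p] by (simp add: power2_eq_square)
      then show ?thesis
        using mult_left_mono[of "v 0" M "W' 0 * W' 0"] M(2)[of 0] by (simp add: mult.commute)
    next
      case False
      then have "W' 0 * W' 0 * v 0 \<le> 0"
        using sign(1) by (intro mult_nonneg_nonpos) auto
      moreover have "0 \<le> M * (W 0)\<^sup>2"
        using M(1) by simp
      ultimately show ?thesis
        by simp
    qed
    moreover have "M * b = M * (W 0)\<^sup>2 + M * (W 1)\<^sup>2" "M * E = M * A + M * b"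
      by (simp_all add: b_def E(1) distrib_left)
    ultimately show ?thesis
      using J by simp
  qed
  \<comment> \<open>The product \<open>W' W v'\<close> is differentiated. Its boundary values are
    \<open>- W^2 v'\<close> at 1 and \<open>W^2 v'\<close> at 0 under either kind of condition. The
    interior and boundary terms give \<open>M * E\<close>, the term with \<open>v''\<close> another
    \<open>3 / 2 * M * E\<close>.\<close>
  have T2: "- (\<integral>x. (Y x * v' x) * W x \<partial>U) \<le> 5 / 2 * M * E"
  proof -
    have "(\<integral>x. (- Y x * W x + W' x * W' x) * v' x + (W' x * W x) * v'' x \<partial>U) = W' 1 * W 1 * v' 1 - W' 0 * W 0 * v' 0"
      using prim_FTC[OF prim_mult[OF prim_mult[OF W' W] v']] .
    moreover have "(\<integral>x. (- Y x * W x + W' x * W' x) * v' x + (W' x * W x) * v'' x \<partial>U)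
        = (\<integral>x. (W' x)\<^sup>2 * v' x + (W' x * W x) * v'' x - (Y x * v' x) * W x \<partial>U)"
      by (rule Bochner_Integration.integral_cong) (auto simp: power2_eq_square algebra_simps)
    moreover have "\<dots> = (\<integral>x. (W' x)\<^sup>2 * v' x \<partial>U) + (\<integral>x. (W' x * W x) * v'' x \<partial>U) - (\<integral>x. (Y x * v' x) * W x \<partial>U)"
      using i2 i3 i4 by simp
    moreover have "W' 1 * W 1 * v' 1 \<le> M * (W 1)\<^sup>2"
    proof -
      have "W' 1 * W 1 = - (W 1)\<^sup>2"
        using potential_1[OF p] by (simp add: power2_eq_square)
      then show ?thesis
        using mult_left_mono[of "- v' 1" M "(W 1)\<^sup>2"] M(3)[of 1] by (simp add: mult.commute)
    qed
    moreover have "- (W' 0 * W 0 * v' 0) \<le> M * (W 0)\<^sup>2"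
    proof -
      have "W' 0 * W 0 = (W 0)\<^sup>2"
        using potential_0[OF p] by (simp add: power2_eq_square)
      then show ?thesis
        using mult_left_mono[of "- v' 0" M "(W 0)\<^sup>2"] M(3)[of 0] by (simp add: mult.commute)
    qed
    \<comment> \<open>Since \<open>v''\<close> is bounded in mean square only, \<open>W\<close> is
      taken pointwise. Young's weight \<open>M\<close> balances \<open>W'\<close> against a factor
      of size \<open>M\<close>, and the result is linear in \<open>M\<close>.\<close>
    moreover have "\<bar>\<integral>x. (W' x * W x) * v'' x \<partial>U\<bar> \<le> 3 / 2 * M * E"
    proof -
      have "(\<integral>x. (v'' x * W x)\<^sup>2 \<partial>U) \<le> 2 * E * sqnorm v''"
        by (rule integral_square_mult_le[OF v'' continuous_measurable_U[OF c(1)]])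
          (use potential_square_le[OF p] in \<open>simp add: E_def\<close>)
      also have "\<dots> \<le> 2 * E * M\<^sup>2"
        using M(4) E by (intro mult_left_mono) auto
      finally have "(\<integral>x. (v'' x * W x)\<^sup>2 \<partial>U) / M \<le> 2 * E * M\<^sup>2 / M"
        using M(1) by (intro divide_right_mono) auto
      then have "(\<integral>x. (v'' x * W x)\<^sup>2 \<partial>U) / M \<le> 2 * M * E"
        using M(1) by (simp add: power2_eq_square[of M] ac_simps)
      moreover have "M * A \<le> M * E"
        using M(1) E by (intro mult_left_mono) auto
      moreover have "\<bar>\<integral>x. W' x * (v'' x * W x) \<partial>U\<bar> \<le> (M * A + (\<integral>x. (v'' x * W x)\<^sup>2 \<partial>U) / M) / 2"
        unfolding A_def
        by (rule integral_young[OF potential_L2'[OF p] L2_mult_continuous[OF v'' c(1)] M(1)])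
      ultimately show ?thesis
        by (simp add: ac_simps)
    qed
    moreover have "M * b = M * (W 0)\<^sup>2 + M * (W 1)\<^sup>2" "M * E = M * A + M * b"
      by (simp_all add: b_def E(1) distrib_left)
    ultimately show ?thesis
      using J by simp
  qed
  have T3: "(\<integral>x. (z x * D x) * W' x \<partial>U) \<le> (1 + M\<^sup>2) / 2 * E"
  proof -
    have "(\<integral>x. (z x * D x)\<^sup>2 \<partial>U) \<le> E * sqnorm z"
      by (rule integral_square_mult_le[OF z continuous_measurable_U[OF c(5)]])
        (use diff_square_le_energy[OF p] in \<open>simp add: E_def\<close>)
    also have "\<dots> \<le> E * M\<^sup>2"
      using M(5) E by (intro mult_left_mono) auto
    finally show ?thesis
      using integral_young[OF L2_mult_continuous[OF z c(5)] potential_L2'[OF p], of 1] E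
      by (simp add: A_def[symmetric] abs_le_iff algebra_simps)
  qed
  have T4: "- (\<integral>x. D' x * (z x * W x) \<partial>U) \<le> (1 + 2 * M\<^sup>2) / 2 * E"
  proof -
    have "(\<integral>x. (z x * W x)\<^sup>2 \<partial>U) \<le> 2 * E * sqnorm z"
      by (rule integral_square_mult_le[OF z continuous_measurable_U[OF c(1)]])
        (use potential_square_le[OF p] in \<open>simp add: E_def\<close>)
    also have "\<dots> \<le> 2 * E * M\<^sup>2"
      using M(5) E by (intro mult_left_mono) auto
    finally show ?thesis
      using integral_young[OF D(2) L2_mult_continuous[OF z c(1)], of 1] deriv_le_energy[OF p]
      by (simp add: E_def[symmetric] abs_le_iff algebra_simps)
  qed
  have "flux Y v v' z D D' W W' \<le> M / 2 * E + 5 / 2 * M * E + (1 + M\<^sup>2) / 2 * E + (1 + 2 * M\<^sup>2) / 2 * E"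
    unfolding flux_split[OF c(1,2)] using T1 T2 T3 T4 by linarith
  also have "\<dots> = (1 + 3 * M + 3/2 * M\<^sup>2) * E"
    by (simp add: field_simps)
  also have "\<dots> \<le> (1 + 3 * M + 2 * M\<^sup>2) * E"
    using E by (intro mult_right_mono) auto
  finally show ?thesis
    by (simp add: E_def)
qed

text \<open>Meant for the remainder that arises when the test function is compared with the
  potential at an intermediate time. Nothing cancels here, so each term is bounded crudely by
  Young's inequality with weight \<open>\<epsilon>\<close> or its inverse: the side of
  \<open>g\<close> has mean square of order \<open>\<epsilon>\<^sup>2\<close> and the other side is
  bounded, which gives a bound linear in \<open>\<epsilon>\<close>.\<close>

lemma flux_le_small:
  assumes q: "potential l r X g g'" and \<epsilon>: "0 < \<epsilon>" "energy g g' \<le> \<epsilon>\<^sup>2"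
  shows "flux Y v v' z D D' g g' \<le> (2 + 20 * M\<^sup>2 + 20 * M ^ 4) * \<epsilon>"
proof -
  note Y = coeff_Y and v = coeff_v and v' = coeff_v' and v'' = coeff_v'' and z = coeff_z
    and D = coeff_D and M = coeff_M and YM = coeff_YM
  note c = potential_cont[OF q] potential_cont'_unit[OF q]
    prim_continuous[OF v] prim_continuous[OF v'] prim_continuous[OF D(1)]
  \<comment> \<open>An auxiliary potential of \<open>Y\<close> that is independent of
    \<open>l\<close> and \<open>r\<close>: it only serves to bound \<open>D\<close> and
    \<open>D'\<close> through \<open>M\<close>, its energy being at most
    \<open>2 * sqnorm Y \<le> 8 * M\<^sup>2\<close>.\<close>
  obtain W W' where p: "potential False False Y W W'"
    using potential_exists[OF Y] by blast
  define E where "E = energy W W'"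
  have E: "0 \<le> E" "E \<le> 8 * M\<^sup>2"
    using energy_le[OF p] energy_nonneg[OF p] YM by (simp_all add: E_def)
  have g': "sqnorm g' / \<epsilon> \<le> \<epsilon>"
    using order_trans[OF energy_ge[OF q] \<epsilon>(2)] \<epsilon>(1) by (simp add: divide_le_eq power2_eq_square)
  have gsq: "(g x)\<^sup>2 \<le> 2 * \<epsilon>\<^sup>2" if "x \<in> {0..1}" for x
    using potential_square_le[OF q that] \<epsilon>(2) by simp
  have sq: "(f x)\<^sup>2 \<le> M\<^sup>2" if "\<bar>f x\<bar> \<le> M" for f :: "real \<Rightarrow> real" and x
    using power_mono[OF that, of 2] by simp
  have T1: "(\<integral>x. (Y x * v x) * g' x \<partial>U) \<le> (4 * M ^ 4 + 1) / 2 * \<epsilon>"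
  proof -
    have "(\<integral>x. (Y x * v x)\<^sup>2 \<partial>U) \<le> M\<^sup>2 * sqnorm Y"
      by (rule integral_square_mult_le[OF Y continuous_measurable_U[OF c(3)]])
        (use M(2) sq in simp)
    also have "\<dots> \<le> M\<^sup>2 * (4 * M\<^sup>2)"
      using YM by (intro mult_left_mono) auto
    finally have "\<epsilon> * (\<integral>x. (Y x * v x)\<^sup>2 \<partial>U) \<le> \<epsilon> * (4 * M ^ 4)"
      using \<epsilon>(1) by (intro mult_left_mono) (auto simp: power2_eq_square eval_nat_numeral)
    then show ?thesis
      using integral_young[OF L2_mult_continuous[OF Y c(3)] potential_L2'[OF q] \<epsilon>(1)] g'
      by (simp add: abs_le_iff algebra_simps)
  qed
  have T2: "(\<integral>x. (z x * D x) * g' x \<partial>U) \<le> (8 * M ^ 4 + 1) / 2 * \<epsilon>"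
  proof -
    have "(\<integral>x. (z x * D x)\<^sup>2 \<partial>U) \<le> E * sqnorm z"
      by (rule integral_square_mult_le[OF z continuous_measurable_U[OF c(5)]])
        (use diff_square_le_energy[OF p] in \<open>simp add: E_def\<close>)
    also have "\<dots> \<le> (8 * M\<^sup>2) * M\<^sup>2"
      using M(5) E by (intro mult_mono) auto
    finally have "\<epsilon> * (\<integral>x. (z x * D x)\<^sup>2 \<partial>U) \<le> \<epsilon> * (8 * M ^ 4)"
      using \<epsilon>(1) by (intro mult_left_mono) (auto simp: power2_eq_square eval_nat_numeral)
    then show ?thesis
      using integral_young[OF L2_mult_continuous[OF z c(5)] potential_L2'[OF q] \<epsilon>(1)] g'
      by (simp add: abs_le_iff algebra_simps)
  qed
  have T3: "- (\<integral>x. (Y x * v' x) * g x \<partial>U) \<le> (4 * M ^ 4 + 2) / 2 * \<epsilon>"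
  proof -
    have "(\<integral>x. (Y x * v' x)\<^sup>2 \<partial>U) \<le> M\<^sup>2 * sqnorm Y"
      by (rule integral_square_mult_le[OF Y continuous_measurable_U[OF c(4)]])
        (use M(3) sq in simp)
    also have "\<dots> \<le> M\<^sup>2 * (4 * M\<^sup>2)"
      using YM by (intro mult_left_mono) auto
    finally have "\<epsilon> * (\<integral>x. (Y x * v' x)\<^sup>2 \<partial>U) \<le> \<epsilon> * (4 * M ^ 4)"
      using \<epsilon>(1) by (intro mult_left_mono) (auto simp: power2_eq_square eval_nat_numeral)
    moreover have "(\<integral>x. (1 * g x)\<^sup>2 \<partial>U) \<le> 2 * \<epsilon>\<^sup>2 * (\<integral>x. 1\<^sup>2 \<partial>U)"
      by (rule integral_square_mult_le[OF L2_const continuous_measurable_U[OF c(1)]]) (use gsq in simp)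
    then have "sqnorm g / \<epsilon> \<le> 2 * \<epsilon>"
      using \<epsilon>(1) by (simp add: divide_le_eq power2_eq_square)
    ultimately show ?thesis
      using integral_young[OF L2_mult_continuous[OF Y c(4)] continuous_L2[OF c(1)] \<epsilon>(1)]
      by (simp add: abs_le_iff algebra_simps)
  qed
  have T4: "- (\<integral>x. D' x * (z x * g x) \<partial>U) \<le> (8 * M\<^sup>2 + 2 * M\<^sup>2) / 2 * \<epsilon>"
  proof -
    have "(\<integral>x. (z x * g x)\<^sup>2 \<partial>U) \<le> 2 * \<epsilon>\<^sup>2 * sqnorm z"
      by (rule integral_square_mult_le[OF z continuous_measurable_U[OF c(1)]]) (use gsq in simp)
    also have "\<dots> \<le> 2 * \<epsilon>\<^sup>2 * M\<^sup>2"
      using M(5) by (intro mult_left_mono) auto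
    finally have "(\<integral>x. (z x * g x)\<^sup>2 \<partial>U) / \<epsilon> \<le> 2 * M\<^sup>2 * \<epsilon>"
      using \<epsilon>(1) by (simp add: divide_le_eq power2_eq_square ac_simps)
    moreover have "\<epsilon> * sqnorm D' \<le> \<epsilon> * (8 * M\<^sup>2)"
      using deriv_le_energy[OF p] E \<epsilon>(1) by (intro mult_left_mono) (auto simp: E_def)
    ultimately show ?thesis
      using integral_young[OF D(2) L2_mult_continuous[OF z c(1)] \<epsilon>(1)]
      by (simp add: abs_le_iff algebra_simps)
  qed
  have "flux Y v v' z D D' g g' \<le> (4 * M ^ 4 + 1) / 2 * \<epsilon> + (8 * M ^ 4 + 1) / 2 * \<epsilon>
      + (4 * M ^ 4 + 2) / 2 * \<epsilon> + (8 * M\<^sup>2 + 2 * M\<^sup>2) / 2 * \<epsilon>"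
    unfolding flux_split[OF c(1,2)] using T1 T2 T3 T4 by linarith
  also have "\<dots> = (2 + 5 * M\<^sup>2 + 8 * M ^ 4) * \<epsilon>"
    by (simp add: field_simps)
  also have "\<dots> \<le> (2 + 20 * M\<^sup>2 + 20 * M ^ 4) * \<epsilon>"
    using \<epsilon>(1) M(1) by (intro mult_right_mono) auto
  finally show ?thesis .
qed

end

section \<open>Bounds for the velocity\<close>

lemma poly_pderiv_power_root:
  fixes r :: "real poly"
  shows "k \<le> n \<Longrightarrow> poly ((pderiv ^^ k) ([:-c, 1:] ^ n * r)) c = (if k = n then fact n * poly r c else 0)"
proof (induction n arbitrary: k r)
  case (Suc n)
  show ?case
  proof (cases k)
    case 0
    then show ?thesis by simp
  next
    case (Suc m)
    \<comment> \<open>One derivative turns the power \<open>Suc n\<close> into the power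
      \<open>n\<close> with a new cofactor, whose value at \<open>c\<close> is \<open>Suc n\<close>
      times that of \<open>r\<close>. This is why the induction hypothesis is needed for arbitrary
      \<open>r\<close>.\<close>
    have "pderiv ([:-c, 1:] ^ Suc n * r) = [:-c, 1:] ^ n * (smult (of_nat (Suc n)) r + [:-c, 1:] * pderiv r)"
      by (simp only: pderiv_mult pderiv_power_Suc) (simp add: pderiv_pCons algebra_simps)
    then have e: "(pderiv ^^ k) ([:-c, 1:] ^ Suc n * r)
        = (pderiv ^^ m) ([:-c, 1:] ^ n * (smult (of_nat (Suc n)) r + [:-c, 1:] * pderiv r))"
      unfolding Suc by (simp only: funpow_Suc_right o_apply)
    have "m \<le> n"
      using Suc.prems Suc by simp
    from Suc.IH[OF this, of "smult (of_nat (Suc n)) r + [:-c, 1:] * pderiv r"] show ?thesis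
      unfolding e by (simp add: Suc del: mult_pCons_left)
  qed
qed simp

lemma pderiv_funpow_add: "(pderiv ^^ k) (p + q) = (pderiv ^^ k) p + (pderiv ^^ k) (q :: real poly)"
  by (induction k) (simp_all add: pderiv_add)

text \<open>The correction \<open>x^n (x - 1)^n (\<alpha> + \<beta> x)\<close> has zeros of order
  \<open>n\<close> at both ends, so it leaves the derivatives of lower order alone. Its
  \<open>n\<close>-th derivative is \<open>n! (-1)^n \<alpha>\<close> at 0 and
  \<open>n! (\<alpha> + \<beta>)\<close> at 1, which determines \<open>\<alpha>\<close> and then
  \<open>\<beta>\<close>.\<close>

lemma hermite_interpolation:
  fixes a b :: "nat \<Rightarrow> real"
  shows "\<exists>p. \<forall>i<n. poly ((pderiv ^^ i) p) 0 = a i \<and> poly ((pderiv ^^ i) p) 1 = b i"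
proof (induction n)
  case (Suc n)
  then obtain p where p: "\<forall>i<n. poly ((pderiv ^^ i) p) 0 = a i \<and> poly ((pderiv ^^ i) p) 1 = b i"
    by blast
  define \<alpha> where "\<alpha> = (-1) ^ n * (a n - poly ((pderiv ^^ n) p) 0) / fact n"
  define \<beta> where "\<beta> = (b n - poly ((pderiv ^^ n) p) 1) / fact n - \<alpha>"
  define q where "q = [:-0, 1:] ^ n * ([:-1, 1:] ^ n * [:\<alpha>, \<beta>:])"
  have q': "q = [:-1, 1:] ^ n * ([:-0, 1:] ^ n * [:\<alpha>, \<beta>:])"
    unfolding q_def by (rule mult.left_commute)
  have "poly ((pderiv ^^ i) q) 0 = (if i = n then a n - poly ((pderiv ^^ n) p) 0 else 0)" if "i \<le> n" for i
    unfolding q_def poly_pderiv_power_root[OF that]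
    by (simp add: \<alpha>_def power_mult_distrib[symmetric])
  moreover have "poly ((pderiv ^^ i) q) 1 = (if i = n then b n - poly ((pderiv ^^ n) p) 1 else 0)" if "i \<le> n" for i
    unfolding q' poly_pderiv_power_root[OF that] by (simp add: \<beta>_def)
  ultimately have "\<forall>i<Suc n. poly ((pderiv ^^ i) (p + q)) 0 = a i \<and> poly ((pderiv ^^ i) (p + q)) 1 = b i"
    using p by (auto simp: pderiv_funpow_add less_Suc_eq)
  then show ?case by blast
qed simp

text \<open>The constant must not depend on the boundary values, which vary in time. The lift is
  therefore a linear combination of \<open>2 * n\<close> fixed polynomials, one for each boundary
  derivative, and \<open>K\<close> is the sum of the bounds of all their derivatives up to order
  \<open>n\<close>.\<close>

lemma Hn_jet_lift:
  obtains K :: real where "0 \<le> K"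
    "\<And>bl br B. (\<And>i. i < n \<Longrightarrow> \<bar>bl i\<bar> \<le> B \<and> \<bar>br i\<bar> \<le> B) \<Longrightarrow> 0 \<le> B \<Longrightarrow>
      \<exists>P. Hn_jet n P \<and> (\<forall>i<n. P i 0 = bl i \<and> P i 1 = br i) \<and> (\<forall>i\<le>n. \<forall>x\<in>{0..1}. \<bar>P i x\<bar> \<le> K * B)"
proof -
  have "\<exists>p. \<forall>i<n. poly ((pderiv ^^ i) p) 0 = (if i = j then 1 else 0) \<and> poly ((pderiv ^^ i) p) 1 = (0::real)" for j
    using hermite_interpolation[of n "\<lambda>i. if i = j then 1 else 0" "\<lambda>_. 0"] .
  then have "\<forall>j. \<exists>p. \<forall>i<n. poly ((pderiv ^^ i) p) 0 = (if i = j then 1 else 0) \<and> poly ((pderiv ^^ i) p) 1 = (0::real)"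
    by blast
  from choice[OF this] obtain L where L: "\<And>j i. i < n \<Longrightarrow> poly ((pderiv ^^ i) (L j)) 0 = (if i = j then 1 else 0 :: real)"
      "\<And>j i. i < n \<Longrightarrow> poly ((pderiv ^^ i) (L j)) 1 = (0::real)"
    by blast
  have "\<exists>p. \<forall>i<n. poly ((pderiv ^^ i) p) 0 = (0::real) \<and> poly ((pderiv ^^ i) p) 1 = (if i = j then 1 else 0)" for j
    using hermite_interpolation[of n "\<lambda>_. 0" "\<lambda>i. if i = j then 1 else 0"] .
  then have "\<forall>j. \<exists>p. \<forall>i<n. poly ((pderiv ^^ i) p) 0 = (0::real) \<and> poly ((pderiv ^^ i) p) 1 = (if i = j then 1 else 0)"
    by blast
  from choice[OF this] obtain R where R: "\<And>j i. i < n \<Longrightarrow> poly ((pderiv ^^ i) (R j)) 1 = (if i = j then 1 else 0 :: real)"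
      "\<And>j i. i < n \<Longrightarrow> poly ((pderiv ^^ i) (R j)) 0 = (0::real)"
    by blast
  define l where "l i j = poly ((pderiv ^^ i) (L j))" for i j
  define r where "r i j = poly ((pderiv ^^ i) (R j))" for i j
  have D: "(l i j has_real_derivative l (Suc i) j x) (at x)" "(r i j has_real_derivative r (Suc i) j x) (at x)" for i j x
    unfolding l_def r_def using poly_DERIV[of "(pderiv ^^ i) (L j)" x] poly_DERIV[of "(pderiv ^^ i) (R j)" x] by simp_all
  have cont: "continuous_on A (l i j)" "continuous_on A (r i j)" for A i j
    unfolding l_def r_def by (rule continuous_at_imp_continuous_on, simp)+
  have "\<exists>c. \<forall>x\<in>{0..1}. \<bar>l i j x\<bar> + \<bar>r i j x\<bar> \<le> c" for i j
  proof -
    have "continuous_on {0..1} (\<lambda>x. \<bar>l i j x\<bar> + \<bar>r i j x\<bar>)"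
      by (intro continuous_on_add continuous_on_rabs cont)
    from continuous_bounded_unit[OF this] show ?thesis
      by (metis abs_le_D1)
  qed
  then obtain c where c: "\<And>i j x. x \<in> {0..1} \<Longrightarrow> \<bar>l i j x\<bar> + \<bar>r i j x\<bar> \<le> c i j"
    by metis
  have c0: "0 \<le> c i j" for i j
    using c[of 0 i j] by simp
  define K where "K = (\<Sum>i\<le>n. \<Sum>j<n. c i j)"
  show thesis
  proof
    show "0 \<le> K"
      unfolding K_def by (intro sum_nonneg c0)
    fix bl br :: "nat \<Rightarrow> real" and B :: real
    assume b: "\<And>i. i < n \<Longrightarrow> \<bar>bl i\<bar> \<le> B \<and> \<bar>br i\<bar> \<le> B" and B: "0 \<le> B"
    define P where "P i x = (\<Sum>j<n. bl j * l i j x + br j * r i j x)" for i x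
    have contP: "continuous_on A (P i)" for A i
      unfolding P_def by (intro continuous_on_sum continuous_on_add continuous_on_mult continuous_on_const cont)
    have DP: "(P i has_real_derivative P (Suc i) x) (at x)" for i x
      unfolding P_def by (intro DERIV_sum DERIV_add DERIV_cmult D)
    have "Hn_jet n P"
      unfolding Hn_jet_iff using prim_C1[OF DP contP] continuous_L2[OF contP] by blast
    moreover have "P i 0 = bl i \<and> P i 1 = br i" if "i < n" for i
    proof -
      have "bl j * l i j 0 + br j * r i j 0 = (if j = i then bl i else 0)"
        "bl j * l i j 1 + br j * r i j 1 = (if j = i then br i else 0)" for j
        using L[OF that] R[OF that] by (auto simp: l_def r_def)
      then show ?thesis
        unfolding P_def using that by simp
    qed
    moreover have "\<bar>P i x\<bar> \<le> K * B" if i: "i \<le> n" and x: "x \<in> {0..1}" for i x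
    proof -
      have "\<bar>P i x\<bar> \<le> (\<Sum>j<n. \<bar>bl j * l i j x + br j * r i j x\<bar>)"
        unfolding P_def by (rule sum_abs)
      also have "\<dots> \<le> (\<Sum>j<n. c i j * B)"
      proof (rule sum_mono)
        fix j assume "j \<in> {..<n}"
        then have "\<bar>bl j\<bar> \<le> B" "\<bar>br j\<bar> \<le> B"
          using b by auto
        then have "\<bar>bl j\<bar> * \<bar>l i j x\<bar> \<le> B * \<bar>l i j x\<bar>" "\<bar>br j\<bar> * \<bar>r i j x\<bar> \<le> B * \<bar>r i j x\<bar>"
          by (auto intro: mult_right_mono)
        moreover have "B * (\<bar>l i j x\<bar> + \<bar>r i j x\<bar>) \<le> B * c i j"
          using c[OF x] B by (intro mult_left_mono)
        moreover have "\<bar>bl j * l i j x + br j * r i j x\<bar> \<le> \<bar>bl j\<bar> * \<bar>l i j x\<bar> + \<bar>br j\<bar> * \<bar>r i j x\<bar>"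
          unfolding abs_mult[symmetric] by (rule abs_triangle_ineq)
        ultimately show "\<bar>bl j * l i j x + br j * r i j x\<bar> \<le> c i j * B"
          by (simp add: distrib_left mult.commute)
      qed
      also have "\<dots> = (\<Sum>j<n. c i j) * B"
        by (simp add: sum_distrib_right)
      also have "\<dots> \<le> K * B"
        unfolding K_def using i B
        by (intro mult_right_mono member_le_sum[of i "{..n}" "\<lambda>i. \<Sum>j<n. c i j"] sum_nonneg c0) auto
      finally show ?thesis .
    qed
    ultimately show "\<exists>P. Hn_jet n P \<and> (\<forall>i<n. P i 0 = bl i \<and> P i 1 = br i) \<and> (\<forall>i\<le>n. \<forall>x\<in>{0..1}. \<bar>P i x\<bar> \<le> K * B)"
      by blast
  qed
qed

section \<open>The elliptic problem at a fixed time\<close>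

lemma Hn_jet_diff: "Hn_jet n d \<Longrightarrow> Hn_jet n e \<Longrightarrow> Hn_jet n (\<lambda>i x. d i x - e i x)"
  unfolding Hn_jet_iff by (blast intro: L2_diff prim_diff)

text \<open>Boundary values are left out because the lemmas below constrain them in different ways:
  by agreement with a lift, by a bound, or by agreement of two solutions.\<close>

definition elliptic_solution :: "nat \<Rightarrow> (real \<Rightarrow> real) \<Rightarrow> (nat \<Rightarrow> real \<Rightarrow> real) \<Rightarrow> bool" where
  "elliptic_solution n y d \<longleftrightarrow> Hn_jet n d \<and>
     (\<forall>g. Hn0_jet n g \<longrightarrow> (\<integral>x. (\<Sum>i\<le>n. d i x * g i x) \<partial>U) = (\<integral>x. y x * g 0 x \<partial>U))"

text \<open>The equation is tested with \<open>d - P\<close>, which lies in \<open>H^n_0\<close>.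
  Young's inequality with weight 1/2 leaves a quarter of the left side twice; absorbing this half
  doubles the remaining factors 3/2.\<close>

lemma elliptic_jet_bound:
  assumes e: "elliptic_solution n y d" and y: "L2 y" and P: "Hn_jet n P"
    and b: "\<And>i. i < n \<Longrightarrow> d i 0 = P i 0 \<and> d i 1 = P i 1"
  shows "(\<Sum>i\<le>n. sqnorm (d i)) \<le> 3 * (\<Sum>i\<le>n. sqnorm (P i)) + 3 * sqnorm y"
proof -
  have d: "Hn_jet n d"
    using e by (simp add: elliptic_solution_def)
  have Ld: "L2 (d i)" and LP: "L2 (P i)" if "i \<le> n" for i
    using d P that unfolding Hn_jet_iff by blast+
  have "Hn0_jet n (\<lambda>i x. d i x - P i x)"
    unfolding Hn0_jet_def using Hn_jet_diff[OF d P] b by simp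
  then have "(\<integral>x. (\<Sum>i\<le>n. d i x * (d i x - P i x)) \<partial>U) = (\<integral>x. y x * (d 0 x - P 0 x) \<partial>U)"
    using e unfolding elliptic_solution_def by blast
  moreover have "(\<integral>x. (\<Sum>i\<le>n. d i x * (d i x - P i x)) \<partial>U)
      = (\<Sum>i\<le>n. sqnorm (d i) - (\<integral>x. d i x * P i x \<partial>U))"
  proof -
    have "(\<integral>x. (\<Sum>i\<le>n. d i x * (d i x - P i x)) \<partial>U) = (\<Sum>i\<le>n. \<integral>x. d i x * (d i x - P i x) \<partial>U)"
      by (rule Bochner_Integration.integral_sum) (simp add: L2_mult_integrable Ld LP L2_diff)
    also have "\<dots> = (\<Sum>i\<le>n. sqnorm (d i) - (\<integral>x. d i x * P i x \<partial>U))"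
      by (rule sum.cong) (simp_all add: right_diff_distrib power2_eq_square L2_mult_integrable Ld LP)
    finally show ?thesis .
  qed
  moreover have "(\<integral>x. y x * (d 0 x - P 0 x) \<partial>U) = (\<integral>x. d 0 x * y x \<partial>U) - (\<integral>x. y x * P 0 x \<partial>U)"
    using L2_mult_integrable[OF y Ld[of 0]] L2_mult_integrable[OF y LP[of 0]]
    by (simp add: right_diff_distrib mult.commute)
  ultimately have "(\<Sum>i\<le>n. sqnorm (d i)) = (\<Sum>i\<le>n. \<integral>x. d i x * P i x \<partial>U) + (\<integral>x. d 0 x * y x \<partial>U) - (\<integral>x. y x * P 0 x \<partial>U)"
    by (simp add: sum_subtractf)
  moreover have "(\<Sum>i\<le>n. \<integral>x. d i x * P i x \<partial>U) \<le> (\<Sum>i\<le>n. sqnorm (d i) / 4 + sqnorm (P i))"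
  proof (rule sum_mono)
    fix i assume "i \<in> {..n}"
    then show "(\<integral>x. d i x * P i x \<partial>U) \<le> sqnorm (d i) / 4 + sqnorm (P i)"
      using integral_young[OF Ld LP, of i i "1/2"] by (simp add: abs_le_iff add_divide_distrib)
  qed
  moreover have "\<dots> = (\<Sum>i\<le>n. sqnorm (d i)) / 4 + (\<Sum>i\<le>n. sqnorm (P i))"
    by (simp add: sum.distrib sum_divide_distrib)
  moreover have "(\<integral>x. d 0 x * y x \<partial>U) \<le> sqnorm (d 0) / 4 + sqnorm y"
    using integral_young[OF Ld y, of 0 "1/2"] by (simp add: abs_le_iff add_divide_distrib)
  moreover have "- (\<integral>x. y x * P 0 x \<partial>U) \<le> sqnorm y / 2 + sqnorm (P 0) / 2"
    using integral_young[OF y LP, of 0 1] by (simp add: abs_le_iff add_divide_distrib)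
  moreover have "sqnorm (d 0) \<le> (\<Sum>i\<le>n. sqnorm (d i))"
    by (rule member_le_sum) auto
  moreover have "sqnorm (P 0) \<le> (\<Sum>i\<le>n. sqnorm (P i))"
    by (rule member_le_sum) auto
  ultimately show ?thesis
    by linarith
qed

text \<open>When \<open>d 1\<close> is only a class, a bound at every point makes no sense for it;
  hence the separate continuous representative \<open>v'\<close>, with a second derivative
  \<open>v''\<close> that may lie outside the jet.\<close>

definition regular_jet :: "real \<Rightarrow> (nat \<Rightarrow> real \<Rightarrow> real) \<Rightarrow> bool" where
  "regular_jet M d \<longleftrightarrow> sqnorm (d 0) \<le> M \<and> sqnorm (d 1) \<le> M \<and>
     (\<exists>v' v''. prim (d 0) v' \<and> prim v' v'' \<and> L2 v'' \<and> (AE x in U. d 1 x = v' x) \<and>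
       (\<forall>x\<in>{0..1}. \<bar>d 0 x\<bar> \<le> M \<and> \<bar>v' x\<bar> \<le> M) \<and> sqnorm v'' \<le> M\<^sup>2)"

text \<open>For \<open>n = 1\<close> the second derivative is not part of the jet and comes from the equation.\<close>

lemma elliptic_regularity:
  assumes n: "1 \<le> n" and N: "0 \<le> N" and B: "0 \<le> B"
  shows "\<exists>M>0. \<forall>y d. L2 y \<longrightarrow> sqnorm y \<le> N \<longrightarrow> elliptic_solution n y d \<longrightarrow>
      (\<forall>i<n. \<bar>d i 0\<bar> \<le> B \<and> \<bar>d i 1\<bar> \<le> B) \<longrightarrow> regular_jet M d"
proof -
  obtain K where K: "0 \<le> K"
    "\<And>bl br B. (\<And>i. i < n \<Longrightarrow> \<bar>bl i\<bar> \<le> B \<and> \<bar>br i\<bar> \<le> B) \<Longrightarrow> 0 \<le> B \<Longrightarrow>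
      \<exists>P. Hn_jet n P \<and> (\<forall>i<n. P i 0 = bl i \<and> P i 1 = br i) \<and> (\<forall>i\<le>n. \<forall>x\<in>{0..1}. \<bar>P i x\<bar> \<le> K * B)"
    using Hn_jet_lift by blast
  \<comment> \<open>The right side of \<open>elliptic_jet_bound\<close> for a lift whose
    \<open>n + 1\<close> derivatives are at most \<open>K * B\<close>.\<close>
  define S where "S = 3 * ((real n + 1) * (K * B)\<^sup>2) + 3 * N"
  \<comment> \<open>The part \<open>1 + B + S\<close> bounds the continuous derivatives,
    \<open>16 * S + 12 * N\<close> bounds the square of \<open>v'\<close> when \<open>n = 1\<close>,
    and \<open>1 \<le> M\<close> gives \<open>M \<le> M\<^sup>2\<close>.\<close>
  define M where "M = 1 + B + 16 * S + 12 * N"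
  have S: "0 \<le> S"
    using N by (simp add: S_def)
  have M: "1 \<le> M"
    using S N B by (simp add: M_def)
  have M2: "M \<le> M\<^sup>2"
    using M by (simp add: power2_eq_square)
  have small: "\<bar>a\<bar> \<le> M" if "a\<^sup>2 \<le> M" for a
    using that M2 abs_le_square_iff[of a M] M by simp
  show ?thesis
  proof (intro exI[of _ M] conjI allI impI)
    show "0 < M" using M by simp
    fix y d
    assume y: "L2 y" "sqnorm y \<le> N" and e: "elliptic_solution n y d"
      and bd: "\<forall>i<n. \<bar>d i 0\<bar> \<le> B \<and> \<bar>d i 1\<bar> \<le> B"
    have b: "\<And>i. i < n \<Longrightarrow> \<bar>d i 0\<bar> \<le> B \<and> \<bar>d i 1\<bar> \<le> B"
      using bd by blast
    have d: "Hn_jet n d"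
      using e by (simp add: elliptic_solution_def)
    have Ld: "L2 (d i)" if i: "i \<le> n" for i
      using d i unfolding Hn_jet_iff by blast
    have pd: "prim (d i) (d (Suc i))" if i: "i < n" for i
      using d i unfolding Hn_jet_iff by blast
    obtain P where P: "Hn_jet n P" "\<And>i. i < n \<Longrightarrow> P i 0 = d i 0 \<and> P i 1 = d i 1"
        "\<And>i x. i \<le> n \<Longrightarrow> x \<in> {0..1} \<Longrightarrow> \<bar>P i x\<bar> \<le> K * B"
      using K(2)[of "\<lambda>i. d i 0" B "\<lambda>i. d i 1", OF b B] by blast
    have "sqnorm (P i) \<le> (K * B)\<^sup>2" if i: "i \<le> n" for i
    proof -
      have L: "L2 (P i)"
        using P(1) i unfolding Hn_jet_iff by blast
      have "(P i x)\<^sup>2 \<le> (K * B)\<^sup>2" if x: "x \<in> {0<..<1}" for x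
        using power_mono[OF P(3)[OF i, of x], of 2] x by simp
      from integral_square_mult_le[OF L2_const[of 1] L2_measurable[OF L] this] show ?thesis
        by simp
    qed
    then have "(\<Sum>i\<le>n. sqnorm (P i)) \<le> (\<Sum>i\<le>n. (K * B)\<^sup>2)"
      by (intro sum_mono) simp
    moreover have "(\<Sum>i\<le>n. sqnorm (d i)) \<le> 3 * (\<Sum>i\<le>n. sqnorm (P i)) + 3 * sqnorm y"
      by (rule elliptic_jet_bound[OF e y(1) P(1)]) (simp add: P(2))
    ultimately have sum: "(\<Sum>i\<le>n. sqnorm (d i)) \<le> S"
      using y(2) unfolding S_def by (simp add: add.commute)
    have dS: "sqnorm (d i) \<le> S" if i: "i \<le> n" for i
    proof -
      have "sqnorm (d i) \<le> (\<Sum>i\<le>n. sqnorm (d i))"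
        by (rule member_le_sum) (use i in auto)
      with sum show ?thesis by simp
    qed
    have SM: "S \<le> M" "16 * S + 12 * N \<le> M"
      using S N B by (simp_all add: M_def)
    have sup: "\<bar>d i x\<bar> \<le> M" if i: "i < n" and x: "x \<in> {0..1}" for i x
    proof -
      have "(d i x - d i 0)\<^sup>2 \<le> S"
        using prim_square_le[OF pd[OF i] Ld x] dS[of "Suc i"] i by simp
      also have "S \<le> (1 + S)\<^sup>2"
        using S zero_le_power2[of S] by (simp add: power2_sum)
      finally have "\<bar>d i x - d i 0\<bar> \<le> 1 + S"
        using abs_le_square_iff[of "d i x - d i 0" "1 + S"] S by simp
      then show ?thesis
        using b[OF i] S N unfolding M_def by linarith
    qed
    have ex: "\<exists>v' v''. prim (d 0) v' \<and> prim v' v'' \<and> L2 v'' \<and> (AE x in U. d 1 x = v' x) \<and>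
        (\<forall>x\<in>{0..1}. \<bar>v' x\<bar> \<le> M) \<and> sqnorm v'' \<le> M\<^sup>2"
    proof (cases "n = 1")
      case False
      with n have n2: "1 < n" "2 \<le> n" by auto
      have "prim (d 0) (d 1)" "prim (d 1) (d 2)"
        using pd[of 0] pd[of 1] n2 by (auto simp: eval_nat_numeral)
      moreover have "sqnorm (d 2) \<le> M\<^sup>2"
        using dS[OF n2(2)] SM M2 by simp
      ultimately show ?thesis
        using Ld[OF n2(2)] sup[OF n2(1)] by (intro exI[of _ "d 1"] exI[of _ "d 2"]) simp
    next
      case True
      \<comment> \<open>For \<open>n = 1\<close> the equation says that \<open>d 1\<close> has the
        weak derivative \<open>d 0 - y\<close>, so \<open>q\<close> becomes the second derivative of
        the velocity.\<close>
      define q where "q x = d 0 x - y x" for x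
      have q: "L2 q"
        unfolding q_def by (rule L2_diff[OF Ld y(1)]) simp
      have qS: "sqnorm q \<le> 2 * S + 2 * N"
      proof -
        have "sqnorm q \<le> (\<integral>x. 2 * (d 0 x)\<^sup>2 + 2 * (y x)\<^sup>2 \<partial>U)"
        proof (rule integral_mono)
          fix x assume "x \<in> space U"
          show "(q x)\<^sup>2 \<le> 2 * (d 0 x)\<^sup>2 + 2 * (y x)\<^sup>2"
            using zero_le_power2[of "d 0 x + y x"] unfolding q_def power2_sum power2_diff by linarith
        next
          show "integrable U (\<lambda>x. (q x)\<^sup>2)"
            by (rule L2_square[OF q])
          show "integrable U (\<lambda>x. 2 * (d 0 x)\<^sup>2 + 2 * (y x)\<^sup>2)"
            using y Ld[of 0] by (simp add: L2_square)
        qed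
        also have "\<dots> = 2 * sqnorm (d 0) + 2 * sqnorm y"
          using y Ld[of 0] by (simp add: L2_square)
        finally show ?thesis
          using dS[of 0] y(2) by simp
      qed
      have test: "(\<integral>x. q x * g x + d 1 x * g' x \<partial>U) = 0" if g: "prim g g'" "L2 g'" "g 0 = 0" "g 1 = 0" for g g'
      proof -
        define G where "G i = (if i = 0 then g else g')" for i :: nat
        have Lg: "L2 g"
          by (rule continuous_L2[OF prim_continuous[OF g(1)]])
        have "Hn0_jet n G"
          unfolding Hn0_jet_def Hn_jet_iff using True g Lg by (auto simp: G_def)
        then have "(\<integral>x. (\<Sum>i\<le>n. d i x * G i x) \<partial>U) = (\<integral>x. y x * G 0 x \<partial>U)"
          using e unfolding elliptic_solution_def by blast
        then have "(\<integral>x. d 0 x * g x + d 1 x * g' x \<partial>U) = (\<integral>x. y x * g x \<partial>U)"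
          using True by (simp add: G_def)
        moreover have "(\<integral>x. q x * g x + d 1 x * g' x \<partial>U) = (\<integral>x. (d 0 x * g x + d 1 x * g' x) - y x * g x \<partial>U)"
          by (simp add: q_def algebra_simps)
        moreover have "\<dots> = (\<integral>x. d 0 x * g x + d 1 x * g' x \<partial>U) - (\<integral>x. y x * g x \<partial>U)"
          by (intro Bochner_Integration.integral_diff Bochner_Integration.integrable_add L2_mult_integrable y Lg Ld g(2)) (use True in auto)
        ultimately show ?thesis by simp
      qed
      have L1: "L2 (d 1)"
        using Ld[of 1] True by simp
      obtain c where c: "AE x in U. d 1 x = c + cumul q x"
        using weak_constancy[OF L1 q test] by blast
      define v' where "v' x = c + cumul q x" for x
      have pv: "prim v' q"
        unfolding v'_def by (rule prim_cumul[OF L2_integrable[OF q]])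
      have Lv: "L2 v'"
        by (rule continuous_L2[OF prim_continuous[OF pv]])
      have d1v: "AE x in U. d 1 x = v' x"
        using c by (simp add: v'_def)
      have p0: "prim (d 0) v'"
        by (rule prim_cong_AE[OF _ d1v L2_measurable[OF Lv]]) (use pd[of 0] True in simp)
      have var: "(v' x - v' 0)\<^sup>2 \<le> 2 * S + 2 * N" if x: "x \<in> {0..1}" for x
        using prim_square_le[OF pv q x] qS by simp
      \<comment> \<open>Only the mean square of \<open>v'\<close> is known, no value at a point.
        Since \<open>v'\<close> varies little, the value at 0 is compared with the values at all
        \<open>x\<close> and the inequality is averaged:
        \<open>2 * S + 2 * (2 * S + 2 * N)\<close>.\<close>
      have "(v' 0)\<^sup>2 \<le> 6 * S + 4 * N"
      proof -
        have "(\<integral>x. (v' 0)\<^sup>2 \<partial>U) \<le> (\<integral>x. 2 * (v' x)\<^sup>2 + 2 * (2 * S + 2 * N) \<partial>U)"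
        proof (rule integral_mono)
          show "(v' 0)\<^sup>2 \<le> 2 * (v' x)\<^sup>2 + 2 * (2 * S + 2 * N)" if x: "x \<in> space U" for x
            using var[of x] x zero_le_power2[of "2 * v' x - v' 0"] by (simp add: power2_eq_square algebra_simps)
        qed (use Lv in \<open>auto simp: L2_square\<close>)
        also have "\<dots> = 2 * sqnorm v' + 2 * (2 * S + 2 * N)"
          using Lv by (simp add: L2_square)
        also have "sqnorm v' = sqnorm (d 1)"
        proof (rule integral_cong_AE)
          show "AE x in U. (v' x)\<^sup>2 = (d 1 x)\<^sup>2"
            using d1v by eventually_elim simp
        qed (use Lv L1 in \<open>auto intro!: borel_measurable_integrable L2_square\<close>)
        also have "\<dots> \<le> S"
          using dS[of 1] True by simp
        finally show ?thesis by simp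
      qed
      then have "(v' x)\<^sup>2 \<le> 16 * S + 12 * N" if x: "x \<in> {0..1}" for x
        using var[OF x] zero_le_power2[of "v' x - 2 * v' 0"] by (simp add: power2_eq_square algebra_simps)
      then have "\<bar>v' x\<bar> \<le> M" if x: "x \<in> {0..1}" for x
        using small[of "v' x"] SM x by fastforce
      moreover have "sqnorm q \<le> M\<^sup>2"
        using qS SM M2 S N by linarith
      ultimately show ?thesis
        using p0 pv q d1v by blast
    qed
    have "sqnorm (d 0) \<le> M" "sqnorm (d 1) \<le> M"
      using dS[of 0] dS[of 1] n SM by simp_all
    moreover have "\<forall>x\<in>{0..1}. \<bar>d 0 x\<bar> \<le> M"
      using sup[of 0] n by simp
    ultimately show "regular_jet M d"
      unfolding regular_jet_def using ex by blast
  qed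
qed

text \<open>Both equations are tested with the difference of the jets, which is admissible because
  the boundary values cancel. The left side becomes a sum of squares, and only the one of order 1 is
  kept.\<close>

lemma elliptic_difference:
  assumes e1: "elliptic_solution n y1 d1" and e2: "elliptic_solution n y2 d2" and y: "L2 y1" "L2 y2"
    and n: "1 \<le> n" and b: "\<And>i. i < n \<Longrightarrow> d1 i 0 = d2 i 0 \<and> d1 i 1 = d2 i 1"
  shows "(\<integral>x. (d1 1 x - d2 1 x)\<^sup>2 \<partial>U) \<le> (\<integral>x. (y1 x - y2 x) * (d1 0 x - d2 0 x) \<partial>U)"
proof -
  define g where "g i x = d1 i x - d2 i x" for i x
  have d: "Hn_jet n d1" "Hn_jet n d2"
    using e1 e2 by (simp_all add: elliptic_solution_def)
  have Ld: "L2 (d1 i)" "L2 (d2 i)" "L2 (g i)" if "i \<le> n" for i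
    using d Hn_jet_diff[OF d] that unfolding Hn_jet_iff g_def by blast+
  have "Hn0_jet n g"
    unfolding Hn0_jet_def g_def using Hn_jet_diff[OF d] b by simp
  then have "(\<integral>x. (\<Sum>i\<le>n. d1 i x * g i x) \<partial>U) = (\<integral>x. y1 x * g 0 x \<partial>U)"
    "(\<integral>x. (\<Sum>i\<le>n. d2 i x * g i x) \<partial>U) = (\<integral>x. y2 x * g 0 x \<partial>U)"
    using e1 e2 unfolding elliptic_solution_def by blast+
  moreover have "integrable U (\<lambda>x. \<Sum>i\<le>n. d1 i x * g i x)" "integrable U (\<lambda>x. \<Sum>i\<le>n. d2 i x * g i x)"
    "integrable U (\<lambda>x. y1 x * g 0 x)" "integrable U (\<lambda>x. y2 x * g 0 x)"
    by (auto intro!: Bochner_Integration.integrable_sum L2_mult_integrable Ld y)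
  ultimately have "(\<integral>x. (\<Sum>i\<le>n. d1 i x * g i x) - (\<Sum>i\<le>n. d2 i x * g i x) \<partial>U) = (\<integral>x. y1 x * g 0 x - y2 x * g 0 x \<partial>U)"
    by simp
  moreover have "(\<Sum>i\<le>n. d1 i x * g i x) - (\<Sum>i\<le>n. d2 i x * g i x) = (\<Sum>i\<le>n. (g i x)\<^sup>2)" for x
    by (simp add: g_def sum_subtractf[symmetric] power2_eq_square left_diff_distrib)
  ultimately have "(\<integral>x. (\<Sum>i\<le>n. (g i x)\<^sup>2) \<partial>U) = (\<integral>x. (y1 x - y2 x) * g 0 x \<partial>U)"
    by (simp add: left_diff_distrib)
  moreover have "(\<integral>x. (\<Sum>i\<le>n. (g i x)\<^sup>2) \<partial>U) = (\<Sum>i\<le>n. sqnorm (g i))"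
    by (rule Bochner_Integration.integral_sum) (simp add: L2_square Ld)
  moreover have "sqnorm (g 1) \<le> (\<Sum>i\<le>n. sqnorm (g i))"
    by (rule member_le_sum) (use n in auto)
  ultimately show ?thesis
    by (simp add: g_def)
qed

section \<open>Continuity in time and induction over the time interval\<close>

lemma integral_Cauchy_Schwarz:
  assumes f: "L2 f" and g: "L2 g"
  shows "\<bar>\<integral>x. f x * g x \<partial>U\<bar> \<le> sqrt (sqnorm f) * sqrt (sqnorm g)"
proof -
  define A B C where "A = sqnorm f" and "B = sqnorm g" and "C = (\<integral>x. f x * g x \<partial>U)"
  have i: "integrable U (\<lambda>x. (f x)\<^sup>2)" "integrable U (\<lambda>x. (g x)\<^sup>2)" "integrable U (\<lambda>x. f x * g x)"
    using f g L2_square L2_mult_integrable by auto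
  have nn: "0 \<le> A" "0 \<le> B"
    by (simp_all add: A_def B_def)
  have "C\<^sup>2 \<le> A * B"
  proof (cases "B = 0")
    case True
    then have "AE x in U. (g x)\<^sup>2 = 0"
      using integral_nonneg_eq_0_iff_AE[OF i(2)] by (simp add: B_def)
    then have "AE x in U. f x * g x = 0"
      by eventually_elim simp
    then have "C = 0"
      unfolding C_def by (rule integral_eq_zero_AE)
    with nn show ?thesis by simp
  next
    case False
    with nn have B: "0 < B" by simp
    define t where "t = C / B"
    have "0 \<le> (\<integral>x. (f x - t * g x)\<^sup>2 \<partial>U)"
      by simp
    also have "\<dots> = (\<integral>x. (f x)\<^sup>2 - 2 * t * (f x * g x) + t\<^sup>2 * (g x)\<^sup>2 \<partial>U)"
      by (simp add: power2_eq_square algebra_simps)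
    also have "\<dots> = A - 2 * t * C + t\<^sup>2 * B"
      using i by (simp add: A_def B_def C_def)
    also have "\<dots> = A - C\<^sup>2 / B"
      using B by (simp add: t_def power2_eq_square field_simps)
    finally show ?thesis
      using B by (simp add: field_simps)
  qed
  then have "sqrt (C\<^sup>2) \<le> sqrt (A * B)"
    by (rule real_sqrt_le_mono)
  then show ?thesis
    by (simp add: A_def B_def C_def real_sqrt_mult)
qed

lemma integral_square_add_le:
  assumes "L2 f" "L2 g"
  shows "(\<integral>x. (f x + g x)\<^sup>2 \<partial>U) \<le> 2 * sqnorm f + 2 * sqnorm g"
proof -
  have "(\<integral>x. (f x + g x)\<^sup>2 \<partial>U) \<le> (\<integral>x. 2 * (f x)\<^sup>2 + 2 * (g x)\<^sup>2 \<partial>U)"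
  proof (rule integral_mono)
    fix x
    show "(f x + g x)\<^sup>2 \<le> 2 * (f x)\<^sup>2 + 2 * (g x)\<^sup>2"
      using zero_le_power2[of "f x - g x"] unfolding power2_sum power2_diff by linarith
  next
    show "integrable U (\<lambda>x. (f x + g x)\<^sup>2)"
      by (rule L2_square[OF L2_add[OF assms]])
    show "integrable U (\<lambda>x. 2 * (f x)\<^sup>2 + 2 * (g x)\<^sup>2)"
      using assms by (simp add: L2_square)
  qed
  also have "\<dots> = 2 * sqnorm f + 2 * sqnorm g"
    using assms by (simp add: L2_square)
  finally show ?thesis .
qed

lemma integral_square_diff_le:
  assumes "L2 f" "L2 g"
  shows "(\<integral>x. (f x - g x)\<^sup>2 \<partial>U) \<le> 2 * sqnorm f + 2 * sqnorm g"
  using integral_square_add_le[OF assms(1) L2_uminus[OF assms(2)]] by simp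

definition L2_continuous :: "real set \<Rightarrow> (real \<Rightarrow> real \<Rightarrow> real) \<Rightarrow> bool" where
  "L2_continuous I Y \<longleftrightarrow> (\<forall>t\<in>I. L2 (Y t) \<and> ((\<lambda>s. \<integral>x. (Y s x - Y t x)\<^sup>2 \<partial>U) \<longlongrightarrow> 0) (at t within I))"

lemma C0_L2_iff: "C0_L2 T y \<longleftrightarrow> L2_continuous {0..T} y"
  by (simp add: C0_L2_def L2_continuous_def L2_dist_sq_def integral_U)

lemma L2_continuous_diff:
  assumes "L2_continuous I y" "L2_continuous I z"
  shows "L2_continuous I (\<lambda>t x. y t x - z t x)"
  unfolding L2_continuous_def
proof (intro ballI conjI)
  fix t assume t: "t \<in> I"
  note L = assms[unfolded L2_continuous_def, rule_format]
  show "L2 (\<lambda>x. y t x - z t x)"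
    using L t by (auto intro: L2_diff)
  show "((\<lambda>s. \<integral>x. (y s x - z s x - (y t x - z t x))\<^sup>2 \<partial>U) \<longlongrightarrow> 0) (at t within I)"
  proof (rule tendsto_sandwich[where f = "\<lambda>_. 0"])
    show "((\<lambda>s. 2 * (\<integral>x. (y s x - y t x)\<^sup>2 \<partial>U) + 2 * (\<integral>x. (z s x - z t x)\<^sup>2 \<partial>U)) \<longlongrightarrow> 0) (at t within I)"
      using tendsto_add[OF tendsto_mult[OF tendsto_const conjunct2[OF L(1)[OF t]], of 2]
          tendsto_mult[OF tendsto_const conjunct2[OF L(2)[OF t]], of 2]] by simp
    have "(\<integral>x. (y s x - z s x - (y t x - z t x))\<^sup>2 \<partial>U) \<le>
        2 * (\<integral>x. (y s x - y t x)\<^sup>2 \<partial>U) + 2 * (\<integral>x. (z s x - z t x)\<^sup>2 \<partial>U)" if s: "s \<in> I" for s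
    proof -
      have "(\<integral>x. (y s x - z s x - (y t x - z t x))\<^sup>2 \<partial>U) = (\<integral>x. ((y s x - y t x) - (z s x - z t x))\<^sup>2 \<partial>U)"
        by (simp add: algebra_simps)
      also have "\<dots> \<le> 2 * (\<integral>x. (y s x - y t x)\<^sup>2 \<partial>U) + 2 * (\<integral>x. (z s x - z t x)\<^sup>2 \<partial>U)"
        by (intro integral_square_diff_le L2_diff conjunct1[OF L(1)] conjunct1[OF L(2)] s t)
      finally show ?thesis .
    qed
    then show "\<forall>\<^sub>F s in at t within I. (\<integral>x. (y s x - z s x - (y t x - z t x))\<^sup>2 \<partial>U) \<le>
        2 * (\<integral>x. (y s x - y t x)\<^sup>2 \<partial>U) + 2 * (\<integral>x. (z s x - z t x)\<^sup>2 \<partial>U)"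
      unfolding eventually_at_filter by (simp add: always_eventually)
  qed simp_all
qed

lemma L2_continuous_imp_continuous:
  assumes "L2_continuous I Y"
  shows "continuous_on I (\<lambda>t. sqnorm (Y t))"
  unfolding continuous_on_def
proof
  fix t assume t: "t \<in> I"
  note L = assms[unfolded L2_continuous_def, rule_format]
  define d where "d s = (\<integral>x. (Y s x - Y t x)\<^sup>2 \<partial>U)" for s
  define n where "n = sqnorm (Y t)"
  have d: "(d \<longlongrightarrow> 0) (at t within I)"
    unfolding d_def using L[OF t] by blast
  have "((\<lambda>s. sqnorm (Y s) - n) \<longlongrightarrow> 0) (at t within I)"
  proof (rule tendsto_0_le[where K=1])
    show "((\<lambda>s. d s + 2 * (sqrt (d s) * sqrt n)) \<longlongrightarrow> 0) (at t within I)"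
      using tendsto_add[OF d tendsto_mult[OF tendsto_const tendsto_mult[OF tendsto_real_sqrt[OF d] tendsto_const]], of 2 "sqrt n"]
      by simp
    have "\<bar>sqnorm (Y s) - n\<bar> \<le> d s + 2 * (sqrt (d s) * sqrt n)" if s: "s \<in> I" for s
    proof -
      have L': "L2 (Y s)" "L2 (Y t)" "L2 (\<lambda>x. Y s x - Y t x)"
        using L[OF s] L[OF t] by (auto intro: L2_diff)
      have i: "integrable U (\<lambda>x. (Y s x - Y t x)\<^sup>2)" "integrable U (\<lambda>x. (Y t x)\<^sup>2)"
          "integrable U (\<lambda>x. (Y s x - Y t x) * Y t x)"
        by (intro L2_square L2_mult_integrable L')+
      have "sqnorm (Y s) = (\<integral>x. (Y s x - Y t x)\<^sup>2 + 2 * ((Y s x - Y t x) * Y t x) + (Y t x)\<^sup>2 \<partial>U)"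
        by (simp add: power2_eq_square algebra_simps)
      also have "\<dots> = d s + 2 * (\<integral>x. (Y s x - Y t x) * Y t x \<partial>U) + n"
        unfolding d_def n_def using i
        by (simp only: Bochner_Integration.integral_add Bochner_Integration.integrable_add
            integral_mult_right_zero integrable_mult_right)
      finally have "sqnorm (Y s) - n = d s + 2 * (\<integral>x. (Y s x - Y t x) * Y t x \<partial>U)"
        by simp
      moreover have "\<bar>\<integral>x. (Y s x - Y t x) * Y t x \<partial>U\<bar> \<le> sqrt (d s) * sqrt n"
        unfolding d_def n_def by (rule integral_Cauchy_Schwarz[OF L'(3,2)])
      moreover have "0 \<le> d s"
        by (simp add: d_def)
      ultimately show ?thesis
        by linarith
    qed
    then have "norm (sqnorm (Y s) - n) \<le> norm (d s + 2 * (sqrt (d s) * sqrt n)) * 1" if "s \<in> I" for s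
      using that by fastforce
    then show "\<forall>\<^sub>F s in at t within I. norm (sqnorm (Y s) - n) \<le> norm (d s + 2 * (sqrt (d s) * sqrt n)) * 1"
      unfolding eventually_at_filter by (simp add: always_eventually)
  qed
  then show "((\<lambda>s. sqnorm (Y s)) \<longlongrightarrow> sqnorm (Y t)) (at t within I)"
    unfolding n_def by (rule LIM_zero_cancel)
qed

lemma L2_continuous_bounded:
  assumes "L2_continuous {0..T::real} Y"
  obtains N where "0 \<le> N" "\<And>t. t \<in> {0..T} \<Longrightarrow> sqnorm (Y t) \<le> N"
proof -
  have "bounded ((\<lambda>t. sqnorm (Y t)) ` {0..T})"
    by (intro compact_imp_bounded compact_continuous_image L2_continuous_imp_continuous assms compact_Icc)
  then obtain N where N: "0 < N" "\<forall>z\<in>(\<lambda>t. sqnorm (Y t)) ` {0..T}. norm z \<le> N"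
    unfolding bounded_pos by blast
  show thesis
  proof
    show "0 \<le> N" using N(1) by simp
    show "sqnorm (Y t) \<le> N" if t: "t \<in> {0..T}" for t
      using bspec[OF N(2) imageI[OF t]] by simp
  qed
qed

text \<open>By \<open>energy_diff_eq\<close> and Cauchy-Schwarz the increment is at most the
  mean-square distance of the sources times the norm of \<open>W s + W t\<close>. Each square is at
  most \<open>2 * energy \<le> 4 * N\<close>, so the square of the sum is at most
  \<open>16 * N\<close>.\<close>

lemma energy_continuous:
  assumes Y: "L2_continuous I Y" and W: "\<And>t. t \<in> I \<Longrightarrow> potential l r (Y t) (W t) (W' t)"
    and N: "\<And>t. t \<in> I \<Longrightarrow> sqnorm (Y t) \<le> N"
  shows "continuous_on I (\<lambda>t. energy (W t) (W' t))"
  unfolding continuous_on_def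
proof
  fix t assume t: "t \<in> I"
  note L = Y[unfolded L2_continuous_def, rule_format]
  define d where "d s = (\<integral>x. (Y s x - Y t x)\<^sup>2 \<partial>U)" for s
  have d: "(d \<longlongrightarrow> 0) (at t within I)"
    unfolding d_def using L[OF t] by blast
  have "((\<lambda>s. energy (W s) (W' s) - energy (W t) (W' t)) \<longlongrightarrow> 0) (at t within I)"
  proof (rule tendsto_0_le[where K=1])
    show "((\<lambda>s. sqrt (d s) * sqrt (16 * N)) \<longlongrightarrow> 0) (at t within I)"
      using tendsto_mult[OF tendsto_real_sqrt[OF d] tendsto_const[of "sqrt (16 * N)"]] by simp
    have "\<bar>energy (W s) (W' s) - energy (W t) (W' t)\<bar> \<le> sqrt (d s) * sqrt (16 * N)" if s: "s \<in> I" for s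
    proof -
      note p = potential_add[OF W[OF s] W[OF t]]
      note c = continuous_L2[OF potential_cont[OF p]]
      have "(W s x + W t x)\<^sup>2 \<le> 16 * N" if x: "x \<in> {0<..<1}" for x
      proof -
        have x': "x \<in> {0..1}" using x by simp
        have "(W s x)\<^sup>2 \<le> 4 * N" "(W t x)\<^sup>2 \<le> 4 * N"
          using potential_square_le[OF W[OF s] x'] energy_le[OF W[OF s]] N[OF s]
            potential_square_le[OF W[OF t] x'] energy_le[OF W[OF t]] N[OF t] by simp_all
        then show ?thesis
          using zero_le_power2[of "W s x - W t x"] unfolding power2_sum power2_diff by linarith
      qed
      from integral_square_mult_le[OF L2_const[of 1] L2_measurable[OF c] this]
      have "(\<integral>x. (W s x + W t x)\<^sup>2 \<partial>U) \<le> 16 * N"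
        by simp
      then have "sqrt (d s) * sqrt (\<integral>x. (W s x + W t x)\<^sup>2 \<partial>U) \<le> sqrt (d s) * sqrt (16 * N)"
        by (intro mult_left_mono real_sqrt_le_mono) (simp_all add: d_def)
      moreover have "\<bar>energy (W s) (W' s) - energy (W t) (W' t)\<bar> \<le> sqrt (d s) * sqrt (\<integral>x. (W s x + W t x)\<^sup>2 \<partial>U)"
        unfolding energy_diff_eq[OF W[OF s] W[OF t]] d_def
        by (rule integral_Cauchy_Schwarz[OF L2_diff[OF conjunct1[OF L[OF s]] conjunct1[OF L[OF t]]] c])
      ultimately show ?thesis by linarith
    qed
    then have "norm (energy (W s) (W' s) - energy (W t) (W' t)) \<le> norm (sqrt (d s) * sqrt (16 * N)) * 1" if "s \<in> I" for s
      using that by fastforce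
    then show "\<forall>\<^sub>F s in at t within I. norm (energy (W s) (W' s) - energy (W t) (W' t)) \<le> norm (sqrt (d s) * sqrt (16 * N)) * 1"
      unfolding eventually_at_filter by (simp add: always_eventually)
  qed
  then show "((\<lambda>s. energy (W s) (W' s)) \<longlongrightarrow> energy (W t) (W' t)) (at t within I)"
    by (rule LIM_zero_cancel)
qed

section \<open>Propagation along a time interval\<close>

lemma real_induction [consumes 1, case_names start right limit]:
  fixes a b :: real
  assumes t: "t \<in> {a..b}" and start: "P a"
    and right: "\<And>s. a \<le> s \<Longrightarrow> s < b \<Longrightarrow> (\<And>u. a \<le> u \<Longrightarrow> u \<le> s \<Longrightarrow> P u) \<Longrightarrow>
      \<exists>\<delta>>0. \<forall>u. s < u \<and> u < s + \<delta> \<and> u \<le> b \<longrightarrow> P u"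
    and limit: "\<And>s. a < s \<Longrightarrow> s \<le> b \<Longrightarrow> (\<And>u. a \<le> u \<Longrightarrow> u < s \<Longrightarrow> P u) \<Longrightarrow> P s"
  shows "P t"
proof -
  have ab: "a \<le> b" using t by simp
  \<comment> \<open>The points up to which \<open>P\<close> holds without gap. The case
    \<open>limit\<close> puts the supremum into this set, and \<open>right\<close> forbids that it
    lies below \<open>b\<close>.\<close>
  define S where "S = {s \<in> {a..b}. \<forall>u\<in>{a..s}. P u}"
  define m where "m = Sup S"
  have aS: "a \<in> S"
    using ab start by (simp add: S_def)
  have bdd: "bdd_above S"
    by (rule bdd_aboveI[of _ b]) (auto simp: S_def)
  have "a \<le> m"
    unfolding m_def by (rule cSup_upper[OF aS bdd])
  moreover have "m \<le> b"
    unfolding m_def using aS by (intro cSup_least) (auto simp: S_def)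
  ultimately have m: "a \<le> m" "m \<le> b" .
  have below: "P u" if u: "a \<le> u" "u < m" for u
  proof -
    obtain s where "s \<in> S" "u < s"
      using less_cSupD[of S u] u(2) aS unfolding m_def by blast
    then show ?thesis
      using u(1) by (simp add: S_def)
  qed
  have Pm: "P m"
  proof (cases "a = m")
    case True
    then show ?thesis using start by simp
  next
    case False
    with m have "a < m" by simp
    then show ?thesis
      by (rule limit[OF _ m(2) below])
  qed
  then have upto: "P u" if "a \<le> u" "u \<le> m" for u
    using below[OF that(1)] Pm that(2) by (cases "u = m") auto
  have "m = b"
  proof (rule ccontr)
    assume "m \<noteq> b"
    with m have mb: "m < b" by simp
    obtain \<delta> where \<delta>: "0 < \<delta>" "\<And>u. m < u \<Longrightarrow> u < m + \<delta> \<Longrightarrow> u \<le> b \<Longrightarrow> P u"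
      using right[OF m(1) mb upto] by blast
    define s where "s = min b (m + \<delta> / 2)"
    have s: "m < s" "s < m + \<delta>" "s \<le> b"
      using mb \<delta>(1) by (auto simp: s_def)
    have "P u" if "u \<in> {a..s}" for u
    proof (cases "u \<le> m")
      case True
      then show ?thesis using upto[of u] that by simp
    next
      case False
      then show ?thesis using \<delta>(2)[of u] that s by simp
    qed
    then have "s \<in> S"
      using s m by (simp add: S_def)
    then show False
      using cSup_upper[OF _ bdd, of s] s(1) by (simp add: m_def)
  qed
  then show ?thesis
    using upto t by simp
qed

text \<open>A Gronwall lemma for upper Dini derivatives, with the barrier \<open>\<epsilon> exp ((C + 1) (t - a))\<close>.\<close>

lemma Dini_Gronwall:
  fixes f :: "real \<Rightarrow> real"
  assumes cont: "continuous_on {a..b} f" and a: "f a = 0" and C: "0 \<le> C"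
    and step: "\<And>s \<epsilon>. a \<le> s \<Longrightarrow> s < b \<Longrightarrow> 0 < \<epsilon> \<Longrightarrow>
      \<exists>\<delta>>0. \<forall>t. s < t \<and> t < s + \<delta> \<and> t \<le> b \<longrightarrow> f t - f s \<le> (C * f s + \<epsilon>) * (t - s)"
    and t: "t \<in> {a..b}"
  shows "f t \<le> 0"
proof -
  define h where "h \<epsilon> t = \<epsilon> * exp ((C + 1) * (t - a))" for \<epsilon> t
  have "f t \<le> h \<epsilon> t" if e: "0 < \<epsilon>" for \<epsilon>
    using t
  proof (induction rule: real_induction)
    case start
    show ?case using a e by (simp add: h_def)
  next
    case (right s)
    obtain \<delta> where \<delta>: "0 < \<delta>" "\<And>t. s < t \<Longrightarrow> t < s + \<delta> \<Longrightarrow> t \<le> b \<Longrightarrow> f t - f s \<le> (C * f s + \<epsilon>) * (t - s)"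
      using step[OF right(1,2) e] by blast
    have fs: "f s \<le> h \<epsilon> s"
      using right(3)[of s] right(1) by simp
    \<comment> \<open>For \<open>s \<ge> a\<close> the exponential is at least 1, so the additive
      error \<open>\<epsilon>\<close> of \<open>step\<close> is absorbed by the extra 1 in the rate
      \<open>C + 1\<close>.\<close>
    have eh: "\<epsilon> \<le> h \<epsilon> s"
      using e right(1) C by (simp add: h_def)
    have "f u \<le> h \<epsilon> u" if u: "s < u" "u < s + \<delta>" "u \<le> b" for u
    proof -
      have "C * f s \<le> C * h \<epsilon> s"
        using fs C by (rule mult_left_mono)
      then have "(C * f s + \<epsilon>) * (u - s) \<le> ((C + 1) * h \<epsilon> s) * (u - s)"
        using eh u(1) by (intro mult_right_mono) (auto simp: distrib_right)
      then have "f u \<le> h \<epsilon> s * (1 + (C + 1) * (u - s))"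
        using \<delta>(2)[OF u] fs by (simp add: algebra_simps)
      also have "\<dots> \<le> h \<epsilon> s * exp ((C + 1) * (u - s))"
        using exp_ge_add_one_self[of "(C + 1) * (u - s)"] eh e by (intro mult_left_mono) auto
      also have "\<dots> = h \<epsilon> u"
        by (simp add: h_def exp_add[symmetric] algebra_simps)
      finally show ?thesis .
    qed
    then show ?case
      using \<delta>(1) by blast
  next
    case (limit s)
    have ne: "at s within {a..<s} \<noteq> bot"
      using limit(1) by (simp add: trivial_limit_within islimpt_Ico)
    have "(f \<longlongrightarrow> f s) (at s within {a..<s})"
    proof (rule tendsto_within_subset)
      show "(f \<longlongrightarrow> f s) (at s within {a..b})"
        using cont limit(1,2) unfolding continuous_on_def by simp
    qed (use limit(2) in auto)
    moreover have "(h \<epsilon> \<longlongrightarrow> h \<epsilon> s) (at s within {a..<s})"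
      unfolding h_def by (intro tendsto_intros)
    moreover have "\<forall>\<^sub>F u in at s within {a..<s}. f u \<le> h \<epsilon> u"
      unfolding eventually_at_filter using limit(3) by (simp add: always_eventually)
    ultimately show ?case
      by (intro tendsto_le[OF ne])
  qed
  then have *: "f t \<le> h \<epsilon> t" if "0 < \<epsilon>" for \<epsilon>
    using that by blast
  \<comment> \<open>At the fixed time \<open>t\<close> the barrier takes any prescribed positive
    value once its parameter is divided by the exponential.\<close>
  have "f t \<le> 0 + \<epsilon>" if "0 < \<epsilon>" for \<epsilon>
    using *[of "\<epsilon> / exp ((C + 1) * (t - a))"] that by (simp add: h_def)
  then show ?thesis
    by (rule field_le_epsilon)
qed

lemma continuous_nonzero_sign:
  fixes f :: "real \<Rightarrow> real"
  assumes "continuous_on {a<..<b} f" "\<And>t. t \<in> {a<..<b} \<Longrightarrow> f t \<noteq> 0"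
  shows "(\<forall>t\<in>{a<..<b}. 0 < f t) \<or> (\<forall>t\<in>{a<..<b}. f t < 0)"
proof (rule ccontr)
  assume "\<not> ?thesis"
  then obtain s t where st: "s \<in> {a<..<b}" "t \<in> {a<..<b}" "f s \<le> 0" "0 \<le> f t"
    by (meson linorder_not_le less_imp_le)
  have "connected (f ` {a<..<b})"
    by (rule connected_continuous_image[OF assms(1)]) simp
  then have "0 \<in> f ` {a<..<b}"
    using st unfolding connected_iff_interval by blast
  then show False
    using assms(2) by auto
qed

section \<open>Time-independent test functions\<close>

lemma L2_on_continuous_compact:
  fixes f :: "'a::euclidean_space \<Rightarrow> real"
  assumes "continuous_on S f" "compact S"
  shows "L2_on S f"
  unfolding L2_on_def set_integrable_def set_borel_measurable_def
proof
  show "(\<lambda>x. indicator S x *\<^sub>R f x) \<in> borel_measurable lborel"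
    using borel_measurable_integrable[OF borel_integrable_compact[OF assms(2,1)]] .
  show "integrable lborel (\<lambda>x. indicator S x *\<^sub>R (f x)\<^sup>2)"
    by (rule borel_integrable_compact[OF assms(2) continuous_on_power[OF assms(1)]])
qed

lemma L2_dist_sq_self [simp]: "L2_dist_sq S f f = 0"
  by (simp add: L2_dist_sq_def set_lebesgue_integral_def)

lemma C1_plane_DERIV:
  assumes "C1_plane \<psi> \<psi>t \<psi>x"
  shows "((\<lambda>s. \<psi> s x) has_real_derivative \<psi>t t x) (at t)"
    and "(\<psi> t has_real_derivative \<psi>x t x) (at x)"
proof -
  have d: "((\<lambda>(s, z). \<psi> s z) has_derivative (\<lambda>(a, b). a * \<psi>t t x + b * \<psi>x t x)) (at (t, x))"
    using assms unfolding C1_plane_def by blast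
  have "((\<lambda>s. (s, x)) has_derivative (\<lambda>s. (s, 0))) (at t)"
    by (intro has_derivative_Pair has_derivative_ident has_derivative_const)
  from has_derivative_compose[OF this d]
  show "((\<lambda>s. \<psi> s x) has_real_derivative \<psi>t t x) (at t)"
    by (simp add: has_field_derivative_def mult_commute_abs)
  have "((\<lambda>z. (t, z)) has_derivative (\<lambda>z. (0, z))) (at x)"
    by (intro has_derivative_Pair has_derivative_ident has_derivative_const)
  from has_derivative_compose[OF this d]
  show "(\<psi> t has_real_derivative \<psi>x t x) (at x)"
    by (simp add: has_field_derivative_def mult_commute_abs)
qed

lemma C1_plane_isCont:
  assumes "C1_plane \<psi> \<psi>t \<psi>x"
  shows "continuous_on UNIV (\<lambda>(t, x). \<psi> t x)"
  unfolding continuous_on_eq_continuous_at[OF open_UNIV]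
proof
  fix p :: "real \<times> real"
  obtain t x where p: "p = (t, x)" by (cases p)
  have "((\<lambda>(s, z). \<psi> s z) has_derivative (\<lambda>(a, b). a * \<psi>t t x + b * \<psi>x t x)) (at (t, x))"
    using assms unfolding C1_plane_def by blast
  then show "isCont (\<lambda>(t, x). \<psi> t x) p"
    unfolding p by (rule has_derivative_continuous)
qed

lemma continuous_on_swap:
  "continuous_on UNIV (\<lambda>(t, x). f t x) \<Longrightarrow> continuous_on UNIV (\<lambda>(x, t). f t x)"
  using continuous_on_compose2[of UNIV "\<lambda>(t, x). f t x" UNIV "\<lambda>(x, t). (t, x)"]
  by (simp add: case_prod_unfold continuous_on_Pair continuous_on_fst continuous_on_snd continuous_on_id)

lemma continuous_on_section:
  assumes "continuous_on UNIV (\<lambda>(t, x). f t x)"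
  shows "isCont (\<lambda>s. f s x) t" and "isCont (f t) x"
proof -
  have c: "isCont (\<lambda>p. f (fst p) (snd p)) (t, x)"
    using assms by (simp add: continuous_on_eq_continuous_at case_prod_unfold)
  have "isCont (\<lambda>s. (s, x)) t" "isCont (\<lambda>z. (t, z)) x"
    by (intro continuous_intros)+
  from isCont_o2[OF this(1), of "\<lambda>p. f (fst p) (snd p)"] isCont_o2[OF this(2), of "\<lambda>p. f (fst p) (snd p)"] c
  show "isCont (\<lambda>s. f s x) t" "isCont (f t) x"
    by simp_all
qed

lemma rectangle_integral_zero:
  fixes f :: "real \<Rightarrow> real \<Rightarrow> real"
  assumes c: "continuous_on UNIV (\<lambda>(t, x). f t x)"
    and zero: "\<And>t. (\<integral>x. f t x * indicator {c..d} x \<partial>lborel) = 0"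
  shows "(LINT (t, x):{a..b}\<times>{c..d}|lborel. f t x) = 0"
proof -
  have "integrable lborel (\<lambda>p. indicator ({a..b} \<times> {c..d}) p *\<^sub>R (case p of (t, x) \<Rightarrow> f t x))"
    by (rule borel_integrable_compact[OF compact_Times[OF compact_Icc compact_Icc] continuous_on_subset[OF c]]) simp
  then have i: "integrable (lborel \<Otimes>\<^sub>M lborel) (\<lambda>(t, x). indicator {a..b} t * (f t x * indicator {c..d} x))"
    by (simp add: lborel_prod case_prod_unfold indicator_times ac_simps)
  have "(LINT (t, x):{a..b}\<times>{c..d}|lborel. f t x)
      = (\<integral>(t, x). indicator {a..b} t * (f t x * indicator {c..d} x) \<partial>(lborel \<Otimes>\<^sub>M lborel))"
    by (simp add: set_lebesgue_integral_def lborel_prod case_prod_unfold indicator_times ac_simps)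
  also have "\<dots> = (\<integral>t. (\<integral>x. indicator {a..b} t * (f t x * indicator {c..d} x) \<partial>lborel) \<partial>lborel)"
    by (rule lborel_pair.integral_fst[OF i, symmetric])
  also have "\<dots> = 0"
    using zero by simp
  finally show ?thesis .
qed

text \<open>A time derivative has to be integrated over \<open>t\<close> first, whereas
  \<open>rectangle_integral_zero\<close> integrates over the second variable first.\<close>

lemma rectangle_integral_swap:
  fixes f :: "real \<Rightarrow> real \<Rightarrow> real"
  assumes c: "continuous_on UNIV (\<lambda>(t, x). f t x)"
  shows "(LINT (t, x):{a..b}\<times>{c..d}|lborel. f t x) = (LINT (x, t):{c..d}\<times>{a..b}|lborel. f t x)"
proof -
  have "(\<lambda>(t, x). indicator ({a..b} \<times> {c..d}) (t, x) * f t x) \<in> borel_measurable (lborel \<Otimes>\<^sub>M lborel)"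
    using borel_measurable_integrable[OF borel_integrable_compact[OF
        compact_Times[OF compact_Icc compact_Icc] continuous_on_subset[OF c subset_UNIV]]]
    by (simp add: lborel_prod case_prod_unfold)
  from lborel_pair.integral_product_swap[OF this] show ?thesis
    by (simp add: set_lebesgue_integral_def lborel_prod case_prod_unfold indicator_times ac_simps)
qed

context
  fixes g g' :: "real \<Rightarrow> real"
  assumes g: "\<And>x. (g has_real_derivative g' x) (at x)" and g': "continuous_on UNIV g'"
begin

lemma C1_cont: "continuous_on A g"
  by (rule continuous_at_imp_continuous_on) (use DERIV_isCont[OF g] in blast)

lemma time_independent_C1_plane: "C1_plane (\<lambda>t. g) (\<lambda>t x. 0) (\<lambda>t. g')"
  unfolding C1_plane_def
proof (intro conjI allI)
  fix t x :: real
  have "((\<lambda>p. g (snd p)) has_derivative (\<lambda>p. g' x * snd p)) (at (t, x))"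
    using has_derivative_compose[OF has_derivative_snd[OF has_derivative_ident], of g "\<lambda>h. g' x * h" "(t, x)" UNIV]
      g[of x] by (simp add: has_field_derivative_def)
  then show "((\<lambda>(s, z). g z) has_derivative (\<lambda>(a, b). a * 0 + b * g' x)) (at (t, x))"
    by (simp add: case_prod_unfold mult.commute)
  show "continuous_on UNIV (\<lambda>(t, x). 0 :: real)"
    by (simp add: case_prod_unfold)
  show "continuous_on UNIV (\<lambda>(t :: real, x). g' x)"
    unfolding case_prod_unfold by (rule continuous_on_compose2[OF g' continuous_on_snd[OF continuous_on_id]]) simp
qed

text \<open>Without dependence on time the weak derivatives reduce to one-dimensional calculus on
  lines: the time derivative of \<open>\<psi>\<close> integrates to zero for each \<open>x\<close>,
  and the derivative of \<open>g \<psi>\<close> in space integrates to zero for each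
  \<open>t\<close>.\<close>

lemma time_independent_H1:
  "H1_rect t0 t1 (\<lambda>t. g) (\<lambda>t x. 0) (\<lambda>t. g')"
proof -
  have K: "compact ({t0..t1} \<times> {0..1::real})"
    by (intro compact_Times compact_Icc)
  have cg: "continuous_on UNIV (\<lambda>(t :: real, x). g x)"
    by (rule C1_plane_isCont[OF time_independent_C1_plane])
  have cg': "continuous_on UNIV (\<lambda>(t :: real, x). g' x)"
    using time_independent_C1_plane unfolding C1_plane_def by blast
  have L: "L2_on ({t0..t1} \<times> {0..1}) (\<lambda>(t, x). g x)" "L2_on ({t0..t1} \<times> {0..1}) (\<lambda>(t :: real, x :: real). 0)"
      "L2_on ({t0..t1} \<times> {0..1}) (\<lambda>(t, x). g' x)"
    using L2_on_continuous_compact[OF continuous_on_subset[OF cg subset_UNIV] K]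
      L2_on_continuous_compact[OF continuous_on_const K, of 0]
      L2_on_continuous_compact[OF continuous_on_subset[OF cg' subset_UNIV] K]
    by (simp_all add: case_prod_unfold)
  have "(LINT (t, x):{t0..t1} \<times> {0..1}|lborel. g x * \<psi>t t x) = - (LINT (t, x):{t0..t1} \<times> {0..1}|lborel. 0 * \<psi> t x) \<and>
      (LINT (t, x):{t0..t1} \<times> {0..1}|lborel. g x * \<psi>x t x) = - (LINT (t, x):{t0..t1} \<times> {0..1}|lborel. g' x * \<psi> t x)"
    if \<psi>: "C1_plane \<psi> \<psi>t \<psi>x" and supp: "\<And>t x. (t, x) \<notin> {t0<..<t1} \<times> {0<..<1} \<Longrightarrow> \<psi> t x = 0" for \<psi> \<psi>t \<psi>x :: "real \<Rightarrow> real \<Rightarrow> real"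
  proof (cases "t0 \<le> t1")
    case True
    have c: "continuous_on UNIV (\<lambda>(t, x). \<psi> t x)" "continuous_on UNIV (\<lambda>(t, x). \<psi>t t x)" "continuous_on UNIV (\<lambda>(t, x). \<psi>x t x)"
      using C1_plane_isCont[OF \<psi>] \<psi> unfolding C1_plane_def by simp_all
    have m: "continuous_on UNIV (\<lambda>(t, x). g x * \<psi>t t x)" "continuous_on UNIV (\<lambda>(t, x). g x * \<psi>x t x)"
        "continuous_on UNIV (\<lambda>(t, x). g' x * \<psi> t x)"
      using continuous_on_mult[OF cg c(2)] continuous_on_mult[OF cg c(3)] continuous_on_mult[OF cg' c(1)]
      by (simp_all add: case_prod_unfold)
    have "(LINT (t, x):{t0..t1} \<times> {0..1}|lborel. g x * \<psi>t t x) = (LINT (x, t):{0..1} \<times> {t0..t1}|lborel. g x * \<psi>t t x)"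
      by (rule rectangle_integral_swap[OF m(1)])
    also have "\<dots> = 0"
    proof (rule rectangle_integral_zero[OF continuous_on_swap[OF m(1)]])
      fix x
      have "(\<integral>t. \<psi>t t x * indicator {t0..t1} t \<partial>lborel) = \<psi> t1 x - \<psi> t0 x"
        by (rule integral_FTC_Icc_real[OF True C1_plane_DERIV(1)[OF \<psi>] continuous_on_section(1)[OF c(2)]])
      then show "(\<integral>t. g x * \<psi>t t x * indicator {t0..t1} t \<partial>lborel) = 0"
        using supp[of t0 x] supp[of t1 x] by (simp add: mult.assoc)
    qed
    finally have 1: "(LINT (t, x):{t0..t1} \<times> {0..1}|lborel. g x * \<psi>t t x) = 0" .
    have i: "set_integrable lborel ({t0..t1} \<times> {0..1}) (\<lambda>(t, x). g x * \<psi>x t x)"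
        "set_integrable lborel ({t0..t1} \<times> {0..1}) (\<lambda>(t, x). g' x * \<psi> t x)"
      unfolding set_integrable_def
      by (intro borel_integrable_compact[OF K] continuous_on_subset[OF m(2)] continuous_on_subset[OF m(3)] subset_UNIV)+
    have "(LINT (t, x):{t0..t1} \<times> {0..1}|lborel. g x * \<psi>x t x + g' x * \<psi> t x) = 0"
    proof (rule rectangle_integral_zero)
      show cc: "continuous_on UNIV (\<lambda>(t, x). g x * \<psi>x t x + g' x * \<psi> t x)"
        using continuous_on_add[OF m(2,3)] by (simp add: case_prod_unfold)
      fix t
      have "(\<integral>x. (g x * \<psi>x t x + g' x * \<psi> t x) * indicator {0..1} x \<partial>lborel) = g 1 * \<psi> t 1 - g 0 * \<psi> t 0"
      proof (rule integral_FTC_Icc_real)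
        show "((\<lambda>x. g x * \<psi> t x) has_real_derivative g x * \<psi>x t x + g' x * \<psi> t x) (at x)" for x
          using DERIV_mult[OF g C1_plane_DERIV(2)[OF \<psi>]] by (simp add: algebra_simps)
        show "isCont (\<lambda>x. g x * \<psi>x t x + g' x * \<psi> t x) x" for x
          by (rule continuous_on_section(2)[OF cc])
      qed simp
      then show "(\<integral>x. (g x * \<psi>x t x + g' x * \<psi> t x) * indicator {0..1} x \<partial>lborel) = 0"
        using supp[of t 0] supp[of t 1] by simp
    qed
    then have "(LINT (t, x):{t0..t1} \<times> {0..1}|lborel. g x * \<psi>x t x) + (LINT (t, x):{t0..t1} \<times> {0..1}|lborel. g' x * \<psi> t x) = 0"
      using set_integral_add(2)[OF i] by (simp add: case_prod_unfold)
    then show ?thesis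
      using 1 by (simp add: set_lebesgue_integral_def case_prod_unfold)
  qed (simp add: set_lebesgue_integral_def)
  then show ?thesis
    unfolding H1_rect_def Let_def using L by blast
qed

text \<open>The function is itself of class C1 on the plane, so the constant sequence is an exact
  approximation on the rectangle and on all edges, also when \<open>t0 = t1\<close>.\<close>

lemma time_independent_traces:
  "edge_values_are_traces t0 t1 (\<lambda>t. g) (\<lambda>t x. 0) (\<lambda>t. g')"
proof -
  have "L2_on {t0..t1} (\<lambda>t. g x)" for x
    by (intro L2_on_continuous_compact continuous_on_const compact_Icc)
  moreover have "L2_on {0..1} g"
    by (intro L2_on_continuous_compact C1_cont compact_Icc)
  ultimately show ?thesis
    unfolding edge_values_are_traces_def Let_def
    using time_independent_C1_plane
    by (intro conjI ballI, simp_all)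
      (rule exI[of _ "\<lambda>k t. g"], rule exI[of _ "\<lambda>k t x. 0"], rule exI[of _ "\<lambda>k t. g'"], simp)
qed

end

text \<open>Tonelli's criterion: joint measurability and a bound on the integrals of
  \<open>\<bar>F t\<bar>\<close> that is uniform over a bounded time interval give integrability on
  the rectangle.\<close>

lemma rectangle_Fubini:
  fixes F :: "real \<Rightarrow> real \<Rightarrow> real"
  assumes meas: "set_borel_measurable lborel ({a..b} \<times> {0<..<1}) (\<lambda>(t, x). F t x)"
    and int: "\<And>t. t \<in> {a..b} \<Longrightarrow> integrable U (F t)"
    and bound: "\<And>t. t \<in> {a..b} \<Longrightarrow> (\<integral>x. \<bar>F t x\<bar> \<partial>U) \<le> C"
  shows "set_integrable lborel ({a..b} \<times> {0<..<1}) (\<lambda>(t, x). F t x)"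
    and "set_integrable lborel {a..b} (\<lambda>t. \<integral>x. F t x \<partial>U)"
    and "(LINT (t, x):{a..b} \<times> {0<..<1}|lborel. F t x) = (LINT t:{a..b}|lborel. (\<integral>x. F t x \<partial>U))"
proof -
  define f where "f p = indicator ({a..b} \<times> {0<..<1}) p * F (fst p) (snd p)" for p
  have fm: "f \<in> borel_measurable (lborel \<Otimes>\<^sub>M lborel)"
    using meas by (simp add: set_borel_measurable_def f_def[abs_def] lborel_prod case_prod_unfold)
  have inner: "(\<integral>x. f (t, x) \<partial>lborel) = indicator {a..b} t * (\<integral>x. F t x \<partial>U)" for t
    by (simp add: f_def integral_U set_lebesgue_integral_def indicator_times mult.assoc)
  have inner': "(\<integral>x. norm (f (t, x)) \<partial>lborel) = indicator {a..b} t * (\<integral>x. \<bar>F t x\<bar> \<partial>U)" for t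
    by (simp add: f_def integral_U set_lebesgue_integral_def indicator_times mult.assoc abs_mult)
  have i: "integrable (lborel \<Otimes>\<^sub>M lborel) f"
  proof (rule lborel_pair.Fubini_integrable[OF fm])
    show "integrable lborel (\<lambda>t. \<integral>x. norm (f (t, x)) \<partial>lborel)"
    proof (rule Bochner_Integration.integrable_bound)
      show "integrable lborel (\<lambda>t. indicator {a..b} t * C)"
        using borel_integrable_compact[OF compact_Icc continuous_on_const, of a b C] by simp
      show "(\<lambda>t. \<integral>x. norm (f (t, x)) \<partial>lborel) \<in> borel_measurable lborel"
        using fm by measurable
      have "norm (\<integral>x. norm (f (t, x)) \<partial>lborel) \<le> norm (indicator {a..b} t * C)" for t
      proof (cases "t \<in> {a..b}")
        case True
        have "0 \<le> (\<integral>x. \<bar>F t x\<bar> \<partial>U)"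
          by simp
        then show ?thesis
          unfolding inner' using bound[OF True] True by simp
      next
        case False
        then show ?thesis
          unfolding inner' by simp
      qed
      then show "AE t in lborel. norm (\<integral>x. norm (f (t, x)) \<partial>lborel) \<le> norm (indicator {a..b} t * C)"
        by (intro AE_I2)
    qed
    have "integrable lborel (\<lambda>x. f (t, x))" for t
    proof (cases "t \<in> {a..b}")
      case True
      then show ?thesis
        using int[OF True] by (simp add: f_def integrable_U set_integrable_def indicator_times)
    qed (simp add: f_def indicator_times)
    then show "AE t in lborel. integrable lborel (\<lambda>x. f (t, x))"
      by (intro AE_I2)
  qed
  then show "set_integrable lborel ({a..b} \<times> {0<..<1}) (\<lambda>(t, x). F t x)"
    by (simp add: set_integrable_def f_def[abs_def] lborel_prod case_prod_unfold)
  have "integrable lborel (\<lambda>t. \<integral>x. f (t, x) \<partial>lborel)"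
    by (rule lborel_pair.integrable_fst'[OF i])
  then show "set_integrable lborel {a..b} (\<lambda>t. \<integral>x. F t x \<partial>U)"
    unfolding inner by (simp add: set_integrable_def)
  have "(\<integral>t. (\<integral>x. f (t, x) \<partial>lborel) \<partial>lborel) = integral\<^sup>L (lborel \<Otimes>\<^sub>M lborel) f"
    by (rule lborel_pair.integral_fst'[OF i])
  then show "(LINT (t, x):{a..b} \<times> {0<..<1}|lborel. F t x) = (LINT t:{a..b}|lborel. (\<integral>x. F t x \<partial>U))"
    unfolding inner by (simp add: set_lebesgue_integral_def f_def[abs_def] lborel_prod case_prod_unfold)
qed

section \<open>The difference of two solutions\<close>

text \<open>What is left after subtracting the two equations. \<open>hl\<close> and
  \<open>hr\<close> stand for the differences of the boundary fluxes; they are known to vanish at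
  inflow times only. \<open>evolution\<close> is the weak formulation for test functions of
  \<open>x\<close> alone, with the space-time integral already sliced, and like the original it
  stops short of \<open>T\<close>.\<close>

locale difference_problem =
  fixes T M :: real and Y v v' v'' z D D' :: "real \<Rightarrow> real \<Rightarrow> real" and hl hr :: "real \<Rightarrow> real"
  assumes cont: "L2_continuous {0..T} Y"
    and coeffs: "t \<in> {0..T} \<Longrightarrow> flux_coeffs M (Y t) (v t) (v' t) (v'' t) (z t) (D t) (D' t)"
    and evolution: "\<lbrakk>0 \<le> s; s \<le> t; t < T; \<And>x. (g has_real_derivative g' x) (at x); continuous_on UNIV g'\<rbrakk> \<Longrightarrow>
      set_integrable lborel {s..t} (\<lambda>\<tau>. flux (Y \<tau>) (v \<tau>) (v' \<tau>) (z \<tau>) (D \<tau>) (D' \<tau>) g g') \<and>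
      (LINT \<tau>:{s..t}|lborel. flux (Y \<tau>) (v \<tau>) (v' \<tau>) (z \<tau>) (D \<tau>) (D' \<tau>) g g') =
      (LINT \<tau>:{s..t}|lborel. hr \<tau> * g 1 - hl \<tau> * g 0) + (\<integral>x. (Y t x - Y s x) * g x \<partial>U)"
    and left_inflow: "AE \<tau> in lborel. \<tau> \<in> {0..T} \<longrightarrow> 0 < v \<tau> 0 \<longrightarrow> hl \<tau> = 0"
    and right_inflow: "AE \<tau> in lborel. \<tau> \<in> {0..T} \<longrightarrow> v \<tau> 1 < 0 \<longrightarrow> hr \<tau> = 0"
    and boundary_cont: "continuous_on {0..T} (\<lambda>t. v t 0)" "continuous_on {0..T} (\<lambda>t. v t 1)"
    and finite_zeros: "finite {t \<in> {0..T}. v t 0 = 0 \<or> v t 1 = 0}"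
    and initial: "sqnorm (Y 0) = 0"
    and T_pos: "0 < T"
begin

abbreviation flux_at :: "real \<Rightarrow> (real \<Rightarrow> real) \<Rightarrow> (real \<Rightarrow> real) \<Rightarrow> real" where
  "flux_at \<tau> \<equiv> flux (Y \<tau>) (v \<tau>) (v' \<tau>) (z \<tau>) (D \<tau>) (D' \<tau>)"

lemma Y_L2: "t \<in> {0..T} \<Longrightarrow> L2 (Y t)"
  using cont unfolding L2_continuous_def by blast

lemma M_pos: "0 < M"
  using coeff_M(1)[OF coeffs[of 0]] T_pos by simp

lemma Y_bound: "t \<in> {0..T} \<Longrightarrow> sqnorm (Y t) \<le> 4 * M\<^sup>2"
  by (rule coeff_YM[OF coeffs])

section \<open>The energy on a time interval with fixed inflow and outflow ends\<close>

context
  fixes a b :: real and l r :: bool and W W' :: "real \<Rightarrow> real \<Rightarrow> real"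
  assumes ab: "0 \<le> a" "a < b" "b < T"
    and sign_l: "\<And>\<tau>. \<tau> \<in> {a<..<b} \<Longrightarrow> l \<longleftrightarrow> 0 < v \<tau> 0"
    and sign_r: "\<And>\<tau>. \<tau> \<in> {a<..<b} \<Longrightarrow> r \<longleftrightarrow> v \<tau> 1 < 0"
    and W: "\<And>t. t \<in> {a..b} \<Longrightarrow> potential l r (Y t) (W t) (W' t)"
begin

lemma energy_continuous_on: "continuous_on {a..b} (\<lambda>t. energy (W t) (W' t))"
proof (rule energy_continuous)
  have "((\<lambda>s. \<integral>x. (Y s x - Y t x)\<^sup>2 \<partial>U) \<longlongrightarrow> 0) (at t within {a..b})" if "t \<in> {a..b}" for t
  proof (rule tendsto_within_subset)
    show "((\<lambda>s. \<integral>x. (Y s x - Y t x)\<^sup>2 \<partial>U) \<longlongrightarrow> 0) (at t within {0..T})"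
      using cont that ab unfolding L2_continuous_def by simp
    show "{a..b} \<subseteq> {0..T}"
      using ab by auto
  qed
  then show "L2_continuous {a..b} Y"
    unfolding L2_continuous_def using Y_L2 ab by simp
  show "sqnorm (Y t) \<le> 4 * M\<^sup>2" if "t \<in> {a..b}" for t
    using Y_bound that ab by simp
qed (rule W)

text \<open>The test function is written as \<open>2 * W \<tau>\<close> plus a remainder. The first
  part belongs to the same time as the flux, so \<open>flux_le_energy\<close> applies; the remainder
  is the potential of \<open>Y t + Y s - 2 * Y \<tau>\<close>, small by continuity in time, and is
  left to \<open>flux_le_small\<close>.\<close>

lemma flux_two_times_le:
  assumes \<tau>: "\<tau> \<in> {a<..<b}" and s: "s \<in> {a..b}" and t: "t \<in> {a..b}" and \<eta>: "0 < \<eta>"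
    and close: "(\<integral>x. (Y \<tau> x - Y s x)\<^sup>2 \<partial>U) \<le> \<eta>\<^sup>2 / 20" "(\<integral>x. (Y t x - Y s x)\<^sup>2 \<partial>U) \<le> \<eta>\<^sup>2 / 20"
  shows "flux_at \<tau> (\<lambda>x. W t x + W s x) (\<lambda>x. W' t x + W' s x)
    \<le> 2 * (1 + 3 * M + 2 * M\<^sup>2) * energy (W \<tau>) (W' \<tau>) + (2 + 20 * M\<^sup>2 + 20 * M ^ 4) * \<eta>"
proof -
  have \<tau>': "\<tau> \<in> {a..b}" and \<tau>T: "\<tau> \<in> {0..T}" and L: "L2 (Y \<tau>)" "L2 (Y s)" "L2 (Y t)"
    using \<tau> s t ab Y_L2 by auto
  note c = coeffs[OF \<tau>T]
  note p2 = potential_cmult[OF W[OF \<tau>'], of 2]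
  note q = potential_diff[OF potential_add[OF W[OF t] W[OF s]] p2]
  \<comment> \<open>Regrouped around \<open>Y s\<close>, the two closeness bounds enter with factors
    2 and 8. Together with the factor 2 of \<open>energy_le\<close> they add up to 20, hence the
    \<open>\<eta>\<^sup>2 / 20\<close>.\<close>
  have "(\<integral>x. (Y t x + Y s x - 2 * Y \<tau> x)\<^sup>2 \<partial>U) = (\<integral>x. ((Y t x - Y s x) - 2 * (Y \<tau> x - Y s x))\<^sup>2 \<partial>U)"
    by (simp add: algebra_simps)
  also have "\<dots> \<le> 2 * (\<integral>x. (Y t x - Y s x)\<^sup>2 \<partial>U) + 2 * (\<integral>x. (2 * (Y \<tau> x - Y s x))\<^sup>2 \<partial>U)"
    by (intro integral_square_diff_le L2_cmult L2_diff L)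
  also have "\<dots> = 2 * (\<integral>x. (Y t x - Y s x)\<^sup>2 \<partial>U) + 8 * (\<integral>x. (Y \<tau> x - Y s x)\<^sup>2 \<partial>U)"
    unfolding power_mult_distrib by simp
  also have "\<dots> \<le> \<eta>\<^sup>2 / 2"
    using close by simp
  finally have "energy (\<lambda>x. W t x + W s x - 2 * W \<tau> x) (\<lambda>x. W' t x + W' s x - 2 * W' \<tau> x) \<le> \<eta>\<^sup>2"
    using energy_le[OF q] by simp
  from flux_le_small[OF c q \<eta> this]
  have small: "flux_at \<tau> (\<lambda>x. W t x + W s x - 2 * W \<tau> x)
      (\<lambda>x. W' t x + W' s x - 2 * W' \<tau> x) \<le> (2 + 20 * M\<^sup>2 + 20 * M ^ 4) * \<eta>" .
  have "flux_at \<tau> (W \<tau>) (W' \<tau>)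
      \<le> (1 + 3 * M + 2 * M\<^sup>2) * energy (W \<tau>) (W' \<tau>)"
    using sign_l[OF \<tau>] sign_r[OF \<tau>] by (intro flux_le_energy[OF c W[OF \<tau>']]) auto
  then have main: "flux_at \<tau> (\<lambda>x. 2 * W \<tau> x) (\<lambda>x. 2 * W' \<tau> x)
      \<le> 2 * (1 + 3 * M + 2 * M\<^sup>2) * energy (W \<tau>) (W' \<tau>)"
    unfolding flux_cmult[OF c] by (simp add: algebra_simps)
  have "flux_at \<tau>
      (\<lambda>x. 2 * W \<tau> x + (W t x + W s x - 2 * W \<tau> x)) (\<lambda>x. 2 * W' \<tau> x + (W' t x + W' s x - 2 * W' \<tau> x))
    = flux_at \<tau> (\<lambda>x. 2 * W \<tau> x) (\<lambda>x. 2 * W' \<tau> x)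
      + flux_at \<tau> (\<lambda>x. W t x + W s x - 2 * W \<tau> x)
      (\<lambda>x. W' t x + W' s x - 2 * W' \<tau> x)"
    by (rule flux_add[OF c potential_cont[OF p2] potential_cont'_unit[OF p2] potential_cont[OF q] potential_cont'_unit[OF q]])
  then show ?thesis
    using small main by simp
qed

lemma energy_increment_le:
  assumes s: "a \<le> s" "s < t" "t \<le> b"
    and R: "\<And>\<tau>. \<tau> \<in> {s<..<t} \<Longrightarrow>
      flux_at \<tau> (\<lambda>x. W t x + W s x) (\<lambda>x. W' t x + W' s x) \<le> R"
  shows "energy (W t) (W' t) - energy (W s) (W' s) \<le> R * (t - s)"
proof -
  have st: "s \<in> {a..b}" "t \<in> {a..b}"
    using s by auto
  define g where "g x = W t x + W s x" for x
  define g' where "g' x = W' t x + W' s x" for x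
  define F where "F \<tau> = flux_at \<tau> g g'" for \<tau>
  have p: "potential l r (\<lambda>x. Y t x + Y s x) g g'"
    unfolding g_def g'_def by (rule potential_add[OF W[OF st(2)] W[OF st(1)]])
  have "set_integrable lborel {s..t} F \<and> (LINT \<tau>:{s..t}|lborel. F \<tau>) =
      (LINT \<tau>:{s..t}|lborel. hr \<tau> * g 1 - hl \<tau> * g 0) + (\<integral>x. (Y t x - Y s x) * g x \<partial>U)"
    unfolding F_def by (rule evolution[OF _ _ _ potential_DERIV[OF p] potential_cont'[OF p]]) (use s ab in auto)
  then have i: "set_integrable lborel {s..t} F"
    and e: "(LINT \<tau>:{s..t}|lborel. F \<tau>) =
      (LINT \<tau>:{s..t}|lborel. hr \<tau> * g 1 - hl \<tau> * g 0) + (\<integral>x. (Y t x - Y s x) * g x \<partial>U)"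
    by blast+
  \<comment> \<open>The signs are known only inside \<open>{a<..<b}\<close>, since \<open>a\<close>
    and \<open>b\<close> may be zeros of the boundary velocities; the end points \<open>s\<close>
    and \<open>t\<close> are discarded as null sets. At every other time each product has a
    vanishing factor, the boundary flux or the potential.\<close>
  have "(LINT \<tau>:{s..t}|lborel. hr \<tau> * g 1 - hl \<tau> * g 0) = 0"
    unfolding set_lebesgue_integral_def
  proof (rule integral_eq_zero_AE)
    show "AE \<tau> in lborel. indicator {s..t} \<tau> *\<^sub>R (hr \<tau> * g 1 - hl \<tau> * g 0) = 0"
      using left_inflow right_inflow AE_lborel_singleton[of s] AE_lborel_singleton[of t]
    proof eventually_elim
      case (elim \<tau>)
      show ?case
      proof (cases "\<tau> \<in> {s..t}")
        case True
        with elim s have \<tau>: "\<tau> \<in> {a<..<b}" "\<tau> \<in> {0..T}"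
          using ab by auto
        have "hr \<tau> * g 1 = 0"
          using elim(2) \<tau> sign_r[OF \<tau>(1)] potential_1[OF W[OF st(1)]] potential_1[OF W[OF st(2)]]
          by (cases r) (auto simp: g_def)
        moreover have "hl \<tau> * g 0 = 0"
          using elim(1) \<tau> sign_l[OF \<tau>(1)] potential_0[OF W[OF st(1)]] potential_0[OF W[OF st(2)]]
          by (cases l) (auto simp: g_def)
        ultimately show ?thesis by (simp only: diff_self scaleR_zero_right)
      qed simp
    qed
  qed
  then have "energy (W t) (W' t) - energy (W s) (W' s) = (LINT \<tau>:{s..t}|lborel. F \<tau>)"
    unfolding e energy_diff_eq[OF W[OF st(2)] W[OF st(1)]] by (simp add: g_def)
  also have "\<dots> \<le> (LINT \<tau>:{s..t}|lborel. R)"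
    unfolding set_lebesgue_integral_def
  proof (rule integral_mono_AE)
    show "integrable lborel (\<lambda>\<tau>. indicator {s..t} \<tau> *\<^sub>R F \<tau>)"
      using i by (simp add: set_integrable_def)
    show "integrable lborel (\<lambda>\<tau>. indicator {s..t} \<tau> *\<^sub>R R)"
      by (rule borel_integrable_compact[OF compact_Icc continuous_on_const])
    show "AE \<tau> in lborel. indicator {s..t} \<tau> *\<^sub>R F \<tau> \<le> indicator {s..t} \<tau> *\<^sub>R R"
      using AE_lborel_singleton[of s] AE_lborel_singleton[of t]
    proof eventually_elim
      case (elim \<tau>)
      then show ?case
        using R[of \<tau>] by (auto simp: indicator_def F_def g_def[abs_def] g'_def[abs_def])
    qed
  qed
  also have "\<dots> = R * (t - s)"
    using s by (simp add: set_lebesgue_integral_def)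
  finally show ?thesis .
qed

lemma energy_Dini:
  assumes s: "a \<le> s" "s < b" and \<epsilon>: "0 < \<epsilon>"
  shows "\<exists>\<delta>>0. \<forall>t. s < t \<and> t < s + \<delta> \<and> t \<le> b \<longrightarrow>
    energy (W t) (W' t) - energy (W s) (W' s)
      \<le> (2 * (1 + 3 * M + 2 * M\<^sup>2) * energy (W s) (W' s) + \<epsilon>) * (t - s)"
proof -
  define C where "C = 2 * (1 + 3 * M + 2 * M\<^sup>2)"
  define K where "K = 2 + 20 * M\<^sup>2 + 20 * M ^ 4"
  \<comment> \<open>Half of \<open>\<epsilon>\<close> pays for the remainder
    \<open>K * \<eta>\<close>. The other half pays for replacing the energy at \<open>\<tau>\<close>
    by the one at \<open>s\<close>, which continuity of the energy allows within
    \<open>\<epsilon> / (2 * C)\<close>.\<close>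
  define \<eta> where "\<eta> = \<epsilon> / (2 * K)"
  have "0 < C"
    unfolding C_def using M_pos by (simp add: add_pos_pos)
  have "0 < K"
    unfolding K_def using M_pos by (simp add: add_pos_pos)
  have \<eta>: "0 < \<eta>" "K * \<eta> = \<epsilon> / 2"
    using \<open>0 < K\<close> \<epsilon> by (simp_all add: \<eta>_def)
  have sT: "s \<in> {0..T}" and sab: "s \<in> {a..b}"
    using s ab by auto
  have "\<forall>\<^sub>F u in at s within {0..T}. (\<integral>x. (Y u x - Y s x)\<^sup>2 \<partial>U) < \<eta>\<^sup>2 / 20"
  proof (rule order_tendstoD(2))
    show "((\<lambda>u. \<integral>x. (Y u x - Y s x)\<^sup>2 \<partial>U) \<longlongrightarrow> 0) (at s within {0..T})"
      using cont sT unfolding L2_continuous_def by blast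
  qed (use \<eta> in simp)
  then obtain d1 where d1: "0 < d1"
    "\<And>u. u \<in> {0..T} \<Longrightarrow> u \<noteq> s \<Longrightarrow> dist u s < d1 \<Longrightarrow> (\<integral>x. (Y u x - Y s x)\<^sup>2 \<partial>U) < \<eta>\<^sup>2 / 20"
    unfolding eventually_at by blast
  have "\<forall>\<^sub>F u in at s within {a..b}. energy (W u) (W' u) < energy (W s) (W' s) + \<epsilon> / (2 * C)"
  proof (rule order_tendstoD(2))
    show "((\<lambda>u. energy (W u) (W' u)) \<longlongrightarrow> energy (W s) (W' s)) (at s within {a..b})"
      using energy_continuous_on sab unfolding continuous_on_def by blast
  qed (use \<epsilon> \<open>0 < C\<close> in simp)
  then obtain d2 where d2: "0 < d2"
    "\<And>u. u \<in> {a..b} \<Longrightarrow> u \<noteq> s \<Longrightarrow> dist u s < d2 \<Longrightarrow> energy (W u) (W' u) < energy (W s) (W' s) + \<epsilon> / (2 * C)"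
    unfolding eventually_at by blast
  have "energy (W t) (W' t) - energy (W s) (W' s) \<le> (C * energy (W s) (W' s) + \<epsilon>) * (t - s)"
    if t: "s < t" "t < s + min d1 d2" "t \<le> b" for t
  proof (rule energy_increment_le[OF s(1) t(1,3)])
    fix \<tau> assume \<tau>: "\<tau> \<in> {s<..<t}"
    have near: "t - s < d1" "t - s < d2"
      using t(2) by linarith+
    have "flux_at \<tau> (\<lambda>x. W t x + W s x) (\<lambda>x. W' t x + W' s x)
      \<le> C * energy (W \<tau>) (W' \<tau>) + K * \<eta>"
      unfolding C_def K_def
    proof (rule flux_two_times_le[OF _ sab _ \<eta>(1)])
      show "\<tau> \<in> {a<..<b}" "t \<in> {a..b}"
        using \<tau> t s by auto
      show "(\<integral>x. (Y \<tau> x - Y s x)\<^sup>2 \<partial>U) \<le> \<eta>\<^sup>2 / 20"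
        using d1(2)[of \<tau>] \<tau> t s ab near by (simp add: dist_real_def)
      show "(\<integral>x. (Y t x - Y s x)\<^sup>2 \<partial>U) \<le> \<eta>\<^sup>2 / 20"
        using d1(2)[of t] t s ab near by (simp add: dist_real_def)
    qed
    moreover have "C * energy (W \<tau>) (W' \<tau>) \<le> C * (energy (W s) (W' s) + \<epsilon> / (2 * C))"
      using d2(2)[of \<tau>] \<tau> t s near \<open>0 < C\<close> by (intro mult_left_mono) (auto simp: dist_real_def)
    moreover have "\<dots> = C * energy (W s) (W' s) + \<epsilon> / 2"
      using \<open>0 < C\<close> by (simp add: distrib_left)
    ultimately show "flux_at \<tau> (\<lambda>x. W t x + W s x) (\<lambda>x. W' t x + W' s x)
      \<le> C * energy (W s) (W' s) + \<epsilon>"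
      using \<eta>(2) by linarith
  qed
  moreover have "0 < min d1 d2"
    using d1(1) d2(1) by simp
  ultimately show ?thesis
    unfolding C_def by blast
qed

lemma vanishing_propagates:
  assumes "sqnorm (Y a) = 0" and t: "t \<in> {a..b}"
  shows "sqnorm (Y t) = 0"
proof -
  have aab: "a \<in> {a..b}"
    using ab by simp
  have "energy (W t) (W' t) \<le> 0"
  proof (rule Dini_Gronwall[OF energy_continuous_on _ _ energy_Dini t])
    show "energy (W a) (W' a) = 0"
      using energy_le[OF W[OF aab]] energy_nonneg[OF W[OF aab]] assms(1) by simp
    show "0 \<le> 2 * (1 + 3 * M + 2 * M\<^sup>2)"
      using M_pos by simp
  qed
  then have "energy (W t) (W' t) = 0"
    using energy_nonneg[OF W[OF t]] by simp
  then have "AE x in U. Y t x = 0"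
    by (rule energy_zero[OF W[OF t]])
  then have "AE x in U. (Y t x)\<^sup>2 = 0"
    by eventually_elim simp
  then show ?thesis
    by (rule integral_eq_zero_AE)
qed

end

lemma vanishing_between_zeros:
  assumes ab: "0 \<le> a" "a < b" "b < T"
    and no_zero: "\<And>\<tau>. \<tau> \<in> {a<..<b} \<Longrightarrow> v \<tau> 0 \<noteq> 0 \<and> v \<tau> 1 \<noteq> 0"
    and a: "sqnorm (Y a) = 0" and t: "t \<in> {a..b}"
  shows "sqnorm (Y t) = 0"
proof -
  have sub: "{a<..<b} \<subseteq> {0..T}"
    using ab by auto
  have "\<exists>l. \<forall>\<tau>\<in>{a<..<b}. l \<longleftrightarrow> 0 < v \<tau> 0"
    using continuous_nonzero_sign[OF continuous_on_subset[OF boundary_cont(1) sub]] no_zero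
    by (metis less_asym)
  then obtain l where l: "\<And>\<tau>. \<tau> \<in> {a<..<b} \<Longrightarrow> l \<longleftrightarrow> 0 < v \<tau> 0"
    by blast
  have "\<exists>r. \<forall>\<tau>\<in>{a<..<b}. r \<longleftrightarrow> v \<tau> 1 < 0"
    using continuous_nonzero_sign[OF continuous_on_subset[OF boundary_cont(2) sub]] no_zero
    by (metis less_asym)
  then obtain r where r: "\<And>\<tau>. \<tau> \<in> {a<..<b} \<Longrightarrow> r \<longleftrightarrow> v \<tau> 1 < 0"
    by blast
  have "\<forall>t\<in>{a..b}. \<exists>p. potential l r (Y t) (fst p) (snd p)"
    using potential_exists[OF Y_L2] ab by fastforce
  then obtain p where p: "\<And>t. t \<in> {a..b} \<Longrightarrow> potential l r (Y t) (fst (p t)) (snd (p t))"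
    by metis
  show ?thesis
    by (rule vanishing_propagates[OF ab l r p a t])
qed

lemma difference_zero:
  assumes t: "t \<in> {0..T}"
  shows "sqnorm (Y t) = 0"
  using t
proof (induction rule: real_induction)
  case start
  show ?case by (rule initial)
next
  case (right s)
  \<comment> \<open>Only the zeros other than \<open>s\<close> are avoided; \<open>s\<close> itself
    may be one.\<close>
  obtain d where d: "0 < d" "\<And>u. u \<in> {t \<in> {0..T}. v t 0 = 0 \<or> v t 1 = 0} \<Longrightarrow> u \<noteq> s \<Longrightarrow> d \<le> dist s u"
    using finite_set_avoid[OF finite_zeros, of s] by blast
  \<comment> \<open>The cut at \<open>T - s\<close> keeps \<open>u\<close> below \<open>T\<close>,
    where \<open>evolution\<close> is available; the time \<open>T\<close> is reached by continuity
    in the case \<open>limit\<close>.\<close>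
  have "sqnorm (Y u) = 0" if u: "s < u" "u < s + min d (T - s)" "u \<le> T" for u
  proof (rule vanishing_between_zeros[OF right(1) u(1)])
    show "u < T" using u by simp
    show "v \<tau> 0 \<noteq> 0 \<and> v \<tau> 1 \<noteq> 0" if "\<tau> \<in> {s<..<u}" for \<tau>
      using d(2)[of \<tau>] that u right(1) by (fastforce simp: dist_real_def)
    show "sqnorm (Y s) = 0"
      using right(3)[of s] right(1) by simp
  qed (use u in simp)
  moreover have "0 < min d (T - s)"
    using d(1) right(2) by simp
  ultimately show ?case by blast
next
  case (limit s)
  define f where "f t = sqnorm (Y t)" for t
  have "(f \<longlongrightarrow> f s) (at s within {0..<s})"
  proof (rule tendsto_within_subset)
    show "(f \<longlongrightarrow> f s) (at s within {0..T})"
      using L2_continuous_imp_continuous[OF cont] limit(1,2) unfolding continuous_on_def f_def by simp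
  qed (use limit(2) in auto)
  moreover have "\<forall>\<^sub>F u in at s within {0..<s}. f u = 0"
    unfolding eventually_at_filter f_def using limit(3) by (simp add: always_eventually)
  then have "(f \<longlongrightarrow> 0) (at s within {0..<s})"
    by (rule tendsto_eventually)
  moreover have "at s within {0..<s} \<noteq> bot"
    using limit(1) by (simp add: trivial_limit_within islimpt_Ico)
  ultimately show ?case
    using tendsto_unique[of "at s within {0..<s}" f] unfolding f_def by blast
qed

end

section \<open>Vanishing of the boundary fluxes\<close>

context difference_problem
begin

text \<open>Once \<open>Y\<close> vanishes its energy is zero, and with it \<open>D\<close> and
  \<open>D'\<close> by the elliptic bounds. Every term of the integrand has one of these three as a
  factor.\<close>

lemma flux_zero:
  assumes t: "t \<in> {0..T}"
  shows "flux_at t g g' = 0"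
proof -
  note c = coeffs[OF t]
  obtain W W' where p: "potential False False (Y t) W W'"
    using potential_exists[OF Y_L2[OF t]] by blast
  have E: "energy W W' = 0"
    using energy_le[OF p] energy_nonneg[OF p] difference_zero[OF t] by simp
  have D0: "D t x = 0" if "x \<in> {0..1}" for x
    using diff_square_le_energy[OF c p that] E by simp
  have "AE x in U. (D' t x)\<^sup>2 = 0"
  proof -
    have "0 \<le> sqnorm (D' t)"
      by simp
    then have "sqnorm (D' t) = 0"
      using deriv_le_energy[OF c p] E by linarith
    then show ?thesis
      using integral_nonneg_eq_0_iff_AE[OF L2_square[OF coeff_D(2)[OF c]]] by simp
  qed
  then have "AE x in U. (Y t x * v t x + z t x * D t x) * g' x - (Y t x * v' t x + z t x * D' t x) * g x = 0"
    using energy_zero[OF p E] AE_space[of U] by eventually_elim (simp add: D0)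
  then show ?thesis
    unfolding flux_def by (rule integral_eq_zero_AE)
qed

text \<open>With \<open>Y\<close> and the flux gone, \<open>evolution\<close> from time 0 retains
  nothing but the boundary integral.\<close>

lemma boundary_flux_zero:
  assumes t: "0 \<le> t" "t < T" and g: "\<And>x. (g has_real_derivative g' x) (at x)" "continuous_on UNIV g'"
  shows "(LINT \<tau>:{0..t}|lborel. hr \<tau> * g 1 - hl \<tau> * g 0) = 0"
proof -
  have "AE x in U. Y u x = 0" if u: "u \<in> {0..T}" for u
  proof -
    have "AE x in U. (Y u x)\<^sup>2 = 0"
      using integral_nonneg_eq_0_iff_AE[OF L2_square[OF Y_L2[OF u]]] difference_zero[OF u] by simp
    then show ?thesis
      by eventually_elim simp
  qed
  then have "AE x in U. Y t x = 0" "AE x in U. Y 0 x = 0"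
    using t by simp_all
  then have "AE x in U. (Y t x - Y 0 x) * g x = 0"
    by eventually_elim simp
  then have "(\<integral>x. (Y t x - Y 0 x) * g x \<partial>U) = 0"
    by (rule integral_eq_zero_AE)
  moreover have "(LINT \<tau>:{0..t}|lborel. flux_at \<tau> g g') = 0"
    unfolding set_lebesgue_integral_def
  proof (intro integral_eq_zero_AE AE_I2)
    fix \<tau> :: real
    show "indicator {0..t} \<tau> *\<^sub>R flux_at \<tau> g g' = 0"
      using flux_zero[of \<tau> g g'] t by (cases "\<tau> \<in> {0..t}") auto
  qed
  ultimately show ?thesis
    using evolution[OF _ t g] by simp
qed

end

text \<open>The integrals are known for \<open>t < T\<close> only, so the half-line criterion is
  applied on each \<open>{0..b}\<close> with \<open>b < T\<close>. Countably many such
  \<open>b\<close> exhaust the interval up to the point \<open>T\<close>.\<close>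

lemma AE_zero_if_initial_integrals_zero:
  fixes h :: "real \<Rightarrow> real"
  assumes h: "set_integrable lborel {0..T} h"
    and zero: "\<And>t. 0 \<le> t \<Longrightarrow> t < T \<Longrightarrow> (LINT \<tau>:{0..t}|lborel. h \<tau>) = 0"
  shows "AE \<tau> in lborel. \<tau> \<in> {0..T} \<longrightarrow> h \<tau> = 0"
proof -
  have part: "AE \<tau> in lborel. \<tau> \<in> {0..b} \<longrightarrow> h \<tau> = 0" if b: "b < T" for b
  proof -
    define f where "f \<tau> = indicator {0..b} \<tau> * h \<tau>" for \<tau>
    have "AE \<tau> in lborel. f \<tau> = 0"
    proof (rule AE_zero_if_half_line_integrals_zero)
      have "set_integrable lborel {0..b} h"
        by (rule set_integrable_subset[OF h]) (use b in auto)
      then show "integrable lborel f"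
        by (simp add: set_integrable_def f_def[abs_def])
      have part: "(\<integral>\<tau>. indicator {0..t} \<tau> * h \<tau> \<partial>lborel) = 0" if "t \<le> b" for t
        using zero[of t] that b by (cases "0 \<le> t") (simp_all add: set_lebesgue_integral_def)
      then show "(\<integral>\<tau>. f \<tau> \<partial>lborel) = 0"
        by (simp add: f_def)
      show "(\<integral>\<tau>. indicator {..x} \<tau> * f \<tau> \<partial>lborel) = 0" for x
      proof -
        have "(\<integral>\<tau>. indicator {..x} \<tau> * f \<tau> \<partial>lborel) = (\<integral>\<tau>. indicator {0..min x b} \<tau> * h \<tau> \<partial>lborel)"
          by (rule Bochner_Integration.integral_cong) (auto simp: f_def indicator_def)
        then show ?thesis
          using part[of "min x b"] by simp
      qed
    qed
    then show ?thesis
      by eventually_elim (auto simp: f_def)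
  qed
  have "AE \<tau> in lborel. \<forall>n. \<tau> \<in> {0..T - 1 / real (Suc n)} \<longrightarrow> h \<tau> = 0"
    unfolding AE_all_countable using part by simp
  then show ?thesis
    using AE_lborel_singleton[of T]
  proof eventually_elim
    case (elim \<tau>)
    show ?case
    proof
      assume \<tau>: "\<tau> \<in> {0..T}"
      with elim have "0 < T - \<tau>" by simp
      then obtain n where "1 / real (Suc n) < T - \<tau>"
        using reals_Archimedean[of "T - \<tau>"] by (auto simp: inverse_eq_divide)
      then show "h \<tau> = 0"
        using elim(1)[rule_format, of n] \<tau> by auto
    qed
  qed
qed

section \<open>From two weak solutions to the difference problem\<close>

lemma Linf_mult_continuous_integrable:
  fixes f h :: "real \<Rightarrow> real"
  assumes f: "Linf_on {a..b} f" and h: "continuous_on {a..b} h"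
  shows "set_integrable lborel {a..b} (\<lambda>t. f t * h t)"
proof -
  obtain C where C: "AE t in lborel. t \<in> {a..b} \<longrightarrow> \<bar>f t\<bar> \<le> C"
    using f unfolding Linf_on_def by blast
  have ih: "integrable lborel (\<lambda>t. indicator {a..b} t *\<^sub>R h t)"
    by (rule borel_integrable_compact[OF compact_Icc h])
  have "integrable lborel (\<lambda>t. (indicator {a..b} t *\<^sub>R f t) * (indicator {a..b} t *\<^sub>R h t))"
  proof (rule Bochner_Integration.integrable_bound)
    show "integrable lborel (\<lambda>t. C * (indicator {a..b} t *\<^sub>R h t))"
      using ih by (rule integrable_mult_right)
    show "(\<lambda>t. (indicator {a..b} t *\<^sub>R f t) * (indicator {a..b} t *\<^sub>R h t)) \<in> borel_measurable lborel"
      using f borel_measurable_integrable[OF ih] unfolding Linf_on_def set_borel_measurable_def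
      by (intro borel_measurable_times) blast+
    show "AE t in lborel. norm ((indicator {a..b} t *\<^sub>R f t) * (indicator {a..b} t *\<^sub>R h t))
        \<le> norm (C * (indicator {a..b} t *\<^sub>R h t))"
      using C
    proof eventually_elim
      case (elim t)
      show ?case
      proof (cases "t \<in> {a..b}")
        case True
        then have "\<bar>f t\<bar> * \<bar>h t\<bar> \<le> \<bar>C\<bar> * \<bar>h t\<bar>"
          using elim by (intro mult_right_mono) auto
        then show ?thesis
          using True by (simp add: abs_mult)
      qed simp
    qed
  qed
  moreover have "(\<lambda>t. (indicator {a..b} t *\<^sub>R f t) * (indicator {a..b} t *\<^sub>R h t)) = (\<lambda>t. indicator {a..b} t *\<^sub>R (f t * h t))"
    by (auto simp: indicator_def)
  ultimately show ?thesis
    by (simp add: set_integrable_def)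
qed

lemma continuous_family_bounded:
  fixes f :: "nat \<Rightarrow> real \<Rightarrow> real"
  assumes "\<And>i. i < n \<Longrightarrow> continuous_on {a..b} (f i)"
  obtains B where "0 \<le> B" "\<And>i t. i < n \<Longrightarrow> t \<in> {a..b} \<Longrightarrow> \<bar>f i t\<bar> \<le> B"
proof -
  have "\<exists>B\<ge>0. \<forall>i<n. \<forall>t\<in>{a..b}. \<bar>f i t\<bar> \<le> B"
    using assms
  proof (induction n)
    case (Suc n)
    then obtain B where B: "0 \<le> B" "\<forall>i<n. \<forall>t\<in>{a..b}. \<bar>f i t\<bar> \<le> B"
      by (metis less_Suc_eq)
    have "bounded (f n ` {a..b})"
      by (intro compact_imp_bounded compact_continuous_image Suc.prems compact_Icc) simp
    then obtain C where C: "\<forall>y\<in>f n ` {a..b}. norm y \<le> C"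
      unfolding bounded_iff by blast
    have "\<bar>f i t\<bar> \<le> max B C" if i: "i < Suc n" and t: "t \<in> {a..b}" for i t
    proof (cases "i = n")
      case True
      then show ?thesis
        using bspec[OF C imageI[OF t]] by simp
    next
      case False
      then have "\<bar>f i t\<bar> \<le> B"
        using B(2) i t by (simp add: less_Suc_eq)
      then show ?thesis by simp
    qed
    then show ?case
      using B(1) by (intro exI[of _ "max B C"]) auto
  qed (auto intro: exI[of _ 0])
  then show thesis
    using that by blast
qed

lemma is_velocity_elliptic:
  assumes "is_velocity T n bvl bvr y V" "t \<in> {0..T}"
  shows "elliptic_solution n (y t) (\<lambda>i. V i t)"
  using assms unfolding is_velocity_def elliptic_solution_def integral_U by blast

lemma is_velocity_boundary:
  assumes "is_velocity T n bvl bvr y V" "t \<in> {0..T}" "i < n"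
  shows "V i t 0 = bvl i t" "V i t 1 = bvr i t"
  using assms unfolding is_velocity_def by blast+

text \<open>The weak formulation integrates over a rectangle, the energy argument over slices. The
  mean-square bound \<open>N\<close>, uniform in time, controls the products through
  \<open>\<bar>p * q\<bar> \<le> p\<^sup>2 + q\<^sup>2\<close> and makes
  \<open>rectangle_Fubini\<close> applicable.\<close>

lemma weak_equation_sliced:
  fixes y w w' :: "real \<Rightarrow> real \<Rightarrow> real"
  assumes y: "set_borel_measurable lborel ({0..T} \<times> {0<..<1}) (\<lambda>(t, x). y t x)" "\<And>t. t \<in> {0..T} \<Longrightarrow> L2 (y t)"
    and w: "set_borel_measurable lborel ({0..T} \<times> {0<..<1}) (\<lambda>(t, x). w t x)" "\<And>t. t \<in> {0..T} \<Longrightarrow> L2 (w t)"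
    and w': "set_borel_measurable lborel ({0..T} \<times> {0<..<1}) (\<lambda>(t, x). w' t x)" "\<And>t. t \<in> {0..T} \<Longrightarrow> L2 (w' t)"
    and N: "\<And>t. t \<in> {0..T} \<Longrightarrow> sqnorm (y t) \<le> N" "\<And>t. t \<in> {0..T} \<Longrightarrow> sqnorm (w t) \<le> N"
      "\<And>t. t \<in> {0..T} \<Longrightarrow> sqnorm (w' t) \<le> N"
    and st: "0 \<le> s" "t \<le> T" and g: "continuous_on UNIV g" "continuous_on UNIV g'"
  shows "set_integrable lborel {s..t} (\<lambda>\<tau>. \<integral>x. y \<tau> x * w \<tau> x * g' x - y \<tau> x * w' \<tau> x * g x \<partial>U)"
    and "(LINT (\<tau>, x):{s..t} \<times> {0<..<1}|lborel. y \<tau> x * w \<tau> x * g' x - y \<tau> x * w' \<tau> x * g x)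
      = (LINT \<tau>:{s..t}|lborel. (\<integral>x. y \<tau> x * w \<tau> x * g' x - y \<tau> x * w' \<tau> x * g x \<partial>U))"
proof -
  have gu: "continuous_on {0..1} g" "continuous_on {0..1} g'"
    using g continuous_on_subset by blast+
  obtain G0 where G0: "0 < G0" "\<And>x. x \<in> {0..1} \<Longrightarrow> \<bar>g x\<bar> \<le> G0"
    using continuous_bounded_unit[OF gu(1)] by blast
  obtain G1 where G1: "0 < G1" "\<And>x. x \<in> {0..1} \<Longrightarrow> \<bar>g' x\<bar> \<le> G1"
    using continuous_bounded_unit[OF gu(2)] by blast
  let ?Q = "{s..t} \<times> {0<..<1::real}"
  have "?Q \<in> sets (lborel \<Otimes>\<^sub>M lborel)"
    by (intro pair_measureI) simp_all
  then have Q: "?Q \<in> sets lborel" "?Q \<subseteq> {0..T} \<times> {0<..<1}"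
    using st unfolding lborel_prod by auto
  note sub = set_borel_measurable_subset[OF _ Q]
  have [measurable]: "(\<lambda>p. indicator ?Q p *\<^sub>R (case p of (t, x) \<Rightarrow> y t x)) \<in> borel_measurable lborel"
      "(\<lambda>p. indicator ?Q p *\<^sub>R (case p of (t, x) \<Rightarrow> w t x)) \<in> borel_measurable lborel"
      "(\<lambda>p. indicator ?Q p *\<^sub>R (case p of (t, x) \<Rightarrow> w' t x)) \<in> borel_measurable lborel"
    using sub[OF y(1)] sub[OF w(1)] sub[OF w'(1)] by (simp_all add: set_borel_measurable_def)
  have [measurable]: "(\<lambda>p. g (snd p)) \<in> borel_measurable (lborel :: (real \<times> real) measure)"
      "(\<lambda>p. g' (snd p)) \<in> borel_measurable (lborel :: (real \<times> real) measure)"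
    using continuous_on_compose2[OF g(1) continuous_on_snd[OF continuous_on_id], of UNIV]
      continuous_on_compose2[OF g(2) continuous_on_snd[OF continuous_on_id], of UNIV]
    by (auto intro: borel_measurable_continuous_onI)
  let ?F = "\<lambda>\<tau> x. y \<tau> x * w \<tau> x * g' x - y \<tau> x * w' \<tau> x * g x"
  let ?i = "\<lambda>f p. indicator ?Q p *\<^sub>R (case p of (t, x) \<Rightarrow> f t x) :: real"
  have "(\<lambda>p. ?i y p * ?i w p * g' (snd p) - ?i y p * ?i w' p * g (snd p)) \<in> borel_measurable lborel"
    by measurable
  moreover have "(\<lambda>p. ?i y p * ?i w p * g' (snd p) - ?i y p * ?i w' p * g (snd p)) = ?i ?F"
    by (auto simp: indicator_def fun_eq_iff)
  ultimately have meas: "set_borel_measurable lborel ?Q (\<lambda>(\<tau>, x). ?F \<tau> x)"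
    by (simp add: set_borel_measurable_def)
  have i: "integrable U (?F \<tau>)" if "\<tau> \<in> {s..t}" for \<tau>
  proof -
    have \<tau>: "\<tau> \<in> {0..T}" using that st by auto
    show ?thesis
      by (intro Bochner_Integration.integrable_diff integrable_mult_continuous gu L2_mult_integrable y(2) w(2) w'(2) \<tau>)
  qed
  have bound: "(\<integral>x. \<bar>?F \<tau> x\<bar> \<partial>U) \<le> G1 * (N + N) + G0 * (N + N)" if "\<tau> \<in> {s..t}" for \<tau>
  proof -
    have \<tau>: "\<tau> \<in> {0..T}" using that st by auto
    have sq: "integrable U (\<lambda>x. (y \<tau> x)\<^sup>2)" "integrable U (\<lambda>x. (w \<tau> x)\<^sup>2)" "integrable U (\<lambda>x. (w' \<tau> x)\<^sup>2)"
      using L2_square[OF y(2)[OF \<tau>]] L2_square[OF w(2)[OF \<tau>]] L2_square[OF w'(2)[OF \<tau>]] .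
    have ab: "\<bar>p * q\<bar> \<le> p\<^sup>2 + q\<^sup>2" for p q :: real
    proof -
      have "0 \<le> \<bar>p\<bar> * \<bar>q\<bar>"
        by simp
      then show ?thesis
        using sum_squares_bound[of "\<bar>p\<bar>" "\<bar>q\<bar>"] unfolding abs_mult power2_abs by linarith
    qed
    have "(\<integral>x. \<bar>?F \<tau> x\<bar> \<partial>U) \<le> (\<integral>x. G1 * ((y \<tau> x)\<^sup>2 + (w \<tau> x)\<^sup>2) + G0 * ((y \<tau> x)\<^sup>2 + (w' \<tau> x)\<^sup>2) \<partial>U)"
    proof (rule integral_mono)
      show "integrable U (\<lambda>x. \<bar>?F \<tau> x\<bar>)"
        using i[OF that] by (rule integrable_abs)
      show "integrable U (\<lambda>x. G1 * ((y \<tau> x)\<^sup>2 + (w \<tau> x)\<^sup>2) + G0 * ((y \<tau> x)\<^sup>2 + (w' \<tau> x)\<^sup>2))"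
        using sq by simp
      fix x assume "x \<in> space U"
      then have x: "x \<in> {0..1}" by simp
      have "\<bar>y \<tau> x * w \<tau> x\<bar> * \<bar>g' x\<bar> \<le> ((y \<tau> x)\<^sup>2 + (w \<tau> x)\<^sup>2) * G1"
        by (rule mult_mono) (use ab G1(2)[OF x] in auto)
      moreover have "\<bar>y \<tau> x * w' \<tau> x\<bar> * \<bar>g x\<bar> \<le> ((y \<tau> x)\<^sup>2 + (w' \<tau> x)\<^sup>2) * G0"
        by (rule mult_mono) (use ab G0(2)[OF x] in auto)
      moreover have "\<bar>?F \<tau> x\<bar> \<le> \<bar>y \<tau> x * w \<tau> x\<bar> * \<bar>g' x\<bar> + \<bar>y \<tau> x * w' \<tau> x\<bar> * \<bar>g x\<bar>"
        unfolding abs_mult[symmetric] by (rule abs_triangle_ineq4)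
      ultimately show "\<bar>?F \<tau> x\<bar> \<le> G1 * ((y \<tau> x)\<^sup>2 + (w \<tau> x)\<^sup>2) + G0 * ((y \<tau> x)\<^sup>2 + (w' \<tau> x)\<^sup>2)"
        by (simp add: mult.commute)
    qed
    also have "\<dots> = G1 * (sqnorm (y \<tau>) + sqnorm (w \<tau>)) + G0 * (sqnorm (y \<tau>) + sqnorm (w' \<tau>))"
      using sq by simp
    also have "\<dots> \<le> G1 * (N + N) + G0 * (N + N)"
      using G0(1) G1(1) N[OF \<tau>] by (intro add_mono mult_left_mono) auto
    finally show ?thesis .
  qed
  show "set_integrable lborel {s..t} (\<lambda>\<tau>. \<integral>x. ?F \<tau> x \<partial>U)"
    by (rule rectangle_Fubini(2)[OF meas i bound])
  show "(LINT (\<tau>, x):?Q|lborel. ?F \<tau> x) = (LINT \<tau>:{s..t}|lborel. (\<integral>x. ?F \<tau> x \<partial>U))"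
    by (rule rectangle_Fubini(3)[OF meas i bound])
qed

text \<open>The point is uniformity in time. The boundary data are continuous and the solutions
  continuous in mean square on a compact interval, so all slices of both solutions obey one bound,
  and \<open>elliptic_regularity\<close> returns a single constant for all velocities.\<close>

lemma weak_solution_difference:
  assumes T: "T > 0" and n: "n \<ge> 1"
    and data: "CH_data T n vl vr y0 bvl bvr yrc ylc"
    and sol1: "weak_solution T n vl vr y0 bvl bvr yrc ylc y1 yr1 yl1"
    and sol2: "weak_solution T n vl vr y0 bvl bvr yrc ylc y2 yr2 yl2"
  obtains M v v' v'' D D' where
    "difference_problem T M (\<lambda>t x. y1 t x - y2 t x) v v' v'' y2 D D'
      (\<lambda>t. yl1 t * vl t - yl2 t * vl t) (\<lambda>t. yr1 t * vr t - yr2 t * vr t)"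
proof -
  obtain V1 where V1: "is_velocity T n bvl bvr y1 V1"
    and eq1: "\<And>t0 t1 \<phi> \<phi>t \<phi>x. 0 \<le> t0 \<and> t0 \<le> t1 \<and> t1 < T \<and>
           H1_rect t0 t1 \<phi> \<phi>t \<phi>x \<and> edge_values_are_traces t0 t1 \<phi> \<phi>t \<phi>x \<Longrightarrow>
           (LINT (t, x):{t0..t1} \<times> {0<..<1}|lborel.
              y1 t x * \<phi>t t x + y1 t x * V1 0 t x * \<phi>x t x - y1 t x * V1 1 t x * \<phi> t x) =
           (LINT t:{t0..t1}|lborel. yr1 t * vr t * \<phi> t 1 - yl1 t * vl t * \<phi> t 0)
           + (LINT x:{0<..<1}|lborel. \<phi> t1 x * y1 t1 x)
           - (LINT x:{0<..<1}|lborel. \<phi> t0 x * y1 t0 x)"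
    using sol1 unfolding weak_solution_def by blast
  obtain V2 where V2: "is_velocity T n bvl bvr y2 V2"
    and eq2: "\<And>t0 t1 \<phi> \<phi>t \<phi>x. 0 \<le> t0 \<and> t0 \<le> t1 \<and> t1 < T \<and>
           H1_rect t0 t1 \<phi> \<phi>t \<phi>x \<and> edge_values_are_traces t0 t1 \<phi> \<phi>t \<phi>x \<Longrightarrow>
           (LINT (t, x):{t0..t1} \<times> {0<..<1}|lborel.
              y2 t x * \<phi>t t x + y2 t x * V2 0 t x * \<phi>x t x - y2 t x * V2 1 t x * \<phi> t x) =
           (LINT t:{t0..t1}|lborel. yr2 t * vr t * \<phi> t 1 - yl2 t * vl t * \<phi> t 0)
           + (LINT x:{0<..<1}|lborel. \<phi> t1 x * y2 t1 x)
           - (LINT x:{0<..<1}|lborel. \<phi> t0 x * y2 t0 x)"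
    using sol2 unfolding weak_solution_def by blast
  have c: "L2_continuous {0..T} y1" "L2_continuous {0..T} y2"
    using sol1 sol2 unfolding weak_solution_def C0_L2_iff by blast+
  have L: "L2 (y1 t)" "L2 (y2 t)" if "t \<in> {0..T}" for t
    using c that unfolding L2_continuous_def by blast+
  have meas: "set_borel_measurable lborel ({0..T} \<times> {0<..<1}) (\<lambda>(t, x). y1 t x)"
      "set_borel_measurable lborel ({0..T} \<times> {0<..<1}) (\<lambda>(t, x). y2 t x)"
    using sol1 sol2 unfolding weak_solution_def Linf_on_def by blast+
  have measV: "set_borel_measurable lborel ({0..T} \<times> {0<..<1}) (\<lambda>(t, x). V1 i t x)"
      "set_borel_measurable lborel ({0..T} \<times> {0<..<1}) (\<lambda>(t, x). V2 i t x)" if "i \<le> n" for i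
    using V1 V2 that unfolding is_velocity_def by blast+
  have lin: "Linf_on {0..T} yr1" "Linf_on {0..T} yl1" "Linf_on {0..T} yr2" "Linf_on {0..T} yl2"
    using sol1 sol2 unfolding weak_solution_def by blast+
  have le0: "0 \<le> n"
    by simp
  have vlc: "continuous_on {0..T} vl" and vrc: "continuous_on {0..T} vr"
    and zeros: "finite {t \<in> {0..T}. vl t = 0}" "finite {t \<in> {0..T}. vr t = 0}"
    and bvc: "\<And>i. i < n \<Longrightarrow> continuous_on {0..T} (bvl i)" "\<And>i. i < n \<Longrightarrow> continuous_on {0..T} (bvr i)"
    and bv0: "\<And>t. t \<in> {0..T} \<Longrightarrow> bvl 0 t = vl t \<and> bvr 0 t = vr t"
    using data unfolding CH_data_def by blast+
  obtain Bl where Bl: "0 \<le> Bl" "\<And>i t. i < n \<Longrightarrow> t \<in> {0..T} \<Longrightarrow> \<bar>bvl i t\<bar> \<le> Bl"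
    using continuous_family_bounded[of n 0 T bvl] bvc(1) by blast
  obtain Br where Br: "0 \<le> Br" "\<And>i t. i < n \<Longrightarrow> t \<in> {0..T} \<Longrightarrow> \<bar>bvr i t\<bar> \<le> Br"
    using continuous_family_bounded[of n 0 T bvr] bvc(2) by blast
  obtain N1 where N1: "0 \<le> N1" "\<And>t. t \<in> {0..T} \<Longrightarrow> sqnorm (y1 t) \<le> N1"
    using L2_continuous_bounded[OF c(1)] by blast
  obtain N2 where N2: "0 \<le> N2" "\<And>t. t \<in> {0..T} \<Longrightarrow> sqnorm (y2 t) \<le> N2"
    using L2_continuous_bounded[OF c(2)] by blast
  have NB: "0 \<le> N1 + N2" "0 \<le> Bl + Br"
    using N1(1) N2(1) Bl(1) Br(1) by simp_all
  obtain M0 where M0: "0 < M0"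
    "\<forall>y d. L2 y \<longrightarrow> sqnorm y \<le> N1 + N2 \<longrightarrow> elliptic_solution n y d \<longrightarrow>
      (\<forall>i<n. \<bar>d i 0\<bar> \<le> Bl + Br \<and> \<bar>d i 1\<bar> \<le> Bl + Br) \<longrightarrow> regular_jet M0 d"
    using elliptic_regularity[OF n NB] by blast
  have reg: "regular_jet M0 (\<lambda>i. V1 i t)" "regular_jet M0 (\<lambda>i. V2 i t)" if t: "t \<in> {0..T}" for t
  proof -
    have "sqnorm (y1 t) \<le> N1 + N2" "sqnorm (y2 t) \<le> N1 + N2"
      using N1(2)[OF t] N2(2)[OF t] N1(1) N2(1) by simp_all
    moreover have "\<forall>i<n. \<bar>V1 i t 0\<bar> \<le> Bl + Br \<and> \<bar>V1 i t 1\<bar> \<le> Bl + Br"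
    proof (intro allI impI)
      fix i assume i: "i < n"
      show "\<bar>V1 i t 0\<bar> \<le> Bl + Br \<and> \<bar>V1 i t 1\<bar> \<le> Bl + Br"
        using Bl(1) Br(1) Bl(2)[OF i t] Br(2)[OF i t] is_velocity_boundary[OF V1 t i] by simp
    qed
    moreover have "\<forall>i<n. \<bar>V2 i t 0\<bar> \<le> Bl + Br \<and> \<bar>V2 i t 1\<bar> \<le> Bl + Br"
    proof (intro allI impI)
      fix i assume i: "i < n"
      show "\<bar>V2 i t 0\<bar> \<le> Bl + Br \<and> \<bar>V2 i t 1\<bar> \<le> Bl + Br"
        using Bl(1) Br(1) Bl(2)[OF i t] Br(2)[OF i t] is_velocity_boundary[OF V2 t i] by simp
    qed
    ultimately show "regular_jet M0 (\<lambda>i. V1 i t)" "regular_jet M0 (\<lambda>i. V2 i t)"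
      using M0(2)[rule_format, OF L(1)[OF t] _ is_velocity_elliptic[OF V1 t]]
        M0(2)[rule_format, OF L(2)[OF t] _ is_velocity_elliptic[OF V2 t]] by simp_all
  qed
  have MV: "sqnorm (V1 0 t) \<le> M0" "sqnorm (V1 1 t) \<le> M0"
      "sqnorm (V2 0 t) \<le> M0" "sqnorm (V2 1 t) \<le> M0" if t: "t \<in> {0..T}" for t
    using reg[OF t] unfolding regular_jet_def by blast+
  \<comment> \<open>Packs \<open>v'\<close> and \<open>v''\<close> into one pair, so that a single
    choice over the times yields both.\<close>
  define R where "R t p \<longleftrightarrow> prim (V1 0 t) (fst p) \<and> prim (fst p) (snd p) \<and> L2 (snd p) \<and>
      (AE x in U. V1 1 t x = fst p x) \<and> (\<forall>x\<in>{0..1}. \<bar>V1 0 t x\<bar> \<le> M0 \<and> \<bar>fst p x\<bar> \<le> M0) \<and>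
      sqnorm (snd p) \<le> M0\<^sup>2" for t p
  have "\<exists>p. R t p" if t: "t \<in> {0..T}" for t
  proof -
    obtain v' v'' where "prim (V1 0 t) v' \<and> prim v' v'' \<and> L2 v'' \<and> (AE x in U. V1 1 t x = v' x) \<and>
       (\<forall>x\<in>{0..1}. \<bar>V1 0 t x\<bar> \<le> M0 \<and> \<bar>v' x\<bar> \<le> M0) \<and> sqnorm v'' \<le> M0\<^sup>2"
      using reg(1)[OF t] unfolding regular_jet_def by blast
    then show ?thesis
      by (intro exI[of _ "(v', v'')"], unfold R_def fst_conv snd_conv, assumption)
  qed
  then have "\<forall>t\<in>{0..T}. \<exists>p. R t p"
    by blast
  from bchoice[OF this] obtain p where p: "\<forall>t\<in>{0..T}. R t (p t)"
    by blast
  note p = p[rule_format, unfolded R_def]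
  \<comment> \<open>The summand 1 ensures \<open>M \<le> M\<^sup>2\<close>, which turns the linear
    bounds on the mean squares into the quadratic ones of \<open>flux_coeffs\<close>.\<close>
  define M where "M = 1 + M0 + N1 + N2"
  have M: "M0 \<le> M" "N1 \<le> M" "N2 \<le> M" "N1 + N2 \<le> M" "M \<le> M\<^sup>2" "M0\<^sup>2 \<le> M\<^sup>2" "0 < M"
  proof -
    show le: "M0 \<le> M" "N1 \<le> M" "N2 \<le> M" "N1 + N2 \<le> M" "0 < M"
      using M0(1) N1(1) N2(1) by (simp_all add: M_def)
    show "M \<le> M\<^sup>2"
      using self_le_power[of M 2] M0(1) N1(1) N2(1) by (simp add: M_def)
    show "M0\<^sup>2 \<le> M\<^sup>2"
      using le(1) M0(1) by (intro power_mono) auto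
  qed
  have pV: "prim (V1 0 t) (V1 1 t)" "prim (V2 0 t) (V2 1 t)" and LV: "L2 (V1 0 t)" "L2 (V2 0 t)" "L2 (V1 1 t)" "L2 (V2 1 t)"
    if t: "t \<in> {0..T}" for t
  proof -
    have J: "Hn_jet n (\<lambda>i. V1 i t)" "Hn_jet n (\<lambda>i. V2 i t)"
      using V1 V2 t unfolding is_velocity_def by blast+
    have n': "0 < n" "0 \<le> n" "1 \<le> n"
      using n by simp_all
    show "prim (V1 0 t) (V1 1 t)" "prim (V2 0 t) (V2 1 t)"
      using J n'(1) unfolding Hn_jet_iff by (metis One_nat_def)+
    show "L2 (V1 0 t)" "L2 (V2 0 t)" "L2 (V1 1 t)" "L2 (V2 1 t)"
      using J n'(2,3) unfolding Hn_jet_iff by blast+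
  qed
  have bdry: "V1 0 t 0 = vl t" "V1 0 t 1 = vr t" "V2 0 t 0 = vl t" "V2 0 t 1 = vr t" if t: "t \<in> {0..T}" for t
    using is_velocity_boundary[OF V1 t, of 0] is_velocity_boundary[OF V2 t, of 0] bv0[OF t] n by simp_all
  have "difference_problem T M (\<lambda>t x. y1 t x - y2 t x) (V1 0) (\<lambda>t. fst (p t)) (\<lambda>t. snd (p t)) y2
      (\<lambda>t x. V1 0 t x - V2 0 t x) (\<lambda>t x. V1 1 t x - V2 1 t x)
      (\<lambda>t. yl1 t * vl t - yl2 t * vl t) (\<lambda>t. yr1 t * vr t - yr2 t * vr t)"
  proof
    show "L2_continuous {0..T} (\<lambda>t x. y1 t x - y2 t x)"
      by (rule L2_continuous_diff[OF c])
    show "0 < T" by (rule T)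
  next
    fix t assume t: "t \<in> {0..T}"
    have YM: "(\<integral>x. (y1 t x - y2 t x)\<^sup>2 \<partial>U) \<le> 4 * M\<^sup>2"
      using integral_square_diff_le[OF L[OF t]] N1(2)[OF t] N2(2)[OF t] M by linarith
    have DY: "(\<integral>x. (V1 1 t x - V2 1 t x)\<^sup>2 \<partial>U) \<le> (\<integral>x. (y1 t x - y2 t x) * (V1 0 t x - V2 0 t x) \<partial>U)"
    proof (rule elliptic_difference[OF is_velocity_elliptic[OF V1 t] is_velocity_elliptic[OF V2 t] L[OF t] n])
      show "V1 i t 0 = V2 i t 0 \<and> V1 i t 1 = V2 i t 1" if "i < n" for i
        using is_velocity_boundary[OF V1 t that] is_velocity_boundary[OF V2 t that] by simp
    qed
    have vM: "\<forall>x\<in>{0..1}. \<bar>V1 0 t x\<bar> \<le> M \<and> \<bar>fst (p t) x\<bar> \<le> M"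
      using p[OF t] M(1) by (meson order_trans)
    have "sqnorm (y2 t) \<le> M\<^sup>2" "sqnorm (snd (p t)) \<le> M\<^sup>2"
      using N2(2)[OF t] p[OF t] M by linarith+
    moreover have "V1 0 t 0 - V2 0 t 0 = 0" "V1 0 t 1 - V2 0 t 1 = 0"
      using bdry[OF t] by simp_all
    ultimately show "flux_coeffs M (\<lambda>x. y1 t x - y2 t x) (V1 0 t) (fst (p t)) (snd (p t)) (y2 t)
        (\<lambda>x. V1 0 t x - V2 0 t x) (\<lambda>x. V1 1 t x - V2 1 t x)"
      unfolding flux_coeffs_def
      using L2_diff[OF L[OF t]] L(2)[OF t] prim_diff[OF pV[OF t]] L2_diff[OF LV(3,4)[OF t]] p[OF t] vM M(7) YM DY
      by blast
  next
    fix s t and g g' :: "real \<Rightarrow> real"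
    assume st: "0 \<le> s" "s \<le> t" "t < T" and g: "\<And>x. (g has_real_derivative g' x) (at x)" "continuous_on UNIV g'"
    have gc: "continuous_on UNIV g"
      by (rule C1_cont[OF g])
    have gu: "continuous_on {0..1} g" "continuous_on {0..1} g'"
      using gc g(2) continuous_on_subset by blast+
    have sT: "s \<in> {0..T}" "t \<in> {0..T}" "t \<le> T" "{s..t} \<subseteq> {0..T}"
      using st by auto
    have test: "0 \<le> s \<and> s \<le> t \<and> t < T \<and> H1_rect s t (\<lambda>t. g) (\<lambda>t x. 0) (\<lambda>t. g') \<and>
        edge_values_are_traces s t (\<lambda>t. g) (\<lambda>t x. 0) (\<lambda>t. g')"
      using st time_independent_H1[OF g] time_independent_traces[OF g] by blast
    define F1 where "F1 \<tau> = (\<integral>x. y1 \<tau> x * V1 0 \<tau> x * g' x - y1 \<tau> x * V1 1 \<tau> x * g x \<partial>U)" for \<tau>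
    define F2 where "F2 \<tau> = (\<integral>x. y2 \<tau> x * V2 0 \<tau> x * g' x - y2 \<tau> x * V2 1 \<tau> x * g x \<partial>U)" for \<tau>
    define N where "N = N1 + N2 + M0"
    have N: "N1 \<le> N" "N2 \<le> N" "M0 \<le> N"
      using N1(1) N2(1) M0(1) by (simp_all add: N_def)
    have NN: "sqnorm (y1 t) \<le> N" "sqnorm (y2 t) \<le> N" "sqnorm (V1 0 t) \<le> N"
        "sqnorm (V1 1 t) \<le> N" "sqnorm (V2 0 t) \<le> N" "sqnorm (V2 1 t) \<le> N"
      if t: "t \<in> {0..T}" for t
      using N1(2)[OF t] N2(2)[OF t] MV[OF t] N by linarith+
    note s1 = weak_equation_sliced[OF meas(1) L(1) measV(1)[OF le0] LV(1) measV(1)[OF n] LV(3) NN(1,3,4) st(1) sT(3) gc g(2)]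
    note s2 = weak_equation_sliced[OF meas(2) L(2) measV(2)[OF le0] LV(2) measV(2)[OF n] LV(4) NN(2,5,6) st(1) sT(3) gc g(2)]
    have iF: "set_integrable lborel {s..t} F1" "set_integrable lborel {s..t} F2"
      unfolding F1_def[abs_def] F2_def[abs_def] using s1(1) s2(1) by simp_all
    define b1 where "b1 \<tau> = yr1 \<tau> * vr \<tau> * g 1 - yl1 \<tau> * vl \<tau> * g 0" for \<tau>
    define b2 where "b2 \<tau> = yr2 \<tau> * vr \<tau> * g 1 - yl2 \<tau> * vl \<tau> * g 0" for \<tau>
    have iy: "set_integrable lborel {s..t} (\<lambda>\<tau>. yr1 \<tau> * vr \<tau>)" "set_integrable lborel {s..t} (\<lambda>\<tau>. yl1 \<tau> * vl \<tau>)"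
        "set_integrable lborel {s..t} (\<lambda>\<tau>. yr2 \<tau> * vr \<tau>)" "set_integrable lborel {s..t} (\<lambda>\<tau>. yl2 \<tau> * vl \<tau>)"
      by (rule set_integrable_subset[OF Linf_mult_continuous_integrable _ sT(4)], rule lin, rule vlc vrc, simp)+
    have ib: "set_integrable lborel {s..t} b1" "set_integrable lborel {s..t} b2"
      unfolding b1_def[abs_def] b2_def[abs_def]
      by (intro set_integral_diff(1) set_integrable_mult_left iy; simp)+
    have e1: "(LINT \<tau>:{s..t}|lborel. F1 \<tau>) = (LINT \<tau>:{s..t}|lborel. b1 \<tau>) + (\<integral>x. g x * y1 t x \<partial>U) - (\<integral>x. g x * y1 s x \<partial>U)"
      using eq1[OF test] s1(2) unfolding F1_def b1_def integral_U by simp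
    have e2: "(LINT \<tau>:{s..t}|lborel. F2 \<tau>) = (LINT \<tau>:{s..t}|lborel. b2 \<tau>) + (\<integral>x. g x * y2 t x \<partial>U) - (\<integral>x. g x * y2 s x \<partial>U)"
      using eq2[OF test] s2(2) unfolding F2_def b2_def integral_U by simp
    \<comment> \<open>The representative \<open>fst (p \<tau>)\<close> was chosen separately for
      each time, with no control of its dependence on time. Integrability of the flux in time is
      therefore obtained from \<open>F1 - F2\<close>, which involves only the jointly measurable
      \<open>V1\<close> and \<open>V2\<close>.\<close>
    have flux: "flux (\<lambda>x. y1 \<tau> x - y2 \<tau> x) (V1 0 \<tau>) (fst (p \<tau>)) (y2 \<tau>) (\<lambda>x. V1 0 \<tau> x - V2 0 \<tau> x)
        (\<lambda>x. V1 1 \<tau> x - V2 1 \<tau> x) g g' = F1 \<tau> - F2 \<tau>" if \<tau>: "\<tau> \<in> {s..t}" for \<tau>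
    proof -
      have \<tau>T: "\<tau> \<in> {0..T}" using \<tau> sT(4) by blast
      have i1: "integrable U (\<lambda>x. y1 \<tau> x * V1 0 \<tau> x * g' x - y1 \<tau> x * V1 1 \<tau> x * g x)"
        by (intro Bochner_Integration.integrable_diff integrable_mult_continuous gu L2_mult_integrable L(1) LV(1,3) \<tau>T)
      have i2: "integrable U (\<lambda>x. y2 \<tau> x * V2 0 \<tau> x * g' x - y2 \<tau> x * V2 1 \<tau> x * g x)"
        by (intro Bochner_Integration.integrable_diff integrable_mult_continuous gu L2_mult_integrable L(2) LV(2,4) \<tau>T)
      have pm: "prim (V1 0 \<tau>) (fst (p \<tau>))" "prim (fst (p \<tau>)) (snd (p \<tau>))" "AE x in U. V1 1 \<tau> x = fst (p \<tau>) x"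
        using p[OF \<tau>T] by blast+
      have Lf: "L2 (fst (p \<tau>))"
        by (rule continuous_L2[OF prim_continuous[OF pm(2)]])
      have "F1 \<tau> - F2 \<tau> = (\<integral>x. (y1 \<tau> x * V1 0 \<tau> x * g' x - y1 \<tau> x * V1 1 \<tau> x * g x)
          - (y2 \<tau> x * V2 0 \<tau> x * g' x - y2 \<tau> x * V2 1 \<tau> x * g x) \<partial>U)"
        unfolding F1_def F2_def by (rule Bochner_Integration.integral_diff[OF i1 i2, symmetric])
      also have "\<dots> = flux (\<lambda>x. y1 \<tau> x - y2 \<tau> x) (V1 0 \<tau>) (fst (p \<tau>)) (y2 \<tau>) (\<lambda>x. V1 0 \<tau> x - V2 0 \<tau> x)
        (\<lambda>x. V1 1 \<tau> x - V2 1 \<tau> x) g g'"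
        unfolding flux_def
      proof (rule integral_cong_AE)
        show "(\<lambda>x. (y1 \<tau> x * V1 0 \<tau> x * g' x - y1 \<tau> x * V1 1 \<tau> x * g x)
          - (y2 \<tau> x * V2 0 \<tau> x * g' x - y2 \<tau> x * V2 1 \<tau> x * g x)) \<in> borel_measurable U"
          by (rule borel_measurable_integrable[OF Bochner_Integration.integrable_diff[OF i1 i2]])
        note LY = L2_diff[OF L[OF \<tau>T]] and Ly2 = L(2)[OF \<tau>T]
        show "(\<lambda>x. ((y1 \<tau> x - y2 \<tau> x) * V1 0 \<tau> x + y2 \<tau> x * (V1 0 \<tau> x - V2 0 \<tau> x)) * g' x -
          ((y1 \<tau> x - y2 \<tau> x) * fst (p \<tau>) x + y2 \<tau> x * (V1 1 \<tau> x - V2 1 \<tau> x)) * g x) \<in> borel_measurable U"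
          by (intro borel_measurable_integrable Bochner_Integration.integrable_diff[OF
              integrable_mult_continuous[OF Bochner_Integration.integrable_add[OF
                L2_mult_integrable[OF LY LV(1)[OF \<tau>T]]
                L2_mult_integrable[OF Ly2 L2_diff[OF LV(1,2)[OF \<tau>T]]]] gu(2)]
              integrable_mult_continuous[OF Bochner_Integration.integrable_add[OF
                L2_mult_integrable[OF LY Lf]
                L2_mult_integrable[OF Ly2 L2_diff[OF LV(3,4)[OF \<tau>T]]]] gu(1)]])
        show "AE x in U. (y1 \<tau> x * V1 0 \<tau> x * g' x - y1 \<tau> x * V1 1 \<tau> x * g x)
          - (y2 \<tau> x * V2 0 \<tau> x * g' x - y2 \<tau> x * V2 1 \<tau> x * g x) =
          ((y1 \<tau> x - y2 \<tau> x) * V1 0 \<tau> x + y2 \<tau> x * (V1 0 \<tau> x - V2 0 \<tau> x)) * g' x -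
          ((y1 \<tau> x - y2 \<tau> x) * fst (p \<tau>) x + y2 \<tau> x * (V1 1 \<tau> x - V2 1 \<tau> x)) * g x"
          using pm(3)
        proof eventually_elim
          case (elim x)
          show ?case
            unfolding elim[symmetric] by (simp add: algebra_simps)
        qed
      qed
      finally show ?thesis ..
    qed
    let ?flux = "\<lambda>\<tau>. flux (\<lambda>x. y1 \<tau> x - y2 \<tau> x) (V1 0 \<tau>) (fst (p \<tau>)) (y2 \<tau>) (\<lambda>x. V1 0 \<tau> x - V2 0 \<tau> x)
        (\<lambda>x. V1 1 \<tau> x - V2 1 \<tau> x) g g'"
    have "set_integrable lborel {s..t} ?flux \<longleftrightarrow> set_integrable lborel {s..t} (\<lambda>\<tau>. F1 \<tau> - F2 \<tau>)"
      by (rule set_integrable_cong) (use flux in auto)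
    then have int: "set_integrable lborel {s..t} ?flux"
      using set_integral_diff(1)[OF iF] by blast
    have "(LINT \<tau>:{s..t}|lborel. ?flux \<tau>) = (LINT \<tau>:{s..t}|lborel. F1 \<tau> - F2 \<tau>)"
      by (rule set_lebesgue_integral_cong) (use flux in auto)
    also have "\<dots> = (LINT \<tau>:{s..t}|lborel. F1 \<tau>) - (LINT \<tau>:{s..t}|lborel. F2 \<tau>)"
      by (rule set_integral_diff(2)[OF iF])
    also have "\<dots> = (LINT \<tau>:{s..t}|lborel. b1 \<tau>) - (LINT \<tau>:{s..t}|lborel. b2 \<tau>)
        + ((\<integral>x. g x * y1 t x \<partial>U) - (\<integral>x. g x * y1 s x \<partial>U) - (\<integral>x. g x * y2 t x \<partial>U) + (\<integral>x. g x * y2 s x \<partial>U))"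
      unfolding e1 e2 by simp
    also have "(LINT \<tau>:{s..t}|lborel. b1 \<tau>) - (LINT \<tau>:{s..t}|lborel. b2 \<tau>) = (LINT \<tau>:{s..t}|lborel. b1 \<tau> - b2 \<tau>)"
      by (rule set_integral_diff(2)[OF ib, symmetric])
    also have "\<dots> = (LINT \<tau>:{s..t}|lborel. (yr1 \<tau> * vr \<tau> - yr2 \<tau> * vr \<tau>) * g 1 - (yl1 \<tau> * vl \<tau> - yl2 \<tau> * vl \<tau>) * g 0)"
      by (rule set_lebesgue_integral_cong) (auto simp: b1_def b2_def algebra_simps)
    also have "(\<integral>x. g x * y1 t x \<partial>U) - (\<integral>x. g x * y1 s x \<partial>U) - (\<integral>x. g x * y2 t x \<partial>U) + (\<integral>x. g x * y2 s x \<partial>U)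
        = (\<integral>x. ((y1 t x - y2 t x) - (y1 s x - y2 s x)) * g x \<partial>U)"
    proof -
      have i: "integrable U (\<lambda>x. g x * y1 t x)" "integrable U (\<lambda>x. g x * y1 s x)"
          "integrable U (\<lambda>x. g x * y2 t x)" "integrable U (\<lambda>x. g x * y2 s x)"
        by (intro L2_mult_integrable continuous_L2[OF gu(1)] L sT)+
      have "(\<integral>x. ((y1 t x - y2 t x) - (y1 s x - y2 s x)) * g x \<partial>U)
        = (\<integral>x. g x * y1 t x - g x * y1 s x - g x * y2 t x + g x * y2 s x \<partial>U)"
        by (rule Bochner_Integration.integral_cong) (auto simp: algebra_simps)
      then show ?thesis
        using i by simp
    qed
    finally show "set_integrable lborel {s..t} ?flux \<and> (LINT \<tau>:{s..t}|lborel. ?flux \<tau>) =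
      (LINT \<tau>:{s..t}|lborel. (yr1 \<tau> * vr \<tau> - yr2 \<tau> * vr \<tau>) * g 1 - (yl1 \<tau> * vl \<tau> - yl2 \<tau> * vl \<tau>) * g 0)
      + (\<integral>x. ((y1 t x - y2 t x) - (y1 s x - y2 s x)) * g x \<partial>U)"
      by (rule conjI[OF int])
  next
    have "AE t in lborel. t \<in> Gamma_l T vl \<longrightarrow> yl1 t = ylc t" "AE t in lborel. t \<in> Gamma_l T vl \<longrightarrow> yl2 t = ylc t"
      using sol1 sol2 unfolding weak_solution_def ae_eq_on_def by blast+
    then show "AE t in lborel. t \<in> {0..T} \<longrightarrow> 0 < V1 0 t 0 \<longrightarrow> yl1 t * vl t - yl2 t * vl t = 0"
      by eventually_elim (auto simp: Gamma_l_def bdry)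
    have "AE t in lborel. t \<in> Gamma_r T vr \<longrightarrow> yr1 t = yrc t" "AE t in lborel. t \<in> Gamma_r T vr \<longrightarrow> yr2 t = yrc t"
      using sol1 sol2 unfolding weak_solution_def ae_eq_on_def by blast+
    then show "AE t in lborel. t \<in> {0..T} \<longrightarrow> V1 0 t 1 < 0 \<longrightarrow> yr1 t * vr t - yr2 t * vr t = 0"
      by eventually_elim (auto simp: Gamma_r_def bdry)
    show "continuous_on {0..T} (\<lambda>t. V1 0 t 0)"
      by (rule continuous_on_eq[OF vlc]) (simp add: bdry)
    show "continuous_on {0..T} (\<lambda>t. V1 0 t 1)"
      by (rule continuous_on_eq[OF vrc]) (simp add: bdry)
    show "finite {t \<in> {0..T}. V1 0 t 0 = 0 \<or> V1 0 t 1 = 0}"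
      by (rule finite_subset[OF _ finite_UnI[OF zeros]]) (auto simp: bdry)
    have "AE x in U. y1 0 x = y0 x" "AE x in U. y2 0 x = y0 x"
      using sol1 sol2 unfolding weak_solution_def ae_eq_on_def AE_U by blast+
    then have "AE x in U. (y1 0 x - y2 0 x)\<^sup>2 = 0"
      by eventually_elim simp
    then show "(\<integral>x. (y1 0 x - y2 0 x)\<^sup>2 \<partial>U) = 0"
      by (rule integral_eq_zero_AE)
  qed
  then show thesis
    by (rule that)
qed

theorem theorem1p12:
  fixes T :: real and n :: nat
    and vl vr y0 yrc ylc yr1 yl1 yr2 yl2 :: "real \<Rightarrow> real"
    and bvl bvr :: "nat \<Rightarrow> real \<Rightarrow> real"
    and y1 y2 :: "real \<Rightarrow> real \<Rightarrow> real"
  assumes "T > 0" and "n \<ge> 1"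
    and "CH_data T n vl vr y0 bvl bvr yrc ylc"
    and "weak_solution T n vl vr y0 bvl bvr yrc ylc y1 yr1 yl1"
    and "weak_solution T n vl vr y0 bvl bvr yrc ylc y2 yr2 yl2"
  shows "(\<forall>t\<in>{0..T}. ae_eq_on {0<..<1} (y1 t) (y2 t)) \<and>
    ae_eq_on {0..T} yr1 yr2 \<and> ae_eq_on {0..T} yl1 yl2"
proof -
  obtain M v v' v'' D D' where dp: "difference_problem T M (\<lambda>t x. y1 t x - y2 t x) v v' v'' y2 D D'
      (\<lambda>t. yl1 t * vl t - yl2 t * vl t) (\<lambda>t. yr1 t * vr t - yr2 t * vr t)"
    using weak_solution_difference[OF assms] by blast
  interpret difference_problem T M "\<lambda>t x. y1 t x - y2 t x" v v' v'' y2 D D'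
      "\<lambda>t. yl1 t * vl t - yl2 t * vl t" "\<lambda>t. yr1 t * vr t - yr2 t * vr t"
    by (rule dp)
  have "ae_eq_on {0<..<1} (y1 t) (y2 t)" if t: "t \<in> {0..T}" for t
  proof -
    have "AE x in U. (y1 t x - y2 t x)\<^sup>2 = 0"
      using integral_nonneg_eq_0_iff_AE[OF L2_square[OF Y_L2[OF t]]] difference_zero[OF t] by simp
    then have "AE x in U. y1 t x = y2 t x"
      by eventually_elim simp
    then show ?thesis
      unfolding ae_eq_on_def AE_U .
  qed
  \<comment> \<open>The boundary integral only sees the traces multiplied by the boundary velocity
    \<open>w\<close>. Its finitely many zeros form a null set, and elsewhere the factor
    cancels.\<close>
  moreover have "ae_eq_on {0..T} f1 f2"
    if f: "Linf_on {0..T} f1" "Linf_on {0..T} f2" and w: "continuous_on {0..T} w" "finite {t \<in> {0..T}. w t = 0}"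
      and zero: "\<And>t. 0 \<le> t \<Longrightarrow> t < T \<Longrightarrow> (LINT \<tau>:{0..t}|lborel. f1 \<tau> * w \<tau> - f2 \<tau> * w \<tau>) = 0" for f1 f2 w
  proof -
    have "set_integrable lborel {0..T} (\<lambda>\<tau>. f1 \<tau> * w \<tau> - f2 \<tau> * w \<tau>)"
      by (intro set_integral_diff(1) Linf_mult_continuous_integrable f w)
    from AE_zero_if_initial_integrals_zero[OF this zero]
    have "AE \<tau> in lborel. \<tau> \<in> {0..T} \<longrightarrow> f1 \<tau> * w \<tau> - f2 \<tau> * w \<tau> = 0" .
    moreover have "AE \<tau> in lborel. \<tau> \<notin> {t \<in> {0..T}. w t = 0}"
      by (rule AE_not_in[OF finite_imp_null_set_lborel[OF w(2)]])
    ultimately show ?thesis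
      unfolding ae_eq_on_def by eventually_elim auto
  qed
  note trace = this
  have lin: "Linf_on {0..T} yr1" "Linf_on {0..T} yl1" "Linf_on {0..T} yr2" "Linf_on {0..T} yl2"
    using assms(4,5) unfolding weak_solution_def by blast+
  have w: "continuous_on {0..T} vl" "continuous_on {0..T} vr"
      "finite {t \<in> {0..T}. vl t = 0}" "finite {t \<in> {0..T}. vr t = 0}"
    using assms(3) unfolding CH_data_def by blast+
  have "ae_eq_on {0..T} yr1 yr2"
  proof (rule trace)
    \<comment> \<open>The test function \<open>x\<close> vanishes at the left end and isolates the
      right one.\<close>
    show "(LINT \<tau>:{0..t}|lborel. yr1 \<tau> * vr \<tau> - yr2 \<tau> * vr \<tau>) = 0" if "0 \<le> t" "t < T" for t
      using boundary_flux_zero[OF that, of "\<lambda>x. x" "\<lambda>x. 1"] by simp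
  qed (rule lin w)+
  moreover have "ae_eq_on {0..T} yl1 yl2"
  proof (rule trace)
    show "(LINT \<tau>:{0..t}|lborel. yl1 \<tau> * vl \<tau> - yl2 \<tau> * vl \<tau>) = 0" if "0 \<le> t" "t < T" for t
    proof -
      \<comment> \<open>Vanishing at the right end, \<open>x - 1\<close> isolates the left one; its
        value -1 at 0 cancels the sign of the left flux.\<close>
      have "((\<lambda>x. x - 1) has_real_derivative 1) (at x)" for x :: real
        by (auto intro!: derivative_eq_intros)
      from boundary_flux_zero[OF that this] show ?thesis by simp
    qed
  qed (rule lin w)+
  ultimately show ?thesis
    by blast
qed

end
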